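(* Let $1<p_1,\dots,p_n<+\infty$ with $\sum_{i=1}^n\frac1{p_i}>1$, let $\frac1p=\frac1n\sum_{i=1}^n\frac1{p_i}$, $p^*=\frac{np}{n-p}$, $p'=\frac p{p-1}$, $n'=\frac n{n-1}$, let $V$ satisfy (a) and (b) of the context, and let $f\in L^1(\Omega)$. Let $u$ be the entropic-renormalized solution of $$-\sum_{i=1}^n\frac{\partial}{\partial x_i}\left(\Big|\frac{\partial u}{\partial x_i}\Big|^{p_i-2}\frac{\partial u}{\partial x_i}\right)+V(x;u)=f\ \text{ in }\Omega,\qquad u=0\ \text{ on }\partial\Omega .$$ Then there exists a constant $c>0$ independent of $u$ and $f$ such that: 1. $\operatorname{meas}\{|u|>k\}\leq c\,\|f\|_{L^1(\Omega)}^{\frac{p^*}p}\,k^{-\frac{p^*}{p'}}$ for all $k>0$; 2. $\displaystyle\Big\|\frac{\partial u}{\partial x_i}\Big\|_{L^{\frac{n'p_i}{p'},\infty}(\Omega)}\leq c\,\|f\|_{L^1(\Omega)}^{\frac{p'}{p_i}}$ for $i=1,\dots,n$.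
   Context: $\Omega\subset\mathbb R^n$ ($n\ge2$) is a bounded smooth domain, $\vec p=(p_1,\dots,p_n)$. $V:\Omega\times\mathbb R\to\mathbb R$ is a Carathéodory function such that (a) for every $\sigma\in\mathbb R$, $x\mapsto V(x;\sigma)$ is in $L^\infty(\Omega)$; (b) for a.e. $x\in\Omega$, $\sigma\mapsto V(x;\sigma)$ is continuous and non-decreasing with $V(x;0)=0$. $W_0^{1,\vec p}(\Omega)=\{\varphi\in W^{1,1}_0(\Omega):\partial_i\varphi\in L^{p_i}(\Omega),\ i=1,\dots,n\}$. With $T_k(\sigma)=\{|k+\sigma|-|k-\sigma|\}/2$, $\mathbb S_0^{1,\vec p}$ is the set of measurable $v:\Omega\to\mathbb R$ with $\tan^{-1}(v)\in W_0^{1,1}(\Omega)$, $T_k(v)\in W_0^{1,\vec p}(\Omega)$ for all $k>0$ and $\sup_{k>0}\max_{1\leq i\leq n}k^{-1/p_i}\|\partial_iT_k(v)\|_{L^{p_i}}<+\infty$; for such $v$, $\nabla v$ is defined a.e. (by $\nabla T_k(v)=\nabla v$ a.e. on $\{|v|<k\}$). For $\xi\in\mathbb R^n$ put $\widehat a_{\vec p}(\xi)=(|\xi_1|^{p_1-2}\xi_1,\dots,|\xi_n|^{p_n-2}\xi_n)$. For $f\in L^1(\Omega)$, $u$ is an entropic-renormalized solution of the Dirichlet problem $$-\sum_{j=1}^n\frac{\partial}{\partial x_j}\left(\Big|\frac{\partial u}{\partial x_j}\Big|^{p_j-2}\frac{\partial u}{\partial x_j}\right)+V(x;u)=f\ \text{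 in }\Omega,\qquad u=0\ \text{ on }\partial\Omega,$$ if: (1) $u\in\mathbb S_0^{1,\vec p}$ and $V(\cdot,u)\in L^1(\Omega)$; (2) for all $\eta\in W^{1,\infty}(\Omega)$, all $\varphi\in W_0^{1,\vec p}(\Omega)\cap L^\infty(\Omega)$ and all $B\in W^{1,\infty}(\mathbb R)$ with $B(0)=0$, $B'(\sigma)=0$ for $|\sigma|\geq\sigma_0$ (some $\sigma_0>0$), $$\int_\Omega\widehat a_{\vec p}(\nabla u)\cdot\nabla(\eta B(u-\varphi))\,dx+\int_\Omega V(x;u)\eta B(u-\varphi)\,dx=\int_\Omega f\eta B(u-\varphi)\,dx.$$ Such a solution exists and is unique. For $0<q<\infty$, $L^{q,\infty}(\Omega)$ is the Marcinkiewicz space with quasi-norm $\|v\|_{L^{q,\infty}}=\sup_{\lambda>0}\lambda\,\operatorname{meas}\{|v|>\lambda\}^{1/q}$. *)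

theory Defs
  imports "HOL-Analysis.Analysis"
begin

text \<open>All function spaces consist of functions on the whole space whose values outside
  \<open>\<Omega>\<close> are irrelevant; equality in these spaces is equality almost everywhere on \<open>\<Omega>\<close>.\<close>

section \<open>Smooth functions and smooth domains\<close>

text \<open>Intended for open \<open>S\<close>.\<close>

primrec Ck_on :: "nat \<Rightarrow> 'a::euclidean_space set \<Rightarrow> ('a \<Rightarrow> 'b::real_normed_vector) \<Rightarrow> bool" where
  "Ck_on 0 S f \<longleftrightarrow> continuous_on S f"
| "Ck_on (Suc k) S f \<longleftrightarrow> f differentiable_on S \<and>
     (\<forall>b\<in>Basis. Ck_on k S (\<lambda>x. frechet_derivative f (at x) b))"

definition smooth_on :: "'a::euclidean_space set \<Rightarrow> ('a \<Rightarrow> 'b::real_normed_vector) \<Rightarrow> bool" where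
  "smooth_on S f \<longleftrightarrow> (\<forall>k. Ck_on k S f)"

text \<open>The boundary is smooth if near each of its points a smooth diffeomorphism straightens it,
  mapping \<open>\<Omega>\<close> to one side of a coordinate hyperplane.\<close>

definition smooth_boundary :: "'a::euclidean_space set \<Rightarrow> bool" where
  "smooth_boundary \<Omega> \<longleftrightarrow> (\<forall>x0\<in>frontier \<Omega>. \<exists>U D. \<exists>(\<psi>::'a \<Rightarrow> 'a) \<theta>. \<exists>b\<in>Basis.
     open U \<and> x0 \<in> U \<and> open D \<and> homeomorphism U D \<psi> \<theta> \<and> smooth_on U \<psi> \<and> smooth_on D \<theta> \<and>
     \<psi> ` (U \<inter> \<Omega>) = {y\<in>D. y \<bullet> b > 0} \<and> \<psi> ` (U \<inter> frontier \<Omega>) = {y\<in>D. y \<bullet> b = 0})"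

definition bounded_smooth_domain :: "'a::euclidean_space set \<Rightarrow> bool" where
  "bounded_smooth_domain \<Omega> \<longleftrightarrow>
     \<Omega> \<noteq> {} \<and> open \<Omega> \<and> connected \<Omega> \<and> bounded \<Omega> \<and> smooth_boundary \<Omega>"

section \<open>Lebesgue and Marcinkiewicz spaces\<close>

definition Lp :: "'a::euclidean_space set \<Rightarrow> real \<Rightarrow> ('a \<Rightarrow> real) set" where
  "Lp \<Omega> q = {v \<in> borel_measurable (lebesgue_on \<Omega>).
     integrable (lebesgue_on \<Omega>) (\<lambda>x. \<bar>v x\<bar> powr q)}"

definition Lp_norm :: "'a::euclidean_space set \<Rightarrow> real \<Rightarrow> ('a \<Rightarrow> real) \<Rightarrow> real" where
  "Lp_norm \<Omega> q v = (\<integral>x. \<bar>v x\<bar> powr q \<partial>lebesgue_on \<Omega>) powr (1 / q)"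

definition Linf :: "'a::euclidean_space set \<Rightarrow> ('a \<Rightarrow> real) set" where
  "Linf \<Omega> = {v \<in> borel_measurable (lebesgue_on \<Omega>).
     \<exists>C. AE x in lebesgue_on \<Omega>. \<bar>v x\<bar> \<le> C}"

definition meas_gt :: "'a::euclidean_space set \<Rightarrow> ('a \<Rightarrow> real) \<Rightarrow> real \<Rightarrow> real" where
  "meas_gt \<Omega> v l = measure (lebesgue_on \<Omega>) {x\<in>\<Omega>. \<bar>v x\<bar> > l}"

text \<open>Extended valued, so that an upper bound includes membership in \<open>L\<^sup>q\<^sup>,\<^sup>\<infinity>\<close>; the measure
  itself is finite for bounded \<open>\<Omega>\<close>.\<close>

definition weak_Lp_norm :: "'a::euclidean_space set \<Rightarrow> real \<Rightarrow> ('a \<Rightarrow> real) \<Rightarrow> ennreal" where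
  "weak_Lp_norm \<Omega> q v = (SUP l\<in>{0<..}. ennreal (l * meas_gt \<Omega> v l powr (1 / q)))"

section \<open>Weak derivatives and Sobolev spaces\<close>

definition test_functions :: "'a::euclidean_space set \<Rightarrow> ('a \<Rightarrow> real) set" where
  "test_functions \<Omega> = {\<phi>. smooth_on UNIV \<phi> \<and>
     compact (closure {x. \<phi> x \<noteq> 0}) \<and> closure {x. \<phi> x \<noteq> 0} \<subseteq> \<Omega>}"

definition L1_loc :: "'a::euclidean_space set \<Rightarrow> ('a \<Rightarrow> real) set" where
  "L1_loc \<Omega> = {v. \<forall>K. compact K \<and> K \<subseteq> \<Omega> \<longrightarrow> integrable (lebesgue_on K) v}"

definition has_weak_deriv ::
    "'a::euclidean_space set \<Rightarrow> 'a \<Rightarrow> ('a \<Rightarrow> real) \<Rightarrow> ('a \<Rightarrow> real) \<Rightarrow> bool" where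
  "has_weak_deriv \<Omega> e v g \<longleftrightarrow> v \<in> L1_loc \<Omega> \<and> g \<in> L1_loc \<Omega> \<and>
     (\<forall>\<phi>\<in>test_functions \<Omega>.
        (\<integral>x. v x * frechet_derivative \<phi> (at x) e \<partial>lebesgue_on \<Omega>)
          = - (\<integral>x. g x * \<phi> x \<partial>lebesgue_on \<Omega>))"

text \<open>A version of the weak derivative in direction \<open>e\<close>; unique almost everywhere on \<open>\<Omega>\<close> if
  one exists.\<close>

definition weak_deriv :: "'a::euclidean_space set \<Rightarrow> 'a \<Rightarrow> ('a \<Rightarrow> real) \<Rightarrow> 'a \<Rightarrow> real" where
  "weak_deriv \<Omega> e v = (SOME g. has_weak_deriv \<Omega> e v g)"

definition weak_grad :: "(real^'n) set \<Rightarrow> (real^'n \<Rightarrow> real) \<Rightarrow> real^'n \<Rightarrow> real^'n" where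
  "weak_grad \<Omega> v x = (\<chi> i. weak_deriv \<Omega> (axis i 1) v x)"

definition W11 :: "'a::euclidean_space set \<Rightarrow> ('a \<Rightarrow> real) set" where
  "W11 \<Omega> = {v \<in> Lp \<Omega> 1. \<forall>e\<in>Basis. \<exists>g\<in>Lp \<Omega> 1. has_weak_deriv \<Omega> e v g}"

definition W1inf :: "'a::euclidean_space set \<Rightarrow> ('a \<Rightarrow> real) set" where
  "W1inf \<Omega> = {v \<in> Linf \<Omega>. \<forall>e\<in>Basis. \<exists>g\<in>Linf \<Omega>. has_weak_deriv \<Omega> e v g}"

text \<open>The closure of the test functions in \<open>W11 \<Omega>\<close>.\<close>

definition W11_0 :: "'a::euclidean_space set \<Rightarrow> ('a \<Rightarrow> real) set" where
  "W11_0 \<Omega> = {v \<in> W11 \<Omega>. \<exists>\<phi>. (\<forall>j. \<phi> j \<in> test_functions \<Omega>) \<and>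
     (\<lambda>j. Lp_norm \<Omega> 1 (\<lambda>x. \<phi> j x - v x)) \<longlonglongrightarrow> 0 \<and>
     (\<forall>e\<in>Basis. (\<lambda>j. Lp_norm \<Omega> 1
        (\<lambda>x. frechet_derivative (\<phi> j) (at x) e - weak_deriv \<Omega> e v x)) \<longlonglongrightarrow> 0)}"

definition W1p_0 :: "(real^'n) set \<Rightarrow> real^'n \<Rightarrow> (real^'n \<Rightarrow> real) set" where
  "W1p_0 \<Omega> p = {v \<in> W11_0 \<Omega>. \<forall>i. weak_deriv \<Omega> (axis i 1) v \<in> Lp \<Omega> (p$i)}"

section \<open>Entropic-renormalized solutions\<close>

definition trunc :: "real \<Rightarrow> real \<Rightarrow> real" where
  "trunc k s = (\<bar>k + s\<bar> - \<bar>k - s\<bar>) / 2"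

definition S1p_0 :: "(real^'n) set \<Rightarrow> real^'n \<Rightarrow> (real^'n \<Rightarrow> real) set" where
  "S1p_0 \<Omega> p = {v \<in> borel_measurable (lebesgue_on \<Omega>).
     (\<lambda>x. arctan (v x)) \<in> W11_0 \<Omega> \<and>
     (\<forall>k>0. (\<lambda>x. trunc k (v x)) \<in> W1p_0 \<Omega> p) \<and>
     (\<exists>C. \<forall>k>0. \<forall>i. k powr (- 1 / p$i) *
        Lp_norm \<Omega> (p$i) (weak_deriv \<Omega> (axis i 1) (\<lambda>x. trunc k (v x))) \<le> C)}"

text \<open>The almost everywhere defined gradient of a function in \<open>S1p_0 \<Omega> p\<close>, which need not be
  weakly differentiable itself.\<close>

definition trunc_grad :: "(real^'n) set \<Rightarrow> (real^'n \<Rightarrow> real) \<Rightarrow> real^'n \<Rightarrow> real^'n" where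
  "trunc_grad \<Omega> v = (SOME G. G \<in> borel_measurable (lebesgue_on \<Omega>) \<and>
     (\<forall>k>0. AE x in lebesgue_on \<Omega>.
        \<bar>v x\<bar> < k \<longrightarrow> G x = weak_grad \<Omega> (\<lambda>y. trunc k (v y)) x))"

definition a_hat :: "real^'n \<Rightarrow> real^'n \<Rightarrow> real^'n" where
  "a_hat p \<xi> = (\<chi> i. \<bar>\<xi>$i\<bar> powr (p$i - 2) * \<xi>$i)"

text \<open>The Caratheodory property is the measurability contained in \<open>Linf\<close> together with the
  continuity in the second argument.\<close>

definition admissible_potential ::
    "'a::euclidean_space set \<Rightarrow> ('a \<Rightarrow> real \<Rightarrow> real) \<Rightarrow> bool" where
  "admissible_potential \<Omega> V \<longleftrightarrow>
     (\<forall>s. (\<lambda>x. V x s) \<in> Linf \<Omega>) \<and>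
     (AE x in lebesgue_on \<Omega>. continuous_on UNIV (V x) \<and> mono (V x) \<and> V x 0 = 0)"

text \<open>Elements of \<open>W1inf UNIV\<close> on the line are evaluated pointwise, hence the choice of the
  continuous representative.\<close>

definition renormalizations :: "(real \<Rightarrow> real) set" where
  "renormalizations = {B \<in> W1inf UNIV. continuous_on UNIV B \<and> B 0 = 0 \<and>
     (\<exists>s0>0. AE s in lebesgue. \<bar>s\<bar> \<ge> s0 \<longrightarrow> weak_deriv UNIV 1 B s = 0)}"

text \<open>The integrability of the flux term is part of the meaning of the identity; it is not
  automatic where \<open>\<eta>\<close> is not constant, since \<open>B\<close> need not vanish at infinity. The other two
  integrands are integrable, being products of integrable and bounded functions.\<close>

definition entropic_renormalized_solution ::
    "(real^'n) set \<Rightarrow> real^'n \<Rightarrow> (real^'n \<Rightarrow> real \<Rightarrow> real) \<Rightarrow> (real^'n \<Rightarrow> real)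
      \<Rightarrow> (real^'n \<Rightarrow> real) \<Rightarrow> bool" where
  "entropic_renormalized_solution \<Omega> p V f u \<longleftrightarrow>
     u \<in> S1p_0 \<Omega> p \<and> (\<lambda>x. V x (u x)) \<in> Lp \<Omega> 1 \<and>
     (\<forall>\<eta>\<in>W1inf \<Omega>. \<forall>\<phi>\<in>W1p_0 \<Omega> p \<inter> Linf \<Omega>. \<forall>B\<in>renormalizations.
        integrable (lebesgue_on \<Omega>)
          (\<lambda>x. a_hat p (trunc_grad \<Omega> u x) \<bullet> weak_grad \<Omega> (\<lambda>y. \<eta> y * B (u y - \<phi> y)) x) \<and>
        (\<integral>x. a_hat p (trunc_grad \<Omega> u x) \<bullet> weak_grad \<Omega> (\<lambda>y. \<eta> y * B (u y - \<phi> y)) x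
            \<partial>lebesgue_on \<Omega>)
          + (\<integral>x. V x (u x) * \<eta> x * B (u x - \<phi> x) \<partial>lebesgue_on \<Omega>)
          = (\<integral>x. f x * \<eta> x * B (u x - \<phi> x) \<partial>lebesgue_on \<Omega>))"

end

theory Submission
  imports Defs
begin

text \<open>Write \<open>T\<^sub>k\<close> for \<open>trunc k\<close>, \<open>M = \<parallel>f\<parallel>\<close> for the norm of \<open>f\<close> in \<open>L\<^sup>1\<close> and \<open>S = \<Sum>1/p\<^sub>i\<close>, so
  that the harmonic mean of the exponents is \<open>q = n/S\<close> and \<open>1 < S < n\<close>.

  The equation is tested with \<open>T\<^sub>k(u)\<close>, that is with \<open>\<eta> = 1\<close>, \<open>\<phi> = 0\<close> and \<open>B = T\<^sub>k\<close>. The potential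
  contributes a nonnegative term, because \<open>V(x,\<cdot>)\<close> is monotone and vanishes at 0, and what remains is
  the energy bound \<open>\<integral>|\<partial>\<^sub>iT\<^sub>k(u)| powr p\<^sub>i \<le> k M\<close> for every \<open>i\<close> (\<open>energy_estimate\<close>). The anisotropic Sobolev
  inequality (\<open>anisotropic_sobolev\<close>) converts it into a bound on \<open>\<integral>|T\<^sub>k(u)|\<^sup>s\<close> with \<open>s = n/(S-1)\<close>,
  the Sobolev exponent of \<open>q\<close>. As \<open>|T\<^sub>k(u)| = k\<close> where \<open>|u| > k\<close>, the first estimate
  is Chebyshev's inequality. For the second one, \<open>{|\<partial>\<^sub>iu| > l}\<close> is covered, up to a null set, by
  \<open>{|u| > k/2}\<close> and \<open>{|\<partial>\<^sub>iT\<^sub>k(u)| > l}\<close>; the first set is controlled by the first estimate, the second one by the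
  energy, and \<open>k\<close> is chosen so that the two bounds coincide (\<open>level_balance\<close>).

  The Sobolev inequality needs care: elements of \<open>W1p_0 \<Omega> p\<close> are limits of test functions in
  \<open>W\<^sup>1\<^sup>,\<^sup>1\<close> only, so an inequality for test functions that involves the \<open>p\<^sub>i\<close>-norms of the
  derivatives does not pass to the limit. What does pass to the limit is the
  inequality \<open>(\<integral>(\<Prod>|v\<^sub>b|)^(1/(n-1)))^(n-1) \<le> \<Prod>\<integral>|\<partial>\<^sub>bv\<^sub>b|\<close>, in which every direction \<open>b\<close> carries its own function
  \<open>v\<^sub>b\<close> (\<open>gagliardo_L1_deriv_limit\<close>). For bounded \<open>v\<close> the chain rule allows the choice of
  the signed powers of \<open>v\<close> with exponents \<open>\<gamma>\<^sub>b = 1 + s - s/p\<^sub>b\<close>. These are the exponents for which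
  the integrand on the left is \<open>|v|\<^sup>s\<close> and Hoelder's inequality produces \<open>|v|\<^sup>s\<close>
  again on the right, so that the powers of \<open>\<integral>|v|\<^sup>s\<close> can be absorbed.

  The inequality for smooth functions follows from the fundamental theorem of calculus on lines and the
  Loomis-Whitney inequality (\<open>loomis_whitney_nn\<close>). Finally, a weak derivative is an arbitrary choice
  among functions that agree almost everywhere (\<open>weak_deriv_AE_eq\<close>), and it vanishes
  almost everywhere on level sets (\<open>L1_deriv_limit_level_set\<close>). Therefore the derivatives of the
  truncations of \<open>u\<close> at different levels are compatible, which gives \<open>trunc_grad\<close> its meaning.\<close>

section \<open>Hoelder and Loomis-Whitney inequalities\<close>

text \<open>Hoelder's inequality for several functions with equal exponents. Raising it to the power \<open>card A\<close>
  avoids roots of extended nonnegative numbers. After normalising every factor to integral 1 it is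
  the inequality between the arithmetic and the geometric mean, integrated.\<close>

lemma nn_integral_prod_holder:
  fixes G :: "'x \<Rightarrow> ennreal" and h :: "'i \<Rightarrow> 'x \<Rightarrow> ennreal"
  assumes A: "finite A" "A \<noteq> {}"
    and G[measurable]: "G \<in> borel_measurable M"
    and h[measurable]: "\<And>i. i \<in> A \<Longrightarrow> h i \<in> borel_measurable M"
    and le: "\<And>x. x \<in> space M \<Longrightarrow> G x ^ card A \<le> (\<Prod>i\<in>A. h i x)"
  shows "(\<integral>\<^sup>+x. G x \<partial>M) ^ card A \<le> (\<Prod>i\<in>A. \<integral>\<^sup>+x. h i x \<partial>M)"
proof -
  define N where "N = card A"
  have N: "N > 0" using A by (auto simp: N_def card_gt_0_iff)
  define a where "a i = (\<integral>\<^sup>+x. h i x \<partial>M)" for i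
  show ?thesis
  proof (cases "\<exists>i\<in>A. a i = 0")
    case True
    then obtain i where i: "i \<in> A" "a i = 0" by auto
    have "AE x in M. h i x = 0"
      using i nn_integral_0_iff_AE[OF h[OF i(1)]] by (auto simp: a_def)
    moreover have "AE x in M. x \<in> space M" by simp
    ultimately have "AE x in M. G x = 0"
    proof eventually_elim
      case (elim x)
      have "(\<Prod>i\<in>A. h i x) = 0" using elim(1) i A by (auto intro: prod_zero)
      then have "G x ^ N = 0" using le[OF elim(2)] by (metis le_zero_eq N_def)
      then show ?case using N by simp
    qed
    then have "(\<integral>\<^sup>+x. G x \<partial>M) = 0"
      using nn_integral_0_iff_AE[OF G] by simp
    then show ?thesis using N by (simp add: N_def zero_power)
  next
    case nz: False
    show ?thesis
    proof (cases "\<exists>i\<in>A. a i = \<infinity>")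
      case True
      then have "(\<Prod>i\<in>A. a i) = \<infinity>"
        using nz A by (subst infinity_ennreal_def, subst ennreal_prod_eq_top) auto
      then show ?thesis by (simp add: a_def)
    next
      case fin: False
      define b where "b i = enn2real (a i)" for i
      have ab: "a i = ennreal (b i)" and b: "b i > 0" if "i \<in> A" for i
        using nz fin that
        by (auto simp: b_def less_top enn2real_positive_iff zero_less_iff_neq_zero)
      define T where "T = root N (\<Prod>i\<in>A. b i)"
      have P: "(\<Prod>i\<in>A. b i) > 0" using b by (intro prod_pos) auto
      have T: "T > 0" "T ^ N = (\<Prod>i\<in>A. b i)"
        using P N by (auto simp: T_def)
      have AEfin: "AE x in M. h i x \<noteq> \<infinity>" if "i \<in> A" for i
        using nn_integral_PInf_AE[OF h[OF that]] fin that by (auto simp: a_def)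
      have "AE x in M. \<forall>i\<in>A. h i x \<noteq> \<infinity>"
        using AEfin A by (simp add: AE_finite_all)
      moreover have "AE x in M. x \<in> space M" by simp
      ultimately have AEle: "AE x in M. G x \<le> ennreal T * (\<Sum>i\<in>A. ennreal (1 / (N * b i)) * h i x)"
      proof eventually_elim
        case (elim x)
        define t where "t i = enn2real (h i x)" for i
        have t: "h i x = ennreal (t i)" "t i \<ge> 0" if "i \<in> A" for i
          using elim that by (auto simp: t_def less_top)
        have GN: "G x ^ N \<le> ennreal (\<Prod>i\<in>A. t i)"
          using le[OF elim(2)] t by (simp add: N_def prod_ennreal)
        have "G x ^ N < top" using GN by (metis ennreal_less_top le_less_trans)
        then have "G x < top" using N by (cases "G x = top") (auto simp: less_top power_eq_top_ennreal)
        define g where "g = enn2real (G x)"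
        have g: "G x = ennreal g" "g \<ge> 0" using \<open>G x < top\<close> by (auto simp: g_def)
        have gN: "g ^ N \<le> (\<Prod>i\<in>A. t i)"
          using GN g t by (simp add: ennreal_power prod_nonneg)
        define S where "S = (\<Sum>i\<in>A. t i / b i / N)"
        have S0: "S \<ge> 0" unfolding S_def using t b by (intro sum_nonneg) (auto intro!: divide_nonneg_nonneg simp: less_imp_le)
        have "(\<Prod>i\<in>A. t i / b i) powr (1 / N) \<le> S"
          unfolding S_def N_def using A t b by (intro arith_geom_mean) (auto simp: less_imp_le)
        moreover have "(\<Prod>i\<in>A. t i / b i) \<ge> 0" using t b by (intro prod_nonneg) (auto simp: less_imp_le)
        ultimately have "(\<Prod>i\<in>A. t i / b i) \<le> S ^ N"
        proof -
          have "(\<Prod>i\<in>A. t i / b i) = ((\<Prod>i\<in>A. t i / b i) powr (1 / N)) ^ N"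
            using N \<open>(\<Prod>i\<in>A. t i / b i) \<ge> 0\<close>
            by (cases "(\<Prod>i\<in>A. t i / b i) = 0") (auto simp: zero_power powr_realpow[symmetric] powr_powr)
          then show ?thesis
            using \<open>(\<Prod>i\<in>A. t i / b i) powr (1 / N) \<le> S\<close> by (metis powr_ge_zero power_mono)
        qed
        then have "(\<Prod>i\<in>A. t i) \<le> T ^ N * S ^ N"
          using P by (simp add: T prod_dividef divide_le_eq mult.commute)
        then have "g ^ N \<le> (T * S) ^ N" using gN by (simp add: power_mult_distrib)
        then have "g \<le> T * S" using S0 T N by (meson less_imp_le mult_nonneg_nonneg power_mono_iff g(2))
        then have "G x \<le> ennreal T * ennreal S" using g S0 T
          by (simp add: ennreal_mult[symmetric] less_imp_le ennreal_leI)
        also have "ennreal S = (\<Sum>i\<in>A. ennreal (1 / (N * b i)) * h i x)"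
          unfolding S_def using t b
          by (subst sum_ennreal[symmetric]) (auto intro!: sum.cong divide_nonneg_nonneg simp: less_imp_le ennreal_mult[symmetric] mult.commute)
        finally show ?case .
      qed
      have "(\<integral>\<^sup>+x. G x \<partial>M) \<le> (\<integral>\<^sup>+x. ennreal T * (\<Sum>i\<in>A. ennreal (1 / (N * b i)) * h i x) \<partial>M)"
        by (rule nn_integral_mono_AE) (rule AEle)
      also have "\<dots> = ennreal T * (\<Sum>i\<in>A. ennreal (1 / (N * b i)) * a i)"
        by (simp add: nn_integral_cmult nn_integral_sum a_def)
      also have "(\<Sum>i\<in>A. ennreal (1 / (N * b i)) * a i) = (\<Sum>i\<in>A. ennreal (1 / N))"
        using N by (intro sum.cong refl) (use b in \<open>force simp: ab ennreal_mult[symmetric] less_imp_le\<close>)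
      also have "\<dots> = 1" using N A by (simp add: N_def ennreal_of_nat_eq_real_of_nat ennreal_mult[symmetric] flip: ennreal_1)
      finally have "(\<integral>\<^sup>+x. G x \<partial>M) \<le> ennreal T" by simp
      then have "(\<integral>\<^sup>+x. G x \<partial>M) ^ N \<le> ennreal (T ^ N)"
        using T by (metis ennreal_power less_imp_le power_mono zero_le)
      also have "\<dots> = (\<Prod>i\<in>A. a i)" using T b ab by (simp add: prod_ennreal less_imp_le)
      finally show ?thesis by (simp add: N_def a_def)
    qed
  qed
qed

text \<open>The Loomis-Whitney inequality, generalised so that it can be proved by integrating one coordinate
  at a time: the coordinates in \<open>J\<close> are those already integrated, and the factor with index \<open>i \<in> J\<close> has lost its
  dependence on the coordinate \<open>i\<close>. When the coordinate \<open>k\<close> is added, the factor with index \<open>k\<close>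
  is constant in it, and the remaining \<open>card I - 1\<close> factors are handled by Hoelder's inequality.\<close>

lemma (in product_sigma_finite) loomis_whitney_nn:
  fixes f :: "'i \<Rightarrow> ('i \<Rightarrow> 'a) \<Rightarrow> ennreal"
  assumes "finite J" "J \<subseteq> I" "finite I" "card I \<ge> 2"
    and "\<And>i. i \<in> I \<Longrightarrow> f i \<in> borel_measurable (Pi\<^sub>M J M)"
    and "G \<in> borel_measurable (Pi\<^sub>M J M)"
    and "\<And>x. x \<in> space (Pi\<^sub>M J M) \<Longrightarrow>
      G x ^ (card I - 1) \<le> (\<Prod>i\<in>I. if i \<in> J then \<integral>\<^sup>+s. f i (x(i := s)) \<partial>M i else f i x)"
  shows "(\<integral>\<^sup>+x. G x \<partial>Pi\<^sub>M J M) ^ (card I - 1) \<le> (\<Prod>i\<in>I. \<integral>\<^sup>+x. f i x \<partial>Pi\<^sub>M J M)"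
  using assms(1,2,5-)
proof (induction J arbitrary: f G rule: finite_induct)
  case empty
  then show ?case by (simp add: nn_integral_empty space_PiM)
next
  case (insert k J)
  note [measurable] = insert.prems(2) insert.prems(3)
  have k: "k \<in> I" "k \<notin> J" "J \<subseteq> I" using insert by auto
  define f' where "f' i x = (\<integral>\<^sup>+y. f i (x(k := y)) \<partial>M k)" for i x
  define G' where "G' x = (\<integral>\<^sup>+y. G (x(k := y)) \<partial>M k)" for x
  have [measurable]: "(\<lambda>y. x(k := y)) \<in> measurable (M k) (Pi\<^sub>M (insert k J) M)"
    if "x \<in> space (Pi\<^sub>M J M)" for x
    using measurable_Pair2[OF measurable_add_dim that] by simp
  have f'm[measurable]: "f' i \<in> borel_measurable (Pi\<^sub>M J M)" if "i \<in> I" for i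
    unfolding f'_def using that by measurable
  have G'm[measurable]: "G' \<in> borel_measurable (Pi\<^sub>M J M)"
    unfolding G'_def by measurable
  have cI: "card (I - {k}) = card I - 1" "finite (I - {k})" "I - {k} \<noteq> {}"
  proof -
    show 1: "card (I - {k}) = card I - 1" using k by simp
    show "finite (I - {k})" using assms(3) by simp
    show "I - {k} \<noteq> {}"
    proof
      assume "I - {k} = {}"
      then have "card I - 1 = 0" using 1 by (metis card.empty)
      then show False using assms(4) by simp
    qed
  qed
  have swap: "(\<integral>\<^sup>+y. \<integral>\<^sup>+s. f i (x(k := y, i := s)) \<partial>M i \<partial>M k) = (\<integral>\<^sup>+s. f' i (x(i := s)) \<partial>M i)"
    if i: "i \<in> J" and x: "x \<in> space (Pi\<^sub>M J M)" for i x
  proof -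
    have ik: "i \<noteq> k" "i \<in> I" using i k by auto
    interpret P: pair_sigma_finite "M i" "M k" by standard
    have [measurable]: "(\<lambda>(s, y). x(i := s, k := y)) \<in> measurable (M i \<Otimes>\<^sub>M M k) (Pi\<^sub>M (insert k J) M)"
      unfolding case_prod_beta
      by (rule measurable_fun_upd[where J = J], force, rule measurable_fun_upd[where J = J])
        (use i x in \<open>auto simp: insert_absorb\<close>)
    have "(\<integral>\<^sup>+y. \<integral>\<^sup>+s. f i (x(k := y, i := s)) \<partial>M i \<partial>M k)
        = (\<integral>\<^sup>+y. \<integral>\<^sup>+s. f i (x(i := s, k := y)) \<partial>M i \<partial>M k)"
      using ik by (simp add: fun_upd_twist)
    also have "\<dots> = (\<integral>\<^sup>+s. \<integral>\<^sup>+y. f i (x(i := s, k := y)) \<partial>M k \<partial>M i)"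
      using ik by (intro P.Fubini') measurable
    finally show ?thesis by (simp add: f'_def)
  qed
  have key: "G' x ^ (card I - 1) \<le>
      (\<Prod>i\<in>I. if i \<in> J then \<integral>\<^sup>+s. f' i (x(i := s)) \<partial>M i else f' i x)"
    if x: "x \<in> space (Pi\<^sub>M J M)" for x
  proof -
    define c where "c = f' k x"
    \<comment> \<open>The factor that is constant in the integration variable is merged into one of the others.\<close>
    obtain i0 where i0: "i0 \<in> I - {k}" using cI by blast
    define e where "e i y = (if i \<in> J then \<integral>\<^sup>+s. f i (x(k := y, i := s)) \<partial>M i else f i (x(k := y)))" for i y
    have em[measurable]: "e i \<in> borel_measurable (M k)" if "i \<in> I" for i
    proof (cases "i \<in> J")
      case True
      have [measurable]: "(\<lambda>(y, s). x(k := y, i := s)) \<in> measurable (M k \<Otimes>\<^sub>M M i) (Pi\<^sub>M (insert k J) M)"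
        unfolding case_prod_beta
        by (rule measurable_fun_upd[where J = "insert k J"], use True in force, rule measurable_fun_upd[where J = J])
          (use x in \<open>auto simp: insert_absorb\<close>)
      show ?thesis unfolding e_def using True that by simp
    next
      case False
      then show ?thesis unfolding e_def using that x by simp
    qed
    have eint: "(\<integral>\<^sup>+y. e i y \<partial>M k) = (if i \<in> J then \<integral>\<^sup>+s. f' i (x(i := s)) \<partial>M i else f' i x)" for i
      using swap[OF _ x, of i] by (auto simp: e_def f'_def)
    have "(\<integral>\<^sup>+y. G (x(k := y)) \<partial>M k) ^ card (I - {k}) \<le>
        (\<Prod>i\<in>I-{k}. \<integral>\<^sup>+y. (if i = i0 then c else 1) * e i y \<partial>M k)"
    proof (rule nn_integral_prod_holder)
      fix y assume y: "y \<in> space (M k)"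
      have sp: "x(k := y) \<in> space (Pi\<^sub>M (insert k J) M)"
        using x y by (auto simp: space_PiM PiE_def extensional_def Pi_def)
      have "G (x(k := y)) ^ (card I - 1) \<le> (\<Prod>i\<in>I. if i \<in> insert k J then \<integral>\<^sup>+s. f i (x(k := y, i := s)) \<partial>M i else f i (x(k:=y)))"
        by (rule insert.prems(4)[OF sp])
      also have "\<dots> = c * (\<Prod>i\<in>I-{k}. e i y)"
        using k assms(3) by (subst prod.remove[of I k]) (auto simp: c_def f'_def e_def intro!: arg_cong2[where f="(*)"] prod.cong)
      also have "\<dots> = (\<Prod>i\<in>I-{k}. (if i = i0 then c else 1) * e i y)"
        using i0 assms(3) by (simp add: prod.distrib prod.delta)
      finally show "G (x(k := y)) ^ card (I - {k}) \<le> (\<Prod>i\<in>I-{k}. (if i = i0 then c else 1) * e i y)"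
        using cI by simp
    qed (use cI x in auto)
    also have "\<dots> = (\<Prod>i\<in>I-{k}. (if i = i0 then c else 1) * (\<integral>\<^sup>+y. e i y \<partial>M k))"
      by (intro prod.cong refl nn_integral_cmult) auto
    also have "\<dots> = c * (\<Prod>i\<in>I-{k}. (\<integral>\<^sup>+y. e i y \<partial>M k))"
      using i0 assms(3) by (simp add: prod.distrib prod.delta)
    also have "\<dots> = (\<Prod>i\<in>I. if i \<in> J then \<integral>\<^sup>+s. f' i (x(i := s)) \<partial>M i else f' i x)"
      using k assms(3) by (simp add: prod.remove[of I k] c_def eint)
    finally show ?thesis using cI by (simp add: G'_def)
  qed
  have "(\<integral>\<^sup>+x. G' x \<partial>Pi\<^sub>M J M) ^ (card I - 1) \<le> (\<Prod>i\<in>I. \<integral>\<^sup>+x. f' i x \<partial>Pi\<^sub>M J M)"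
    by (rule insert.IH) (use k key in auto)
  moreover have "(\<integral>\<^sup>+x. G' x \<partial>Pi\<^sub>M J M) = (\<integral>\<^sup>+x. G x \<partial>Pi\<^sub>M (insert k J) M)"
    unfolding G'_def using insert by (subst product_nn_integral_insert) auto
  moreover have "(\<integral>\<^sup>+x. f' i x \<partial>Pi\<^sub>M J M) = (\<integral>\<^sup>+x. f i x \<partial>Pi\<^sub>M (insert k J) M)" if "i \<in> I" for i
    unfolding f'_def using insert that by (subst product_nn_integral_insert) auto
  ultimately show ?case by simp
qed

section \<open>Test functions separate locally integrable functions\<close>

text \<open>The functions \<open>exp(-1/t)/t\<^sup>m\<close>, extended by 0 to \<open>t \<le> 0\<close>. Together they span a space closed
  under differentiation, hence \<open>exp_flat 0\<close> is smooth although it is flat at 0.\<close>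

definition exp_flat :: "nat \<Rightarrow> real \<Rightarrow> real" where
  "exp_flat m t = (if t > 0 then exp (- 1 / t) / t ^ m else 0)"

lemma exp_flat_has_derivative:
  "(exp_flat m has_real_derivative exp_flat (m + 2) t - real m * exp_flat (m + 1) t) (at t)"
proof -
  consider "t > 0" | "t < 0" | "t = 0" by linarith
  then show ?thesis
  proof cases
    case 1
    have "((\<lambda>t. exp (- 1 / t) / t ^ m) has_real_derivative
        exp_flat (m + 2) t - real m * exp_flat (m + 1) t) (at t)"
      apply (rule derivative_eq_intros refl | use 1 in force)+
      using 1 by (cases m) (auto simp: exp_flat_def field_simps power2_eq_square)
    then show ?thesis
      by (rule has_field_derivative_transform_within_open[where S = "{0<..}"])
        (use 1 in \<open>auto simp: exp_flat_def\<close>)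
  next
    case 2
    have "((\<lambda>t. 0) has_real_derivative
        exp_flat (m + 2) t - real m * exp_flat (m + 1) t) (at t)"
      using 2 by (simp add: exp_flat_def)
    then show ?thesis
      by (rule has_field_derivative_transform_within_open[where S = "{..<0}"])
        (use 2 in \<open>auto simp: exp_flat_def\<close>)
  next
    case 3
    have "((\<lambda>h. inverse h ^ (m + 1) / exp (inverse h)) \<longlongrightarrow> (0::real)) (at_right 0)"
      by (rule filterlim_compose[OF tendsto_power_div_exp_0 filterlim_inverse_at_top_right])
    moreover have "\<forall>\<^sub>F h in at_right 0. inverse h ^ (m + 1) / exp (inverse h) = exp_flat m h / h"
      unfolding eventually_at_right_field
      by (intro exI[of _ 1]) (auto simp: exp_flat_def field_simps exp_minus divide_simps)
    ultimately have "((\<lambda>h. exp_flat m h / h) \<longlongrightarrow> 0) (at_right 0)"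
      by (rule Lim_transform_eventually)
    moreover have "((\<lambda>h. exp_flat m h / h) \<longlongrightarrow> 0) (at_left 0)"
      by (rule Lim_transform_eventually[OF tendsto_const])
        (auto simp: eventually_at_left_field exp_flat_def intro!: exI[of _ "-1"])
    ultimately have "((\<lambda>h. exp_flat m h / h) \<longlongrightarrow> 0) (at 0)"
      by (rule filterlim_split_at[rotated])
    then show ?thesis using 3 by (simp add: DERIV_def exp_flat_def)
  qed
qed

lemma exp_flat_bounds: "0 \<le> exp_flat 0 t" "exp_flat 0 t \<le> 1" "exp_flat 0 t \<noteq> 0 \<longleftrightarrow> t > 0"
  by (auto simp: exp_flat_def)

text \<open>An algebra of functions that is closed under all directional derivatives, so that its members
  are smooth without any computation of higher derivatives.\<close>

inductive_set smooth_alg :: "('a::euclidean_space \<Rightarrow> real) set" where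
  const: "(\<lambda>x. c) \<in> smooth_alg"
| flat: "(\<lambda>x. exp_flat m (\<alpha> * (x \<bullet> b) + \<beta>)) \<in> smooth_alg"
| add: "f \<in> smooth_alg \<Longrightarrow> g \<in> smooth_alg \<Longrightarrow> (\<lambda>x. f x + g x) \<in> smooth_alg"
| mult: "f \<in> smooth_alg \<Longrightarrow> g \<in> smooth_alg \<Longrightarrow> (\<lambda>x. f x * g x) \<in> smooth_alg"

lemma smooth_alg_derivative:
  assumes "f \<in> smooth_alg"
  shows "\<exists>D. (\<forall>x. (f has_derivative D x) (at x)) \<and> (\<forall>v. (\<lambda>x. D x v) \<in> smooth_alg)"
  using assms
proof induction
  case (const c)
  show ?case by (rule exI[of _ "\<lambda>x v. 0"]) (auto intro: smooth_alg.const)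
next
  case (flat m \<alpha> b \<beta>)
  let ?t = "\<lambda>x. \<alpha> * (x \<bullet> b) + \<beta>"
  let ?d = "\<lambda>x. exp_flat (m + 2) (?t x) + (- real m) * exp_flat (m + 1) (?t x)"
  have "((\<lambda>x. exp_flat m (?t x)) has_derivative (\<lambda>v. ?d x * (\<alpha> * (v \<bullet> b)))) (at x)" for x
  proof -
    have "(?t has_derivative (\<lambda>v. \<alpha> * (v \<bullet> b))) (at x)"
      by (auto intro!: derivative_eq_intros)
    moreover have "(exp_flat m has_derivative (\<lambda>h. ?d x * h)) (at (?t x))"
      using exp_flat_has_derivative[of m "?t x"] by (simp add: has_field_derivative_def)
    ultimately show ?thesis
      by (rule has_derivative_compose)
  qed
  moreover have "(\<lambda>x. ?d x * (\<alpha> * (v \<bullet> b))) \<in> smooth_alg" for v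
    by (intro smooth_alg.intros)
  ultimately show ?case by (intro exI[of _ "\<lambda>x v. ?d x * (\<alpha> * (v \<bullet> b))"]) auto
next
  case (add f g)
  then obtain D E where "\<forall>x. (f has_derivative D x) (at x)" "\<forall>v. (\<lambda>x. D x v) \<in> smooth_alg"
    "\<forall>x. (g has_derivative E x) (at x)" "\<forall>v. (\<lambda>x. E x v) \<in> smooth_alg" by blast
  then show ?case
    by (intro exI[of _ "\<lambda>x v. D x v + E x v"])
      (auto intro!: has_derivative_add smooth_alg.intros)
next
  case (mult f g)
  then obtain D E where "\<forall>x. (f has_derivative D x) (at x)" "\<forall>v. (\<lambda>x. D x v) \<in> smooth_alg"
    "\<forall>x. (g has_derivative E x) (at x)" "\<forall>v. (\<lambda>x. E x v) \<in> smooth_alg" by blast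
  then show ?case
    by (intro exI[of _ "\<lambda>x v. f x * E x v + D x v * g x"])
      (auto intro!: has_derivative_mult smooth_alg.intros mult)
qed

lemma smooth_alg_smooth: "f \<in> smooth_alg \<Longrightarrow> smooth_on UNIV f"
  unfolding smooth_on_def
proof (rule allI)
  fix k show "f \<in> smooth_alg \<Longrightarrow> Ck_on k UNIV f"
  proof (induction k arbitrary: f)
    case 0
    then show ?case
      using smooth_alg_derivative[OF 0]
      by (auto intro!: continuous_at_imp_continuous_on intro: has_derivative_continuous)
  next
    case (Suc k)
    obtain D where D: "\<And>x. (f has_derivative D x) (at x)" "\<And>v. (\<lambda>x. D x v) \<in> smooth_alg"
      using smooth_alg_derivative[OF Suc.prems] by blast
    have "frechet_derivative f (at x) = D x" for x
      using frechet_derivative_at[OF D(1)[of x]] by simp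
    then show ?case
      using D Suc.IH by (auto simp: differentiable_on_def intro: differentiableI differentiable_at_withinI)
  qed
qed

lemma smooth_alg_prod: "finite A \<Longrightarrow> (\<And>i. i \<in> A \<Longrightarrow> f i \<in> smooth_alg) \<Longrightarrow> (\<lambda>x. \<Prod>i\<in>A. f i x) \<in> smooth_alg"
  by (induction A rule: finite_induct) (auto intro: smooth_alg.intros)

text \<open>These functions increase to the indicator of an open box as \<open>m\<close> tends to infinity.\<close>

definition box_bump :: "'a::euclidean_space \<Rightarrow> 'a \<Rightarrow> nat \<Rightarrow> 'a \<Rightarrow> real" where
  "box_bump l u m x =
     (\<Prod>b\<in>Basis. exp_flat 0 (real m * (x \<bullet> b) + - (real m * (l \<bullet> b)))
                 * exp_flat 0 (- real m * (x \<bullet> b) + real m * (u \<bullet> b)))"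

lemma box_bump_bounds: "0 \<le> box_bump l u m x" "box_bump l u m x \<le> 1"
  unfolding box_bump_def
  by (auto intro!: prod_nonneg prod_le_1 mult_nonneg_nonneg mult_le_one simp: exp_flat_bounds)

lemma box_bump_outside: "x \<notin> box l u \<Longrightarrow> box_bump l u m x = 0"
proof -
  assume "x \<notin> box l u"
  then obtain b where b: "b \<in> Basis" "x \<bullet> b \<le> l \<bullet> b \<or> u \<bullet> b \<le> x \<bullet> b"
    by (auto simp: box_def not_less)
  have "exp_flat 0 (real m * (x \<bullet> b) + - (real m * (l \<bullet> b)))
                 * exp_flat 0 (- real m * (x \<bullet> b) + real m * (u \<bullet> b)) = 0"
    using b(2) mult_left_mono[of "x \<bullet> b" "l \<bullet> b" "real m"] mult_left_mono[of "u \<bullet> b" "x \<bullet> b" "real m"]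
    by (auto simp: exp_flat_def)
  then show ?thesis unfolding box_bump_def using b(1) by (auto intro!: prod_zero)
qed

lemma exp_flat_tendsto_1:
  assumes "c > 0" shows "(\<lambda>m. exp_flat 0 (real m * c)) \<longlonglongrightarrow> 1"
proof -
  have "(\<lambda>m. inverse (real m) * (- 1 / c)) \<longlonglongrightarrow> 0 * (- 1 / c)"
    by (intro tendsto_mult tendsto_const lim_inverse_n)
  then have "(\<lambda>m. exp (inverse (real m) * (- 1 / c))) \<longlonglongrightarrow> exp (0 * (- 1 / c))"
    by (rule tendsto_exp)
  moreover have "\<forall>\<^sub>F m in sequentially. exp (inverse (real m) * (- 1 / c)) = exp_flat 0 (real m * c)"
    using eventually_gt_at_top[of 0] by eventually_elim (use assms in \<open>auto simp: exp_flat_def field_simps\<close>)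
  ultimately show ?thesis by (auto intro: Lim_transform_eventually)
qed

lemma box_bump_tendsto: "(\<lambda>m. box_bump l u m x) \<longlonglongrightarrow> indicator (box l u) x"
proof (cases "x \<in> box l u")
  case True
  have "(\<lambda>m. \<Prod>b\<in>Basis. exp_flat 0 (real m * (x \<bullet> b - l \<bullet> b))
                 * exp_flat 0 (real m * (u \<bullet> b - x \<bullet> b))) \<longlonglongrightarrow> (\<Prod>b\<in>(Basis :: 'a set). 1 * 1)"
    using True by (intro tendsto_prod tendsto_mult exp_flat_tendsto_1) (auto simp: box_def)
  then show ?thesis using True by (simp add: box_bump_def algebra_simps)
qed (simp add: box_bump_outside)

lemma box_bump_test:
  assumes "cbox l u \<subseteq> \<Omega>"
  shows "box_bump l u m \<in> test_functions \<Omega>"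
proof -
  have "box_bump l u m \<in> smooth_alg"
    unfolding box_bump_def[abs_def] by (intro smooth_alg_prod smooth_alg.intros) auto
  moreover have "closure {x. box_bump l u m x \<noteq> 0} \<subseteq> cbox l u"
    using box_bump_outside[of _ l u m] box_subset_cbox[of l u]
    by (intro closure_minimal closed_cbox) blast
  moreover have "bounded {x. box_bump l u m x \<noteq> 0}"
    using box_bump_outside[of _ l u m] by (intro bounded_subset[OF bounded_box[of l u]]) blast
  ultimately show ?thesis
    using assms smooth_alg_smooth by (auto simp: test_functions_def)
qed

lemma box_bump_borel[measurable]: "box_bump l u m \<in> borel_measurable borel"
proof -
  have "continuous_on UNIV (exp_flat 0)"
    by (meson exp_flat_has_derivative DERIV_isCont continuous_at_imp_continuous_on)
  then have [measurable]: "exp_flat 0 \<in> borel_measurable borel"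
    by (rule borel_measurable_continuous_onI)
  show ?thesis unfolding box_bump_def[abs_def] by measurable
qed

text \<open>The hypothesis on test functions passes to the indicator of a box by dominated convergence.\<close>

lemma integral_cbox_eq_0:
  fixes h :: "'a::euclidean_space \<Rightarrow> real"
  assumes \<Omega>: "open \<Omega>" and h: "h \<in> L1_loc \<Omega>"
    and z: "\<forall>\<psi>\<in>test_functions \<Omega>. (\<integral>x. h x * \<psi> x \<partial>lebesgue_on \<Omega>) = 0"
    and sub: "cbox l u \<subseteq> \<Omega>"
  shows "integral (cbox l u) h = 0" "h absolutely_integrable_on cbox l u"
proof -
  have ic: "integrable (lebesgue_on (cbox l u)) h"
    using h sub by (auto simp: L1_loc_def)
  then have i: "integrable lebesgue (\<lambda>x. indicator (cbox l u) x * h x)"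
    by (simp add: integrable_restrict_space)
  then have im[measurable]: "(\<lambda>x. indicator (cbox l u) x * h x) \<in> borel_measurable lebesgue"
    by (rule borel_measurable_integrable)
  have bm[measurable]: "box_bump l u m \<in> borel_measurable lebesgue" for m
    by (rule measurable_completion) measurable
  have "(\<lambda>m. \<integral>x. (indicator (cbox l u) x * h x) * box_bump l u m x \<partial>lebesgue)
      \<longlonglongrightarrow> (\<integral>x. (indicator (cbox l u) x * h x) * indicator (box l u) x \<partial>lebesgue)"
  proof (rule integral_dominated_convergence[where w = "\<lambda>x. norm (indicator (cbox l u) x * h x)"])
    show "integrable lebesgue (\<lambda>x. norm (indicator (cbox l u) x * h x))" using i by simp
    show "AE x in lebesgue. (\<lambda>m. (indicator (cbox l u) x * h x) * box_bump l u m x)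
        \<longlonglongrightarrow> (indicator (cbox l u) x * h x) * indicator (box l u) x"
      by (intro AE_I2 tendsto_mult tendsto_const box_bump_tendsto)
    show "AE x in lebesgue. norm ((indicator (cbox l u) x * h x) * box_bump l u m x)
        \<le> norm (indicator (cbox l u) x * h x)" for m
      by (intro AE_I2) (auto simp: abs_mult box_bump_bounds intro!: mult_left_le)
    show "(\<lambda>x. indicator (cbox l u) x * h x * indicator (box l u) x) \<in> borel_measurable lebesgue"
      by (rule borel_measurable_times[OF im]) (auto intro!: borel_measurable_indicator)
    show "(\<lambda>x. indicator (cbox l u) x * h x * box_bump l u m x) \<in> borel_measurable lebesgue" for m
      by (rule borel_measurable_times[OF im bm])
  qed
  moreover have "(\<integral>x. (indicator (cbox l u) x * h x) * box_bump l u m x \<partial>lebesgue) = 0" for m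
  proof -
    have "(\<integral>x. h x * box_bump l u m x \<partial>lebesgue_on \<Omega>)
        = (\<integral>x. indicator \<Omega> x * (h x * box_bump l u m x) \<partial>lebesgue)"
      using \<Omega> by (subst integral_restrict_space) auto
    also have "\<dots> = (\<integral>x. (indicator (cbox l u) x * h x) * box_bump l u m x \<partial>lebesgue)"
      using sub box_bump_outside[of _ l u m] box_subset_cbox[of l u]
      by (intro Bochner_Integration.integral_cong) (auto simp: indicator_def)
    finally show ?thesis using z box_bump_test[OF sub] by simp
  qed
  ultimately have "(\<integral>x. (indicator (cbox l u) x * h x) * indicator (box l u) x \<partial>lebesgue) = 0"
    by (simp add: LIMSEQ_const_iff)
  moreover have "(\<lambda>x. (indicator (cbox l u) x * h x) * indicator (box l u) x) = (\<lambda>x. indicator (box l u) x *\<^sub>R h x)"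
    using box_subset_cbox[of l u] by (auto simp: indicator_def fun_eq_iff)
  ultimately have "(\<integral>x. h x \<partial>lebesgue_on (box l u)) = 0"
    by (subst integral_restrict_space) auto
  moreover have a: "h absolutely_integrable_on cbox l u"
    using ic by (simp add: set_integrable_def integrable_restrict_space)
  then have "h absolutely_integrable_on box l u"
    by (rule set_integrable_subset) (auto simp: box_subset_cbox)
  ultimately have "integral (box l u) h = 0"
    by (subst set_lebesgue_integral_eq_integral(2)[symmetric])
      (auto simp: set_lebesgue_integral_def integral_restrict_space)
  then show "integral (cbox l u) h = 0" by (simp add: integral_open_interval)
  show "h absolutely_integrable_on cbox l u" by (rule a)
qed

text \<open>Almost everywhere, \<open>h\<close> is the limit of its averages over shrinking boxes, and all these averages vanish.
  Countably many boxes cover \<open>\<Omega>\<close>, so that it suffices to argue inside one of them.\<close>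

lemma fundamental_lemma_AE:
  fixes h :: "'a::euclidean_space \<Rightarrow> real"
  assumes \<Omega>: "open \<Omega>" and h: "h \<in> L1_loc \<Omega>"
    and z: "\<forall>\<psi>\<in>test_functions \<Omega>. (\<integral>x. h x * \<psi> x \<partial>lebesgue_on \<Omega>) = 0"
  shows "AE x in lebesgue_on \<Omega>. h x = 0"
proof -
  note box0 = integral_cbox_eq_0[OF assms]
  have *: "negligible {x \<in> box c d. h x \<noteq> 0}" if cd: "cbox c d \<subseteq> \<Omega>" for c d
  proof -
    define h' where "h' x = (if x \<in> box c d then h x else 0)" for x
    have "h integrable_on box c d"
      using box0(2)[OF cd] by (simp add: absolutely_integrable_on_def integrable_on_open_interval)
    then have hU: "h' integrable_on UNIV"
      unfolding h'_def by (simp add: integrable_restrict_UNIV)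
    have "h' integrable_on cbox a b" for a b
      by (rule integrable_on_subcbox[OF hU]) auto
    then obtain N where N: "negligible N" "\<And>x e. \<lbrakk>x \<notin> N; 0 < e\<rbrakk> \<Longrightarrow>
        \<exists>d>0. \<forall>t. 0 < t \<and> t < d \<longrightarrow>
          norm (integral (cbox x (x + t *\<^sub>R One)) h' /\<^sub>R t ^ DIM('a) - h' x) < e"
      using integrable_ccontinuous_explicit by metis
    have "h x = 0" if x: "x \<in> box c d" "x \<notin> N" for x
    proof (rule ccontr)
      assume "h x \<noteq> 0"
      then obtain \<delta> where \<delta>: "\<delta> > 0" "\<And>t. 0 < t \<Longrightarrow> t < \<delta> \<Longrightarrow>
          norm (integral (cbox x (x + t *\<^sub>R One)) h' /\<^sub>R t ^ DIM('a) - h' x) < \<bar>h x\<bar>"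
        using N(2)[OF x(2), of "\<bar>h x\<bar>"] by auto
      have "((\<lambda>t. x + t *\<^sub>R One) \<longlongrightarrow> x + 0 *\<^sub>R One) (at_right 0)"
        by (intro tendsto_intros)
      then have "\<forall>\<^sub>F t in at_right 0. x + t *\<^sub>R One \<in> box c d"
        using x(1) open_box by (intro topological_tendstoD) auto
      moreover have "\<forall>\<^sub>F t in at_right 0. 0 < t \<and> t < \<delta>"
        using \<delta>(1) by (auto simp: eventually_at_right_field)
      ultimately have "\<forall>\<^sub>F t::real in at_right 0. False"
      proof eventually_elim
        case (elim t)
        have sub: "cbox x (x + t *\<^sub>R One) \<subseteq> box c d"
        proof
          fix y assume y: "y \<in> cbox x (x + t *\<^sub>R One)"
          show "y \<in> box c d"
            unfolding box_def
          proof (intro CollectI ballI)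
            fix b :: 'a assume b: "b \<in> Basis"
            have "x \<bullet> b \<le> y \<bullet> b" "y \<bullet> b \<le> (x + t *\<^sub>R One) \<bullet> b"
              using y b by (auto simp: cbox_def)
            moreover have "c \<bullet> b < x \<bullet> b" "(x + t *\<^sub>R One) \<bullet> b < d \<bullet> b"
              using x(1) elim(1) b unfolding box_def by blast+
            ultimately show "c \<bullet> b < y \<bullet> b \<and> y \<bullet> b < d \<bullet> b" by linarith
          qed
        qed
        then have "cbox x (x + t *\<^sub>R One) \<subseteq> \<Omega>" using cd box_subset_cbox by blast
        then have "integral (cbox x (x + t *\<^sub>R One)) h = 0" by (rule box0)
        moreover have "integral (cbox x (x + t *\<^sub>R One)) h' = integral (cbox x (x + t *\<^sub>R One)) h"
          using sub by (intro Henstock_Kurzweil_Integration.integral_cong) (auto simp: h'_def)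
        ultimately show False using \<delta>(2)[of t] elim x(1) by (simp add: h'_def)
      qed
      then show False by simp
    qed
    then show ?thesis
      by (intro negligible_subset[OF N(1)]) auto
  qed
  define \<F> where "\<F> = {box c d |c d. cbox c d \<subseteq> \<Omega>}"
  have UF: "\<Union>\<F> = \<Omega>"
  proof
    show "\<Union>\<F> \<subseteq> \<Omega>" using box_subset_cbox unfolding \<F>_def by blast
    show "\<Omega> \<subseteq> \<Union>\<F>"
    proof
      fix x assume "x \<in> \<Omega>"
      then obtain a b where "x \<in> box a b" "cbox a b \<subseteq> \<Omega>"
        using open_contains_cbox[OF \<Omega>] by metis
      then show "x \<in> \<Union>\<F>" by (auto simp: \<F>_def)
    qed
  qed
  obtain \<D> where \<D>: "\<D> \<subseteq> \<F>" "countable \<D>" "\<Union>\<D> = \<Union>\<F>"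
    using Lindelof[of \<F>] by (auto simp: \<F>_def)
  have "negligible {x \<in> X. h x \<noteq> 0}" if X: "X \<in> \<D>" for X
  proof -
    obtain c d where "X = box c d" "cbox c d \<subseteq> \<Omega>"
      using X \<D>(1) by (auto simp: \<F>_def)
    then show ?thesis using *[of c d] by simp
  qed
  then have "negligible (\<Union>X\<in>\<D>. {x \<in> X. h x \<noteq> 0})"
    using \<D>(2) by (intro negligible_countable_Union) auto
  moreover have "(\<Union>X\<in>\<D>. {x \<in> X. h x \<noteq> 0}) = {x \<in> \<Omega>. h x \<noteq> 0}"
    using \<D>(3) UF by blast
  ultimately have "negligible {x \<in> \<Omega>. h x \<noteq> 0}" by simp
  then have "{x \<in> \<Omega>. h x \<noteq> 0} \<in> null_sets lebesgue" by (simp add: negligible_iff_null_sets)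
  then have "AE x in lebesgue. x \<notin> {x \<in> \<Omega>. h x \<noteq> 0}" by (rule AE_not_in)
  then show ?thesis
    using \<Omega> by (subst AE_restrict_space_iff) auto
qed

section \<open>Continuously differentiable functions with compact support\<close>

abbreviation pdiff :: "'a::euclidean_space \<Rightarrow> ('a \<Rightarrow> real) \<Rightarrow> 'a \<Rightarrow> real" where
  "pdiff e w x \<equiv> frechet_derivative w (at x) e"

text \<open>Unlike the test functions, these functions are stable under composition with merely
  continuously differentiable functions.\<close>

definition C1c :: "'a::euclidean_space set \<Rightarrow> ('a \<Rightarrow> real) set" where
  "C1c \<Omega> = {w. (\<forall>x. w differentiable (at x)) \<and> (\<forall>e\<in>Basis. continuous_on UNIV (pdiff e w)) \<and>
     compact (closure {x. w x \<noteq> 0}) \<and> closure {x. w x \<noteq> 0} \<subseteq> \<Omega>}"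

lemma test_functions_C1c: "test_functions \<Omega> \<subseteq> C1c \<Omega>"
proof
  fix \<phi> :: "'a \<Rightarrow> real" assume "\<phi> \<in> test_functions \<Omega>"
  then have \<phi>: "smooth_on UNIV \<phi>" "compact (closure {x. \<phi> x \<noteq> 0})" "closure {x. \<phi> x \<noteq> 0} \<subseteq> \<Omega>"
    by (auto simp: test_functions_def)
  have "Ck_on (Suc 0) UNIV \<phi>" using \<phi>(1) by (simp add: smooth_on_def del: Ck_on.simps)
  then show "\<phi> \<in> C1c \<Omega>" using \<phi> by (auto simp: C1c_def differentiable_on_def)
qed

lemma C1c_zero_outside:
  assumes "w \<in> C1c \<Omega>" "x \<notin> closure {x. w x \<noteq> 0}"
  shows "w x = 0" "pdiff e w x = 0"
proof -
  show "w x = 0" using assms closure_subset[of "{x. w x \<noteq> 0}"] by auto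
  have "(w has_derivative (\<lambda>v. 0)) (at x)"
  proof (rule has_derivative_transform_within_open)
    show "((\<lambda>x. 0) has_derivative (\<lambda>v. 0)) (at x)" by simp
    show "open (- closure {x. w x \<noteq> 0})" by (simp add: open_Compl)
    show "x \<in> - closure {x. w x \<noteq> 0}" using assms by simp
    show "0 = w y" if "y \<in> - closure {x. w x \<noteq> 0}" for y
      using that closure_subset[of "{x. w x \<noteq> 0}"] by auto
  qed
  then show "pdiff e w x = 0" using frechet_derivative_at[of w] by metis
qed

lemma C1c_zero_outside_domain:
  assumes "w \<in> C1c \<Omega>" "x \<notin> \<Omega>"
  shows "w x = 0" "pdiff e w x = 0"
  using assms C1c_zero_outside[OF assms(1), of x] by (auto simp: C1c_def)

lemma C1c_continuous:
  assumes "w \<in> C1c \<Omega>"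
  shows "continuous_on UNIV w" "e \<in> Basis \<Longrightarrow> continuous_on UNIV (pdiff e w)"
  using assms by (auto simp: C1c_def intro!: continuous_at_imp_continuous_on differentiable_imp_continuous_within)

lemma C1c_measurable[measurable_dest]:
  assumes "w \<in> C1c \<Omega>"
  shows "w \<in> borel_measurable borel" "e \<in> Basis \<Longrightarrow> pdiff e w \<in> borel_measurable borel"
  using C1c_continuous[OF assms] by (auto intro: borel_measurable_continuous_onI)

lemma C1c_deriv_line:
  assumes "w \<in> C1c \<Omega>"
  shows "((\<lambda>s. w (x + s *\<^sub>R e)) has_real_derivative pdiff e w (x + s *\<^sub>R e)) (at s)"
proof -
  have "(w has_derivative frechet_derivative w (at (x + s *\<^sub>R e))) (at (x + s *\<^sub>R e))"
    using assms by (auto simp: C1c_def frechet_derivative_works)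
  moreover have "((\<lambda>s. x + s *\<^sub>R e) has_derivative (\<lambda>t. t *\<^sub>R e)) (at s)"
    by (auto intro!: derivative_eq_intros)
  ultimately have "((\<lambda>s. w (x + s *\<^sub>R e)) has_derivative (\<lambda>t. pdiff (t *\<^sub>R e) w (x + s *\<^sub>R e))) (at s)"
    by (rule has_derivative_compose[rotated])
  moreover have "pdiff (t *\<^sub>R e) w (x + s *\<^sub>R e) = pdiff e w (x + s *\<^sub>R e) * t" for t
    using \<open>(w has_derivative _) _\<close> linear_cmul[OF has_derivative_linear] by (metis mult.commute real_scaleR_def)
  ultimately show ?thesis by (simp add: has_field_derivative_def)
qed

lemma C1c_bounded:
  assumes "w \<in> C1c \<Omega>" "e \<in> Basis"
  obtains B where "B \<ge> 0" "\<And>x. \<bar>w x\<bar> \<le> B" "\<And>x. \<bar>pdiff e w x\<bar> \<le> B"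
    "\<And>x t. \<bar>w (x + t *\<^sub>R e) - w x\<bar> \<le> B * \<bar>t\<bar>"
proof -
  let ?K = "closure {x. w x \<noteq> 0}"
  have K: "compact ?K" using assms by (simp add: C1c_def)
  have "bounded (w ` ?K)" "bounded (pdiff e w ` ?K)"
    using C1c_continuous[OF assms(1)] assms(2) K
    by (auto intro!: compact_imp_bounded compact_continuous_image intro: continuous_on_subset)
  then obtain B1 B2 where B: "\<And>x. x \<in> ?K \<Longrightarrow> \<bar>w x\<bar> \<le> B1" "\<And>x. x \<in> ?K \<Longrightarrow> \<bar>pdiff e w x\<bar> \<le> B2"
    by (force simp: bounded_iff)
  define B where "B = max 0 (max B1 B2)"
  have b1: "\<bar>w x\<bar> \<le> B" and b2: "\<bar>pdiff e w x\<bar> \<le> B" for x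
    using B[of x] C1c_zero_outside[OF assms(1), of x] by (cases "x \<in> ?K"; force simp: B_def)+
  have "\<bar>w (x + t *\<^sub>R e) - w x\<bar> \<le> B * \<bar>t\<bar>" for x t
  proof -
    have "norm (w (x + t *\<^sub>R e) - w (x + 0 *\<^sub>R e)) \<le> B * norm (t - 0)"
      by (rule field_differentiable_bound[of UNIV _ "\<lambda>s. pdiff e w (x + s *\<^sub>R e)"])
        (auto simp: b2 intro: C1c_deriv_line[OF assms(1)])
    then show ?thesis by simp
  qed
  then show ?thesis using that[of B] b1 b2 by (auto simp: B_def)
qed

lemma C1c_integrable:
  assumes "w \<in> C1c \<Omega>" "continuous_on UNIV f"
  shows "integrable lborel (\<lambda>x. f x * w x)"
    "e \<in> Basis \<Longrightarrow> integrable lborel (\<lambda>x. f x * pdiff e w x)"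
proof -
  let ?K = "closure {x. w x \<noteq> 0}"
  have K: "compact ?K" using assms by (simp add: C1c_def)
  have "integrable lborel (\<lambda>x. indicator ?K x *\<^sub>R (f x * w x))"
    using C1c_continuous[OF assms(1)] assms(2) K
    by (intro borel_integrable_compact continuous_intros) (auto intro: continuous_on_subset)
  moreover have "(\<lambda>x. indicator ?K x *\<^sub>R (f x * w x)) = (\<lambda>x. f x * w x)"
  proof
    show "indicator ?K x *\<^sub>R (f x * w x) = f x * w x" for x
      using C1c_zero_outside[OF assms(1), of x] by (cases "x \<in> ?K") simp_all
  qed
  ultimately show "integrable lborel (\<lambda>x. f x * w x)" by simp
  assume e: "e \<in> Basis"
  have "integrable lborel (\<lambda>x. indicator ?K x *\<^sub>R (f x * pdiff e w x))"
    using C1c_continuous[OF assms(1)] assms(2) K e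
    by (intro borel_integrable_compact continuous_intros) (auto intro: continuous_on_subset)
  moreover have "(\<lambda>x. indicator ?K x *\<^sub>R (f x * pdiff e w x)) = (\<lambda>x. f x * pdiff e w x)"
  proof
    show "indicator ?K x *\<^sub>R (f x * pdiff e w x) = f x * pdiff e w x" for x
      using C1c_zero_outside[OF assms(1), of x] by (cases "x \<in> ?K") simp_all
  qed
  ultimately show "integrable lborel (\<lambda>x. f x * pdiff e w x)" by simp
qed

lemma lborel_integral_shift:
  fixes f :: "'a::euclidean_space \<Rightarrow> real"
  assumes [measurable]: "f \<in> borel_measurable borel"
  shows "(\<integral>x. f (x + c) \<partial>lborel) = (\<integral>x. f x \<partial>lborel)"
    "integrable lborel f \<Longrightarrow> integrable lborel (\<lambda>x. f (x + c))"
proof -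
  have "(\<integral>x. f x \<partial>lborel) = (\<integral>x. f x \<partial>distr lborel borel ((+) c))"
    by (simp add: lborel_distr_plus)
  also have "\<dots> = (\<integral>x. f (c + x) \<partial>lborel)" by (rule integral_distr) auto
  finally show "(\<integral>x. f (x + c) \<partial>lborel) = (\<integral>x. f x \<partial>lborel)" by (simp add: add.commute)
  assume "integrable lborel f"
  then have "integrable (distr lborel borel ((+) c)) f" by (simp add: lborel_distr_plus)
  then show "integrable lborel (\<lambda>x. f (x + c))"
    by (subst (asm) integrable_distr_eq) (auto simp: add.commute)
qed

text \<open>Integration by parts by translation invariance: a difference quotient is moved from one factor to the
  other by a shift of the variable, and both sides converge by dominated convergence. The argument
  covers constants, compactly supported functions and truncations alike.\<close>

lemma integral_by_parts_lipschitz: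
  fixes w d :: "'a::euclidean_space \<Rightarrow> real"
  assumes e: "e \<in> Basis" and w: "continuous_on UNIV w" and [measurable]: "d \<in> borel_measurable borel"
    and L: "\<And>x t. \<bar>w (x + t *\<^sub>R e) - w x\<bar> \<le> L * \<bar>t\<bar>"
    and d: "AE x in lborel. ((\<lambda>s. w (x + s *\<^sub>R e)) has_real_derivative d x) (at 0)"
    and \<psi>: "\<psi> \<in> C1c \<Omega>"
  shows "(\<integral>x. w x * pdiff e \<psi> x \<partial>lborel) = - (\<integral>x. d x * \<psi> x \<partial>lborel)"
proof -
  define h where "h m = inverse (real (Suc m))" for m
  have h: "h m > 0" "h m \<le> 1" for m by (auto simp: h_def field_simps)
  have h0: "h \<longlonglongrightarrow> 0" unfolding h_def by (rule LIMSEQ_inverse_real_of_nat)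
  have hat: "filterlim h (at 0) sequentially"
    using h0 h by (auto simp: filterlim_at intro!: always_eventually) (metis less_irrefl)
  have hat': "filterlim (\<lambda>m. - h m) (at 0) sequentially"
    using tendsto_minus[OF h0] h by (auto simp: filterlim_at intro!: always_eventually) (metis less_irrefl)
  have [measurable]: "w \<in> borel_measurable borel" by (rule borel_measurable_continuous_onI[OF w])
  note [measurable] = C1c_measurable[OF \<psi>]
  obtain B where B: "B \<ge> 0" "\<And>x. \<bar>\<psi> x\<bar> \<le> B" "\<And>x t. \<bar>\<psi> (x + t *\<^sub>R e) - \<psi> x\<bar> \<le> B * \<bar>t\<bar>"
    by (rule C1c_bounded[OF \<psi> e]) metis
  have "compact (closure {x. \<psi> x \<noteq> 0})" using \<psi> by (simp add: C1c_def)
  then obtain R where R: "\<And>x. x \<in> closure {x. \<psi> x \<noteq> 0} \<Longrightarrow> norm x \<le> R"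
    using compact_imp_bounded bounded_iff by metis
  have supp: "\<psi> x = 0" if "norm x > R" for x
    using R[of x] C1c_zero_outside(1)[OF \<psi>, of x] that by force
  define K where "K = cball (0::'a) (R + 1)"
  have "bounded (w ` K)"
    unfolding K_def by (intro compact_imp_bounded compact_continuous_image continuous_on_subset[OF w]) auto
  then obtain C where C: "\<And>x. x \<in> K \<Longrightarrow> \<bar>w x\<bar> \<le> C" by (force simp: bounded_iff)
  have lim1: "(\<lambda>m. \<integral>x. (w (x + h m *\<^sub>R e) - w x) / h m * \<psi> x \<partial>lborel) \<longlonglongrightarrow> (\<integral>x. d x * \<psi> x \<partial>lborel)"
  proof (rule integral_dominated_convergence[where w = "\<lambda>x. L * \<bar>\<psi> x\<bar>"])
    show "integrable lborel (\<lambda>x. L * \<bar>\<psi> x\<bar>)"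
      using C1c_integrable(1)[OF \<psi>, of "\<lambda>_. 1"] by simp
    show "AE x in lborel. (\<lambda>m. (w (x + h m *\<^sub>R e) - w x) / h m * \<psi> x) \<longlonglongrightarrow> d x * \<psi> x"
      using d
    proof eventually_elim
      case (elim x)
      then have "((\<lambda>s. (w (x + s *\<^sub>R e) - w x) / s) \<longlongrightarrow> d x) (at 0)"
        by (simp add: DERIV_def)
      then have "(\<lambda>m. (w (x + h m *\<^sub>R e) - w x) / h m) \<longlonglongrightarrow> d x"
        using filterlim_compose[OF _ hat] by blast
      then show ?case by (intro tendsto_mult tendsto_const)
    qed
    show "AE x in lborel. norm ((w (x + h m *\<^sub>R e) - w x) / h m * \<psi> x) \<le> L * \<bar>\<psi> x\<bar>" for m
    proof (intro AE_I2)
      fix x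
      have "\<bar>(w (x + h m *\<^sub>R e) - w x) / h m\<bar> \<le> L"
        using L[of x "h m"] h[of m] by (simp add: divide_le_eq)
      then show "norm ((w (x + h m *\<^sub>R e) - w x) / h m * \<psi> x) \<le> L * \<bar>\<psi> x\<bar>"
        by (simp only: abs_mult real_norm_def mult_right_mono abs_ge_zero)
    qed
  qed measurable
  have lim2: "(\<lambda>m. \<integral>x. w x * ((\<psi> (x + (- h m) *\<^sub>R e) - \<psi> x) / h m) \<partial>lborel) \<longlonglongrightarrow> (\<integral>x. w x * - pdiff e \<psi> x \<partial>lborel)"
  proof (rule integral_dominated_convergence[where w = "\<lambda>x. indicator K x *\<^sub>R (C * B)"])
    show "(\<lambda>x. w x * - pdiff e \<psi> x) \<in> borel_measurable lborel" using e by measurable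
    show "integrable lborel (\<lambda>x. indicator K x *\<^sub>R (C * B))"
      unfolding K_def by (intro borel_integrable_compact) auto
    show "AE x in lborel. (\<lambda>m. w x * ((\<psi> (x + (- h m) *\<^sub>R e) - \<psi> x) / h m)) \<longlonglongrightarrow> w x * - pdiff e \<psi> x"
    proof (intro AE_I2 tendsto_mult tendsto_const)
      fix x
      have "((\<lambda>s. (\<psi> (x + s *\<^sub>R e) - \<psi> x) / s) \<longlongrightarrow> pdiff e \<psi> x) (at 0)"
        using C1c_deriv_line[OF \<psi>, of x e 0] by (simp add: DERIV_def)
      then have "(\<lambda>m. (\<psi> (x + (- h m) *\<^sub>R e) - \<psi> x) / (- h m)) \<longlonglongrightarrow> pdiff e \<psi> x"
        using filterlim_compose[OF _ hat'] by blast
      then have "(\<lambda>m. - ((\<psi> (x + (- h m) *\<^sub>R e) - \<psi> x) / (- h m))) \<longlonglongrightarrow> - pdiff e \<psi> x"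
        by (rule tendsto_minus)
      then show "(\<lambda>m. (\<psi> (x + (- h m) *\<^sub>R e) - \<psi> x) / h m) \<longlonglongrightarrow> - pdiff e \<psi> x" by simp
    qed
    show "AE x in lborel. norm (w x * ((\<psi> (x + (- h m) *\<^sub>R e) - \<psi> x) / h m)) \<le> indicator K x *\<^sub>R (C * B)" for m
    proof (intro AE_I2)
      fix x
      show "norm (w x * ((\<psi> (x + (- h m) *\<^sub>R e) - \<psi> x) / h m)) \<le> indicator K x *\<^sub>R (C * B)"
      proof (cases "x \<in> K")
        case True
        have "\<bar>(\<psi> (x + (- h m) *\<^sub>R e) - \<psi> x) / h m\<bar> \<le> B"
          using B(3)[of x "- h m"] h[of m] by (simp add: divide_le_eq)
        then have "\<bar>w x\<bar> * \<bar>(\<psi> (x + (- h m) *\<^sub>R e) - \<psi> x) / h m\<bar> \<le> C * B"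
          using C[OF True] by (intro mult_mono) (use abs_ge_zero order_trans in blast)+
        then show ?thesis using True by (simp add: abs_mult)
      next
        case False
        then have n: "norm x > R + 1" by (simp add: K_def)
        have "norm (x + (- h m) *\<^sub>R e) \<ge> norm x - norm ((- h m) *\<^sub>R e)"
          by (metis norm_diff_ineq)
        moreover have "norm ((- h m) *\<^sub>R e) \<le> 1" using h[of m] e by simp
        ultimately have "norm (x + (- h m) *\<^sub>R e) > R" using n by linarith
        then show ?thesis using False n supp by simp
      qed
    qed
  qed measurable
  have eq: "(\<integral>x. (w (x + h m *\<^sub>R e) - w x) / h m * \<psi> x \<partial>lborel) = (\<integral>x. w x * ((\<psi> (x + (- h m) *\<^sub>R e) - \<psi> x) / h m) \<partial>lborel)" for m
  proof -
    have i1: "integrable lborel (\<lambda>x. w (x + h m *\<^sub>R e) / h m * \<psi> x)"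
      by (intro C1c_integrable[OF \<psi>] continuous_intros continuous_on_compose2[OF w]) (use h[of m] in auto)
    have i2: "integrable lborel (\<lambda>x. w x / h m * \<psi> x)"
      by (intro C1c_integrable[OF \<psi>] continuous_intros w) (use h[of m] in auto)
    have i3: "integrable lborel (\<lambda>x. w x / h m * \<psi> (x + (- h m) *\<^sub>R e))"
      using lborel_integral_shift(2)[OF _ i1, of "(- h m) *\<^sub>R e"] by simp
    have "(\<integral>x. (w (x + h m *\<^sub>R e) - w x) / h m * \<psi> x \<partial>lborel)
        = (\<integral>x. w (x + h m *\<^sub>R e) / h m * \<psi> x - w x / h m * \<psi> x \<partial>lborel)"
      by (simp add: algebra_simps diff_divide_distrib)
    also have "\<dots> = (\<integral>x. w (x + h m *\<^sub>R e) / h m * \<psi> x \<partial>lborel) - (\<integral>x. w x / h m * \<psi> x \<partial>lborel)"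
      by (rule Bochner_Integration.integral_diff[OF i1 i2])
    also have "(\<integral>x. w (x + h m *\<^sub>R e) / h m * \<psi> x \<partial>lborel) = (\<integral>x. w x / h m * \<psi> (x + (- h m) *\<^sub>R e) \<partial>lborel)"
      using lborel_integral_shift(1)[of "\<lambda>x. w (x + h m *\<^sub>R e) / h m * \<psi> x" "(- h m) *\<^sub>R e"] by auto
    also have "\<dots> - (\<integral>x. w x / h m * \<psi> x \<partial>lborel) = (\<integral>x. w x / h m * \<psi> (x + (- h m) *\<^sub>R e) - w x / h m * \<psi> x \<partial>lborel)"
      by (rule Bochner_Integration.integral_diff[OF i3 i2, symmetric])
    also have "\<dots> = (\<integral>x. w x * ((\<psi> (x + (- h m) *\<^sub>R e) - \<psi> x) / h m) \<partial>lborel)"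
      by (simp add: algebra_simps diff_divide_distrib)
    finally show ?thesis .
  qed
  have "(\<integral>x. d x * \<psi> x \<partial>lborel) = (\<integral>x. w x * - pdiff e \<psi> x \<partial>lborel)"
    using LIMSEQ_unique[OF lim1 lim2[folded eq]] .
  then show ?thesis by simp
qed

lemma integral_lebesgue_on_lborel:
  fixes f :: "'a::euclidean_space \<Rightarrow> real"
  assumes "\<Omega> \<in> sets borel" "f \<in> borel_measurable borel" "\<And>x. x \<notin> \<Omega> \<Longrightarrow> f x = 0"
  shows "(\<integral>x. f x \<partial>lebesgue_on \<Omega>) = (\<integral>x. f x \<partial>lborel)"
    "integrable (lebesgue_on \<Omega>) f \<longleftrightarrow> integrable lborel f"
proof -
  have eq: "(\<lambda>x. indicator \<Omega> x * f x) = f" using assms(3) by (auto simp: indicator_def fun_eq_iff)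
  show "(\<integral>x. f x \<partial>lebesgue_on \<Omega>) = (\<integral>x. f x \<partial>lborel)"
    using assms by (subst integral_restrict_space) (auto simp: eq integral_completion)
  show "integrable (lebesgue_on \<Omega>) f \<longleftrightarrow> integrable lborel f"
    using assms by (subst integrable_restrict_space) (auto simp: eq integrable_completion)
qed

section \<open>Limits in the mean together with one derivative\<close>

lemma C1c_measurable_on:
  assumes "w \<in> C1c \<Omega>"
  shows "w \<in> borel_measurable (lebesgue_on S)"
    "e \<in> Basis \<Longrightarrow> pdiff e w \<in> borel_measurable (lebesgue_on S)"
  using C1c_measurable[OF assms] by (auto intro!: measurable_restrict_space1 measurable_completion)

lemma C1c_integrable_on:
  assumes "w \<in> C1c \<Omega>" "\<Omega> \<in> sets borel"
  shows "integrable (lebesgue_on \<Omega>) w" "e \<in> Basis \<Longrightarrow> integrable (lebesgue_on \<Omega>) (pdiff e w)"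
  using C1c_integrable[OF assms(1), of "\<lambda>_. 1"] C1c_measurable[OF assms(1)]
    C1c_zero_outside_domain[OF assms(1)] assms(2)
  by (simp_all add: integral_lebesgue_on_lborel(2))

lemma C1c_compose:
  fixes F F' :: "real \<Rightarrow> real"
  assumes w: "w \<in> C1c \<Omega>" and F: "\<And>t. (F has_real_derivative F' t) (at t)"
    and F': "continuous_on UNIV F'" and F0: "F 0 = 0"
  shows "(\<lambda>x. F (w x)) \<in> C1c \<Omega>" "pdiff e (\<lambda>x. F (w x)) x = F' (w x) * pdiff e w x"
proof -
  have D: "((\<lambda>x. F (w x)) has_derivative (\<lambda>v. F' (w x) * pdiff v w x)) (at x)" for x
    using w F[of "w x"]
    by (intro has_derivative_compose[of w _ _ _ F]) (auto simp: C1c_def frechet_derivative_works has_field_derivative_def)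
  then show pd: "pdiff e (\<lambda>x. F (w x)) x = F' (w x) * pdiff e w x" for e x
    by (metis frechet_derivative_at)
  have sub: "closure {x. F (w x) \<noteq> 0} \<subseteq> closure {x. w x \<noteq> 0}"
    using F0 by (intro closure_mono) auto
  have "compact (closure {x. F (w x) \<noteq> 0})"
    using w sub compact_Int_closed[of "closure {x. w x \<noteq> 0}" "closure {x. F (w x) \<noteq> 0}"]
    by (simp add: C1c_def Int_absorb1)
  moreover have "continuous_on UNIV (pdiff e (\<lambda>x. F (w x)))" if "e \<in> Basis" for e
    unfolding pd using C1c_continuous[OF w] that
    by (intro continuous_on_mult continuous_on_compose2[OF F']) auto
  ultimately show "(\<lambda>x. F (w x)) \<in> C1c \<Omega>"
    using w sub D by (auto simp: C1c_def intro: differentiableI)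
qed

lemma integral_mult_tendsto_L1:
  fixes f b :: "'x \<Rightarrow> real"
  assumes "\<And>j. integrable M (F j)" "integrable M f" and b: "b \<in> borel_measurable M" "\<And>x. \<bar>b x\<bar> \<le> B"
    and lim: "(\<lambda>j::nat. \<integral>x. \<bar>F j x - f x\<bar> \<partial>M) \<longlonglongrightarrow> 0"
  shows "(\<lambda>j. \<integral>x. F j x * b x \<partial>M) \<longlonglongrightarrow> (\<integral>x. f x * b x \<partial>M)"
proof -
  have B: "B \<ge> 0" using b(2) abs_ge_zero order_trans by blast
  have ib: "integrable M (\<lambda>x. g x * b x)" if "integrable M g" for g
  proof (rule Bochner_Integration.integrable_bound)
    show "integrable M (\<lambda>x. B * g x)" using that by simp
    show "(\<lambda>x. g x * b x) \<in> borel_measurable M" using that b(1) by auto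
    show "AE x in M. norm (g x * b x) \<le> norm (B * g x)"
      using b(2) B by (intro AE_I2) (auto simp: abs_mult mult.commute intro: mult_right_mono)
  qed
  have "norm ((\<integral>x. F j x * b x \<partial>M) - (\<integral>x. f x * b x \<partial>M)) \<le> B * (\<integral>x. \<bar>F j x - f x\<bar> \<partial>M)" for j
  proof -
    have "(\<integral>x. F j x * b x \<partial>M) - (\<integral>x. f x * b x \<partial>M) = (\<integral>x. (F j x - f x) * b x \<partial>M)"
      using ib[OF assms(1)[of j]] ib[OF assms(2)] by (simp add: left_diff_distrib)
    also have "norm \<dots> \<le> (\<integral>x. norm ((F j x - f x) * b x) \<partial>M)" by (rule integral_norm_bound)
    also have "\<dots> \<le> (\<integral>x. B * \<bar>F j x - f x\<bar> \<partial>M)"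
    proof (rule integral_mono)
      show "integrable M (\<lambda>x. norm ((F j x - f x) * b x))"
        using ib[of "\<lambda>x. F j x - f x"] assms(1,2) by simp
      show "integrable M (\<lambda>x. B * \<bar>F j x - f x\<bar>)" using assms(1,2) by simp
      show "norm ((F j x - f x) * b x) \<le> B * \<bar>F j x - f x\<bar>" for x
        using b(2)[of x] by (simp add: abs_mult mult.commute mult_right_mono)
    qed
    finally show ?thesis by simp
  qed
  moreover have "(\<lambda>j. B * (\<integral>x. \<bar>F j x - f x\<bar> \<partial>M)) \<longlonglongrightarrow> B * 0"
    by (intro tendsto_mult tendsto_const lim)
  ultimately have "(\<lambda>j. (\<integral>x. F j x * b x \<partial>M) - (\<integral>x. f x * b x \<partial>M)) \<longlonglongrightarrow> 0"
    by - (rule Lim_null_comparison[OF always_eventually], simp_all)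
  then show ?thesis by (simp add: LIM_zero_iff)
qed

text \<open>\<open>g\<close> is the strong derivative of \<open>v\<close> in the direction \<open>e\<close>, with zero boundary values. A single
  direction is considered because the Gagliardo inequality uses different functions in different directions.\<close>

definition L1_deriv_limit :: "'a::euclidean_space set \<Rightarrow> 'a \<Rightarrow> ('a \<Rightarrow> real) \<Rightarrow> ('a \<Rightarrow> real) \<Rightarrow> bool" where
  "L1_deriv_limit \<Omega> e v g \<longleftrightarrow> integrable (lebesgue_on \<Omega>) v \<and> integrable (lebesgue_on \<Omega>) g \<and>
     (\<exists>w. (\<forall>j::nat. w j \<in> C1c \<Omega>) \<and>
        (\<lambda>j. \<integral>x. \<bar>w j x - v x\<bar> \<partial>lebesgue_on \<Omega>) \<longlonglongrightarrow> 0 \<and>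
        (\<lambda>j. \<integral>x. \<bar>pdiff e (w j) x - g x\<bar> \<partial>lebesgue_on \<Omega>) \<longlonglongrightarrow> 0)"

lemma L1_deriv_limit_AE:
  assumes D: "L1_deriv_limit \<Omega> e v g" and \<Omega>: "\<Omega> \<in> sets borel"
  obtains w where "\<And>j::nat. w j \<in> C1c \<Omega>"
    "(\<lambda>j. \<integral>x. \<bar>w j x - v x\<bar> \<partial>lebesgue_on \<Omega>) \<longlonglongrightarrow> 0"
    "(\<lambda>j. \<integral>x. \<bar>pdiff e (w j) x - g x\<bar> \<partial>lebesgue_on \<Omega>) \<longlonglongrightarrow> 0"
    "AE x in lebesgue_on \<Omega>. (\<lambda>j. w j x) \<longlonglongrightarrow> v x"
proof -
  obtain w where w: "\<And>j::nat. w j \<in> C1c \<Omega>"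
    "(\<lambda>j. \<integral>x. \<bar>w j x - v x\<bar> \<partial>lebesgue_on \<Omega>) \<longlonglongrightarrow> 0"
    "(\<lambda>j. \<integral>x. \<bar>pdiff e (w j) x - g x\<bar> \<partial>lebesgue_on \<Omega>) \<longlonglongrightarrow> 0"
    using D by (auto simp: L1_deriv_limit_def)
  have i: "integrable (lebesgue_on \<Omega>) (\<lambda>x. w j x - v x)" for j
    using D C1c_integrable_on(1)[OF w(1) \<Omega>] by (auto simp: L1_deriv_limit_def)
  obtain r :: "nat \<Rightarrow> nat" where r: "strict_mono r" "AE x in lebesgue_on \<Omega>. (\<lambda>j. w (r j) x - v x) \<longlonglongrightarrow> 0"
    using tendsto_L1_AE_subseq[of "lebesgue_on \<Omega>" "\<lambda>j x. w j x - v x"] i w(2) by auto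
  show ?thesis
  proof
    show "w (r j) \<in> C1c \<Omega>" for j by (rule w(1))
    show "(\<lambda>j. \<integral>x. \<bar>w (r j) x - v x\<bar> \<partial>lebesgue_on \<Omega>) \<longlonglongrightarrow> 0"
      "(\<lambda>j. \<integral>x. \<bar>pdiff e (w (r j)) x - g x\<bar> \<partial>lebesgue_on \<Omega>) \<longlonglongrightarrow> 0"
      using LIMSEQ_subseq_LIMSEQ[OF w(2) r(1)] LIMSEQ_subseq_LIMSEQ[OF w(3) r(1)] by (auto simp: o_def)
    show "AE x in lebesgue_on \<Omega>. (\<lambda>j. w (r j) x) \<longlonglongrightarrow> v x"
      using r(2) by (simp add: LIM_zero_iff)
  qed
qed

lemma L1_deriv_limit_diff:
  assumes \<Omega>: "\<Omega> \<in> sets borel" and e: "e \<in> Basis"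
    and D: "L1_deriv_limit \<Omega> e v g" "L1_deriv_limit \<Omega> e v' g'"
  shows "L1_deriv_limit \<Omega> e (\<lambda>x. v x - v' x) (\<lambda>x. g x - g' x)"
proof -
  let ?M = "lebesgue_on \<Omega>"
  obtain w w' where w: "\<And>j::nat. w j \<in> C1c \<Omega>"
    "(\<lambda>j. \<integral>x. \<bar>w j x - v x\<bar> \<partial>?M) \<longlonglongrightarrow> 0"
    "(\<lambda>j. \<integral>x. \<bar>pdiff e (w j) x - g x\<bar> \<partial>?M) \<longlonglongrightarrow> 0"
    and w': "\<And>j::nat. w' j \<in> C1c \<Omega>"
    "(\<lambda>j. \<integral>x. \<bar>w' j x - v' x\<bar> \<partial>?M) \<longlonglongrightarrow> 0"
    "(\<lambda>j. \<integral>x. \<bar>pdiff e (w' j) x - g' x\<bar> \<partial>?M) \<longlonglongrightarrow> 0"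
    using D by (auto simp: L1_deriv_limit_def)
  have [simp]: "integrable ?M v" "integrable ?M g" "integrable ?M v'" "integrable ?M g'"
    using D by (auto simp: L1_deriv_limit_def)
  note [simp] = C1c_integrable_on[OF w(1) \<Omega>] C1c_integrable_on[OF w'(1) \<Omega>]
  have pd: "pdiff b (\<lambda>x. w j x - w' j x) x = pdiff b (w j) x - pdiff b (w' j) x" for b j x
  proof -
    have "((\<lambda>x. w j x - w' j x) has_derivative (\<lambda>b. pdiff b (w j) x - pdiff b (w' j) x)) (at x)"
      using w(1)[of j] w'(1)[of j]
      by (intro has_derivative_diff) (auto simp: C1c_def frechet_derivative_works)
    from fun_cong[OF frechet_derivative_at[OF this], of b] show ?thesis by simp
  qed
  have mem: "(\<lambda>x. w j x - w' j x) \<in> C1c \<Omega>" for j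
  proof -
    have sub: "closure {x. w j x - w' j x \<noteq> 0} \<subseteq> closure {x. w j x \<noteq> 0} \<union> closure {x. w' j x \<noteq> 0}"
      unfolding closure_Un[symmetric] by (intro closure_mono) auto
    have "compact (closure {x. w j x \<noteq> 0} \<union> closure {x. w' j x \<noteq> 0})"
      using w(1)[of j] w'(1)[of j] by (auto simp: C1c_def)
    then have "bounded (closure {x. w j x - w' j x \<noteq> 0})"
      using sub bounded_subset compact_imp_bounded by blast
    then have "compact (closure {x. w j x - w' j x \<noteq> 0})"
      by (simp add: compact_eq_bounded_closed)
    moreover have "continuous_on UNIV (pdiff b (\<lambda>x. w j x - w' j x))" if "b \<in> Basis" for b
      unfolding pd using C1c_continuous(2)[OF w(1) that] C1c_continuous(2)[OF w'(1) that] by (intro continuous_on_diff)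
    moreover have "closure {x. w j x \<noteq> 0} \<union> closure {x. w' j x \<noteq> 0} \<subseteq> \<Omega>"
      using w(1)[of j] w'(1)[of j] by (simp add: C1c_def)
    ultimately show ?thesis
      using w(1)[of j] w'(1)[of j] sub unfolding C1c_def mem_Collect_eq by (blast intro: differentiable_diff)
  qed
  have tri: "(\<lambda>j. \<integral>x. \<bar>(f j x - f' j x) - (h x - h' x)\<bar> \<partial>?M) \<longlonglongrightarrow> 0"
    if "\<And>j. integrable ?M (f j)" "\<And>j. integrable ?M (f' j)" "integrable ?M h" "integrable ?M h'"
      "(\<lambda>j. \<integral>x. \<bar>f j x - h x\<bar> \<partial>?M) \<longlonglongrightarrow> 0" "(\<lambda>j. \<integral>x. \<bar>f' j x - h' x\<bar> \<partial>?M) \<longlonglongrightarrow> 0"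
    for f f' :: "nat \<Rightarrow> 'a \<Rightarrow> real" and h h' :: "'a \<Rightarrow> real"
  proof (rule Lim_null_comparison[OF always_eventually])
    show "\<forall>j. norm (\<integral>x. \<bar>(f j x - f' j x) - (h x - h' x)\<bar> \<partial>?M)
      \<le> (\<integral>x. \<bar>f j x - h x\<bar> \<partial>?M) + (\<integral>x. \<bar>f' j x - h' x\<bar> \<partial>?M)"
    proof
      fix j
      have "(\<integral>x. \<bar>(f j x - f' j x) - (h x - h' x)\<bar> \<partial>?M) \<le> (\<integral>x. \<bar>f j x - h x\<bar> + \<bar>f' j x - h' x\<bar> \<partial>?M)"
        using that by (intro integral_mono) auto
      then show "norm (\<integral>x. \<bar>(f j x - f' j x) - (h x - h' x)\<bar> \<partial>?M)
        \<le> (\<integral>x. \<bar>f j x - h x\<bar> \<partial>?M) + (\<integral>x. \<bar>f' j x - h' x\<bar> \<partial>?M)" using that by simp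
    qed
    show "(\<lambda>j. (\<integral>x. \<bar>f j x - h x\<bar> \<partial>?M) + (\<integral>x. \<bar>f' j x - h' x\<bar> \<partial>?M)) \<longlonglongrightarrow> 0"
      using tendsto_add[OF that(5,6)] by simp
  qed
  have "(\<lambda>j. \<integral>x. \<bar>(w j x - w' j x) - (v x - v' x)\<bar> \<partial>?M) \<longlonglongrightarrow> 0"
    by (rule tri[OF _ _ _ _ w(2) w'(2)]) auto
  moreover have "(\<lambda>j. \<integral>x. \<bar>pdiff e (\<lambda>x. w j x - w' j x) x - (g x - g' x)\<bar> \<partial>?M) \<longlonglongrightarrow> 0"
    unfolding pd by (rule tri[OF _ _ _ _ w(3) w'(3)]) (use e in auto)
  ultimately show ?thesis
    unfolding L1_deriv_limit_def
    by (intro conjI exI[of _ "\<lambda>j x. w j x - w' j x"] allI mem) auto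
qed

text \<open>The derivatives \<open>F'(w\<^sub>j) \<partial>w\<^sub>j\<close> converge in \<open>L\<^sup>1\<close> because \<open>F'\<close> is bounded: replacing \<open>\<partial>w\<^sub>j\<close> by \<open>g\<close> costs an error
  that tends to 0, and then \<open>F'(w\<^sub>j) g\<close> is dominated and converges almost everywhere along a subsequence.\<close>

lemma L1_deriv_limit_chain:
  fixes F F' :: "real \<Rightarrow> real"
  assumes \<Omega>: "\<Omega> \<in> sets borel" and e: "e \<in> Basis" and D: "L1_deriv_limit \<Omega> e v g"
    and F: "\<And>t. (F has_real_derivative F' t) (at t)" and F': "continuous_on UNIV F'"
    and L: "\<And>t. \<bar>F' t\<bar> \<le> L" and F0: "F 0 = 0"
  shows "L1_deriv_limit \<Omega> e (\<lambda>x. F (v x)) (\<lambda>x. F' (v x) * g x)"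
proof -
  let ?M = "lebesgue_on \<Omega>"
  obtain w where w: "\<And>j::nat. w j \<in> C1c \<Omega>"
    "(\<lambda>j. \<integral>x. \<bar>w j x - v x\<bar> \<partial>?M) \<longlonglongrightarrow> 0"
    "(\<lambda>j. \<integral>x. \<bar>pdiff e (w j) x - g x\<bar> \<partial>?M) \<longlonglongrightarrow> 0"
    "AE x in ?M. (\<lambda>j. w j x) \<longlonglongrightarrow> v x"
    using L1_deriv_limit_AE[OF D \<Omega>] by blast
  have i[simp]: "integrable ?M v" "integrable ?M g" using D by (auto simp: L1_deriv_limit_def)
  note [measurable] = borel_measurable_integrable[OF i(1)] borel_measurable_integrable[OF i(2)]
  have L0: "L \<ge> 0" using L[of 0] by linarith
  have Fb: "continuous_on UNIV F" using F DERIV_isCont continuous_at_imp_continuous_on by blast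
  have [measurable]: "F \<in> borel_measurable borel" "F' \<in> borel_measurable borel"
    using Fb F' by (auto intro: borel_measurable_continuous_onI)
  have Flip: "\<bar>F s - F t\<bar> \<le> L * \<bar>s - t\<bar>" for s t
    using field_differentiable_bound[of UNIV F F' L s t] F L by auto
  have bnd: "integrable ?M (\<lambda>x. F' (h x) * k x)" if "integrable ?M k" "h \<in> borel_measurable ?M" for h k
  proof (rule Bochner_Integration.integrable_bound)
    show "integrable ?M (\<lambda>x. L * k x)" using that by simp
    show "(\<lambda>x. F' (h x) * k x) \<in> borel_measurable ?M" using that by measurable
    show "AE x in ?M. norm (F' (h x) * k x) \<le> norm (L * k x)"
      by (intro AE_I2) (simp add: abs_mult L L0 mult_right_mono)
  qed
  have iF: "integrable ?M (\<lambda>x. F (v x))"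
  proof (rule Bochner_Integration.integrable_bound)
    show "integrable ?M (\<lambda>x. L * v x)" by simp
    show "AE x in ?M. norm (F (v x)) \<le> norm (L * v x)"
    proof (intro AE_I2)
      show "norm (F (v x)) \<le> norm (L * v x)" for x
        using Flip[of "v x" 0] F0 L0 by (simp add: abs_mult)
    qed
  qed measurable
  note wi = C1c_integrable_on[OF w(1) \<Omega>]
  note wm = C1c_measurable_on[OF w(1)]
  note [measurable] = wm(1) wm(2)[OF e]
  note comp = C1c_compose[OF w(1) F F' F0]
  have "(\<lambda>j. \<integral>x. \<bar>F (w j x) - F (v x)\<bar> \<partial>?M) \<longlonglongrightarrow> 0"
  proof (rule Lim_null_comparison[OF always_eventually])
    show "\<forall>j. norm (\<integral>x. \<bar>F (w j x) - F (v x)\<bar> \<partial>?M) \<le> L * (\<integral>x. \<bar>w j x - v x\<bar> \<partial>?M)"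
    proof
      fix j
      have "(\<integral>x. \<bar>F (w j x) - F (v x)\<bar> \<partial>?M) \<le> (\<integral>x. L * \<bar>w j x - v x\<bar> \<partial>?M)"
        using wi(1)[of j] iF C1c_integrable_on(1)[OF comp(1) \<Omega>, of j] Flip by (intro integral_mono) auto
      then show "norm (\<integral>x. \<bar>F (w j x) - F (v x)\<bar> \<partial>?M) \<le> L * (\<integral>x. \<bar>w j x - v x\<bar> \<partial>?M)" by simp
    qed
    show "(\<lambda>j. L * (\<integral>x. \<bar>w j x - v x\<bar> \<partial>?M)) \<longlonglongrightarrow> 0" using tendsto_mult_left[OF w(2), of L] by simp
  qed
  moreover have "(\<lambda>j. \<integral>x. \<bar>F' (w j x) * pdiff e (w j) x - F' (v x) * g x\<bar> \<partial>?M) \<longlonglongrightarrow> 0"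
  proof (rule Lim_null_comparison[OF always_eventually])
    let ?R = "\<lambda>j x. \<bar>F' (w j x) * g x - F' (v x) * g x\<bar>"
    show "\<forall>j. norm (\<integral>x. \<bar>F' (w j x) * pdiff e (w j) x - F' (v x) * g x\<bar> \<partial>?M)
        \<le> L * (\<integral>x. \<bar>pdiff e (w j) x - g x\<bar> \<partial>?M) + (\<integral>x. ?R j x \<partial>?M)"
    proof
      fix j
      have "(\<integral>x. \<bar>F' (w j x) * pdiff e (w j) x - F' (v x) * g x\<bar> \<partial>?M)
          \<le> (\<integral>x. L * \<bar>pdiff e (w j) x - g x\<bar> + ?R j x \<partial>?M)"
      proof (rule integral_mono)
        show "integrable ?M (\<lambda>x. \<bar>F' (w j x) * pdiff e (w j) x - F' (v x) * g x\<bar>)"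
          using bnd[OF wi(2)[OF e] wm(1), of j j] bnd[OF i(2), of v] by auto
        show "integrable ?M (\<lambda>x. L * \<bar>pdiff e (w j) x - g x\<bar> + ?R j x)"
          using wi(2)[OF e, of j] bnd[OF i(2) wm(1), of j] bnd[OF i(2), of v] by auto
        fix x
        have "\<bar>F' (w j x) * (pdiff e (w j) x - g x)\<bar> \<le> L * \<bar>pdiff e (w j) x - g x\<bar>"
          using L by (auto simp: abs_mult intro: mult_right_mono)
        moreover have "F' (w j x) * pdiff e (w j) x - F' (v x) * g x
            = F' (w j x) * (pdiff e (w j) x - g x) + (F' (w j x) * g x - F' (v x) * g x)"
          by (simp add: algebra_simps)
        ultimately show "\<bar>F' (w j x) * pdiff e (w j) x - F' (v x) * g x\<bar> \<le> L * \<bar>pdiff e (w j) x - g x\<bar> + ?R j x"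
          by linarith
      qed
      also have "\<dots> = L * (\<integral>x. \<bar>pdiff e (w j) x - g x\<bar> \<partial>?M) + (\<integral>x. ?R j x \<partial>?M)"
        using wi(2)[OF e, of j] bnd[OF i(2) wm(1), of j] bnd[OF i(2), of v] by auto
      finally show "norm (\<integral>x. \<bar>F' (w j x) * pdiff e (w j) x - F' (v x) * g x\<bar> \<partial>?M)
        \<le> L * (\<integral>x. \<bar>pdiff e (w j) x - g x\<bar> \<partial>?M) + (\<integral>x. ?R j x \<partial>?M)" by simp
    qed
    have "(\<lambda>j. \<integral>x. ?R j x \<partial>?M) \<longlonglongrightarrow> (\<integral>x. 0 \<partial>?M)"
    proof (rule integral_dominated_convergence[where w = "\<lambda>x. 2 * L * \<bar>g x\<bar>"])
      show "AE x in ?M. (\<lambda>j. ?R j x) \<longlonglongrightarrow> 0"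
        using w(4)
      proof eventually_elim
        case (elim x)
        have "(\<lambda>j. F' (w j x)) \<longlonglongrightarrow> F' (v x)"
          by (rule continuous_on_tendsto_compose[OF F' elim]) auto
        then have "(\<lambda>j. \<bar>F' (w j x) * g x - F' (v x) * g x\<bar>) \<longlonglongrightarrow> \<bar>F' (v x) * g x - F' (v x) * g x\<bar>"
          by (intro tendsto_intros)
        then show ?case by simp
      qed
      show "AE x in ?M. norm (?R j x) \<le> 2 * L * \<bar>g x\<bar>" for j
      proof (intro AE_I2)
        fix x
        have "\<bar>F' (w j x) * g x\<bar> \<le> L * \<bar>g x\<bar>" "\<bar>F' (v x) * g x\<bar> \<le> L * \<bar>g x\<bar>"
          using L by (auto simp: abs_mult intro: mult_right_mono)
        then show "norm (?R j x) \<le> 2 * L * \<bar>g x\<bar>" by simp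
      qed
    qed (use i in auto)
    then show "(\<lambda>j. L * (\<integral>x. \<bar>pdiff e (w j) x - g x\<bar> \<partial>?M) + (\<integral>x. ?R j x \<partial>?M)) \<longlonglongrightarrow> 0"
      using tendsto_add[OF tendsto_mult_left[OF w(3), of L], of "\<lambda>j. \<integral>x. ?R j x \<partial>?M" 0] by simp
  qed
  ultimately show ?thesis
    unfolding L1_deriv_limit_def using iF bnd[OF i(2), of v] comp
    by (intro conjI exI[of _ "\<lambda>j x. F (w j x)"]) auto
qed

lemma L1_deriv_limit_weak:
  assumes \<Omega>: "\<Omega> \<in> sets borel" and e: "e \<in> Basis" and D: "L1_deriv_limit \<Omega> e v g"
    and \<psi>: "\<psi> \<in> C1c \<Omega>"
  shows "(\<integral>x. v x * pdiff e \<psi> x \<partial>lebesgue_on \<Omega>) = - (\<integral>x. g x * \<psi> x \<partial>lebesgue_on \<Omega>)"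
proof -
  let ?M = "lebesgue_on \<Omega>"
  obtain w where w: "\<And>j::nat. w j \<in> C1c \<Omega>"
    "(\<lambda>j. \<integral>x. \<bar>w j x - v x\<bar> \<partial>?M) \<longlonglongrightarrow> 0"
    "(\<lambda>j. \<integral>x. \<bar>pdiff e (w j) x - g x\<bar> \<partial>?M) \<longlonglongrightarrow> 0"
    using D by (auto simp: L1_deriv_limit_def)
  have i[simp]: "integrable ?M v" "integrable ?M g" using D by (auto simp: L1_deriv_limit_def)
  obtain B where B: "\<And>x. \<bar>\<psi> x\<bar> \<le> B" "\<And>x. \<bar>pdiff e \<psi> x\<bar> \<le> B"
    by (rule C1c_bounded[OF \<psi> e]) metis
  have "(\<lambda>j. \<integral>x. w j x * pdiff e \<psi> x \<partial>?M) \<longlonglongrightarrow> (\<integral>x. v x * pdiff e \<psi> x \<partial>?M)"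
    by (rule integral_mult_tendsto_L1[OF _ _ _ B(2) w(2)])
      (use C1c_integrable_on[OF w(1) \<Omega>] C1c_measurable_on[OF \<psi>] e in auto)
  moreover have "(\<lambda>j. - (\<integral>x. pdiff e (w j) x * \<psi> x \<partial>?M)) \<longlonglongrightarrow> - (\<integral>x. g x * \<psi> x \<partial>?M)"
    by (rule tendsto_minus, rule integral_mult_tendsto_L1[OF _ _ _ B(1) w(3)])
      (use C1c_integrable_on[OF w(1) \<Omega>] C1c_measurable_on[OF \<psi>] e in auto)
  moreover have "(\<integral>x. w j x * pdiff e \<psi> x \<partial>?M) = - (\<integral>x. pdiff e (w j) x * \<psi> x \<partial>?M)" for j
  proof -
    note [measurable] = C1c_measurable(1)[OF \<psi>] C1c_measurable(2)[OF \<psi> e]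
      C1c_measurable(1)[OF w(1)] C1c_measurable(2)[OF w(1) e]
    obtain L where L: "\<And>x t. \<bar>w j (x + t *\<^sub>R e) - w j x\<bar> \<le> L * \<bar>t\<bar>"
      by (rule C1c_bounded[OF w(1) e, of j]) metis
    have "(\<integral>x. w j x * pdiff e \<psi> x \<partial>lborel) = - (\<integral>x. pdiff e (w j) x * \<psi> x \<partial>lborel)"
    proof (rule integral_by_parts_lipschitz[OF e _ _ L _ \<psi>])
      show "AE x in lborel. ((\<lambda>s. w j (x + s *\<^sub>R e)) has_real_derivative pdiff e (w j) x) (at 0)"
        using C1c_deriv_line[OF w(1), of j _ e 0] by auto
    qed (use C1c_continuous[OF w(1)] C1c_measurable[OF w(1)] e in auto)
    moreover have "(\<integral>x. w j x * pdiff e \<psi> x \<partial>?M) = (\<integral>x. w j x * pdiff e \<psi> x \<partial>lborel)"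
      using \<Omega> C1c_zero_outside_domain[OF \<psi>] by (intro integral_lebesgue_on_lborel) auto
    moreover have "(\<integral>x. pdiff e (w j) x * \<psi> x \<partial>?M) = (\<integral>x. pdiff e (w j) x * \<psi> x \<partial>lborel)"
      using \<Omega> C1c_zero_outside_domain[OF \<psi>] by (intro integral_lebesgue_on_lborel) auto
    ultimately show ?thesis by simp
  qed
  ultimately show ?thesis using LIMSEQ_unique by auto
qed

lemma integrable_lebesgue_on_subset:
  fixes h :: "'a::euclidean_space \<Rightarrow> real"
  assumes "integrable (lebesgue_on \<Omega>) h" "\<Omega> \<in> sets lebesgue" "K \<subseteq> \<Omega>" "K \<in> sets lebesgue"
  shows "integrable (lebesgue_on K) h"
  using assms set_integrable_subset[of lebesgue \<Omega> h K]
  by (simp add: integrable_restrict_space set_integrable_def)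

lemma integrable_L1_loc:
  fixes h :: "'a::euclidean_space \<Rightarrow> real"
  assumes "integrable (lebesgue_on \<Omega>) h" "open \<Omega>"
  shows "h \<in> L1_loc \<Omega>"
proof -
  have "integrable (lebesgue_on K) h" if "compact K" "K \<subseteq> \<Omega>" for K
  proof (rule integrable_lebesgue_on_subset[OF assms(1) _ that(2)])
    show "\<Omega> \<in> sets lebesgue" using assms(2) by simp
    show "K \<in> sets lebesgue" using that(1) lmeasurable_compact by blast
  qed
  then show ?thesis by (simp add: L1_loc_def)
qed

text \<open>Apply the chain rule with \<open>F(t) = \<epsilon> arctan((t - c)/\<epsilon>)\<close>, up to a constant. As \<open>\<epsilon>\<close> tends to 0 the functions \<open>F(v)\<close>
  tend to 0 uniformly, whereas the factors \<open>F'(v)\<close> tend boundedly to the indicator of \<open>{v = c}\<close>. Hence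
  \<open>g\<close> times this indicator is the weak derivative of 0.\<close>

lemma L1_deriv_limit_level_set:
  assumes \<Omega>: "open \<Omega>" and e: "e \<in> Basis" and D: "L1_deriv_limit \<Omega> e v g"
  shows "AE x in lebesgue_on \<Omega>. v x = c \<longrightarrow> g x = 0"
proof -
  let ?M = "lebesgue_on \<Omega>"
  have \<Omega>b: "\<Omega> \<in> sets borel" using \<Omega> by simp
  have i[simp]: "integrable ?M v" "integrable ?M g" using D by (auto simp: L1_deriv_limit_def)
  note [measurable] = borel_measurable_integrable[OF i(1)] borel_measurable_integrable[OF i(2)]
  define \<epsilon> where "\<epsilon> m = inverse (real (Suc m))" for m
  have \<epsilon>: "\<epsilon> m > 0" for m by (auto simp: \<epsilon>_def)
  have \<epsilon>0: "\<epsilon> \<longlonglongrightarrow> 0" unfolding \<epsilon>_def by (rule LIMSEQ_inverse_real_of_nat)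
  define F where "F m t = \<epsilon> m * (arctan ((t - c) / \<epsilon> m) + arctan (c / \<epsilon> m))" for m t
  define F' where "F' m t = 1 / (1 + ((t - c) / \<epsilon> m)\<^sup>2)" for m t
  have F: "(F m has_real_derivative F' m t) (at t)" for m t
  proof -
    have "((\<lambda>t. \<epsilon> m * (arctan ((t - c) / \<epsilon> m) + arctan (c / \<epsilon> m))) has_real_derivative
        \<epsilon> m * (inverse (1 + ((t - c) / \<epsilon> m)\<^sup>2) * (1 / \<epsilon> m))) (at t)"
      by (auto intro!: derivative_eq_intros)
    then show ?thesis using \<epsilon>[of m] by (simp add: F_def[abs_def] F'_def inverse_eq_divide)
  qed
  have pos: "1 + ((t - c) / \<epsilon> m)\<^sup>2 \<noteq> 0" for t m
    by (metis add_pos_nonneg less_irrefl zero_le_power2 zero_less_one)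
  have F'c: "continuous_on UNIV (F' m)" for m
    unfolding F'_def using \<epsilon>[of m] pos[of _ m] by (intro continuous_intros) auto
  have F'b: "\<bar>F' m t\<bar> \<le> 1" for m t
  proof -
    have "1 + ((t - c) / \<epsilon> m)\<^sup>2 \<ge> 1" by simp
    then show ?thesis unfolding F'_def by (simp only: abs_divide abs_one divide_le_eq_1) linarith
  qed
  have F0: "F m 0 = 0" for m by (simp add: F_def arctan_minus)
  have Fb: "\<bar>F m t\<bar> \<le> \<epsilon> m * pi" for m t
  proof -
    have "\<bar>arctan ((t - c) / \<epsilon> m) + arctan (c / \<epsilon> m)\<bar> \<le> pi"
      using arctan_lbound[of "(t - c) / \<epsilon> m"] arctan_ubound[of "(t - c) / \<epsilon> m"]
        arctan_lbound[of "c / \<epsilon> m"] arctan_ubound[of "c / \<epsilon> m"] by linarith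
    then show ?thesis using \<epsilon>[of m] by (simp add: F_def abs_mult)
  qed
  have [measurable]: "F' m \<in> borel_measurable borel" "F m \<in> borel_measurable borel" for m
    using F'c[of m] F by (auto intro!: borel_measurable_continuous_onI continuous_at_imp_continuous_on DERIV_isCont)
  define h where "h x = indicator {c} (v x) * g x" for x
  have hm[measurable]: "h \<in> borel_measurable ?M" unfolding h_def by measurable
  have hi: "integrable ?M h"
    by (rule Bochner_Integration.integrable_bound[OF i(2) hm]) (auto simp: h_def indicator_def)
  have "(\<integral>x. h x * \<psi> x \<partial>?M) = 0" if "\<psi> \<in> test_functions \<Omega>" for \<psi>
  proof -
    have \<psi>: "\<psi> \<in> C1c \<Omega>" using that test_functions_C1c by auto
    note [measurable] = C1c_measurable_on(1)[OF \<psi>] C1c_measurable_on(2)[OF \<psi> e]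
    obtain B where B: "B \<ge> 0" "\<And>x. \<bar>\<psi> x\<bar> \<le> B" "\<And>x. \<bar>pdiff e \<psi> x\<bar> \<le> B"
      by (rule C1c_bounded[OF \<psi> e]) metis
    have "(\<lambda>m. \<integral>x. F m (v x) * pdiff e \<psi> x \<partial>?M) \<longlonglongrightarrow> (\<integral>x. 0 \<partial>?M)"
    proof (rule integral_dominated_convergence[where w = "\<lambda>x. pi * \<bar>pdiff e \<psi> x\<bar>"])
      show "integrable ?M (\<lambda>x. pi * \<bar>pdiff e \<psi> x\<bar>)" using C1c_integrable_on[OF \<psi> \<Omega>b] e by auto
      show "AE x in ?M. norm (F m (v x) * pdiff e \<psi> x) \<le> pi * \<bar>pdiff e \<psi> x\<bar>" for m
      proof (intro AE_I2)
        fix x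
        have "\<epsilon> m \<le> 1" by (simp add: \<epsilon>_def field_simps)
        then have "\<epsilon> m * pi \<le> pi" by simp
        then have "\<bar>F m (v x)\<bar> \<le> pi" using Fb[of m "v x"] by linarith
        then show "norm (F m (v x) * pdiff e \<psi> x) \<le> pi * \<bar>pdiff e \<psi> x\<bar>"
          by (simp add: abs_mult mult_right_mono)
      qed
      show "AE x in ?M. (\<lambda>m. F m (v x) * pdiff e \<psi> x) \<longlonglongrightarrow> 0"
      proof (intro AE_I2)
        fix x
        have "(\<lambda>m. \<epsilon> m * pi) \<longlonglongrightarrow> 0" using tendsto_mult_right[OF \<epsilon>0, of pi] by simp
        then have "(\<lambda>m. F m (v x)) \<longlonglongrightarrow> 0"
          by (rule Lim_null_comparison[OF always_eventually, rotated]) (use Fb in auto)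
        then show "(\<lambda>m. F m (v x) * pdiff e \<psi> x) \<longlonglongrightarrow> 0" using tendsto_mult_right by fastforce
      qed
    qed measurable
    moreover have "(\<lambda>m. - (\<integral>x. F' m (v x) * g x * \<psi> x \<partial>?M)) \<longlonglongrightarrow> - (\<integral>x. h x * \<psi> x \<partial>?M)"
    proof (rule tendsto_minus, rule integral_dominated_convergence[where w = "\<lambda>x. B * \<bar>g x\<bar>"])
      show "AE x in ?M. norm (F' m (v x) * g x * \<psi> x) \<le> B * \<bar>g x\<bar>" for m
      proof (intro AE_I2)
        fix x
        have "\<bar>F' m (v x)\<bar> * (\<bar>\<psi> x\<bar> * \<bar>g x\<bar>) \<le> 1 * (B * \<bar>g x\<bar>)"
          using B(1) B(2)[of x] F'b by (intro mult_mono) (auto simp: mult_right_mono)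
        then show "norm (F' m (v x) * g x * \<psi> x) \<le> B * \<bar>g x\<bar>" by (simp add: abs_mult mult_ac)
      qed
      show "AE x in ?M. (\<lambda>m. F' m (v x) * g x * \<psi> x) \<longlonglongrightarrow> h x * \<psi> x"
      proof (intro AE_I2 tendsto_mult tendsto_const)
        fix x
        have "(\<lambda>m. F' m (v x)) \<longlonglongrightarrow> indicator {c} (v x)"
        proof (cases "v x = c")
          case True
          then show ?thesis by (simp add: F'_def)
        next
          case False
          have "(\<lambda>m. (\<epsilon> m)\<^sup>2 / ((\<epsilon> m)\<^sup>2 + (v x - c)\<^sup>2)) \<longlonglongrightarrow> 0\<^sup>2 / (0\<^sup>2 + (v x - c)\<^sup>2)"
            using False by (intro tendsto_intros \<epsilon>0) auto
          moreover have "F' m (v x) = (\<epsilon> m)\<^sup>2 / ((\<epsilon> m)\<^sup>2 + (v x - c)\<^sup>2)" for m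
            using \<epsilon>[of m] by (simp add: F'_def power_divide field_simps)
          ultimately show ?thesis using False by simp
        qed
        then show "(\<lambda>m. F' m (v x) * g x) \<longlonglongrightarrow> h x" unfolding h_def by (intro tendsto_mult tendsto_const)
      qed
    qed (use i in auto)
    moreover have "(\<integral>x. F m (v x) * pdiff e \<psi> x \<partial>?M) = - (\<integral>x. F' m (v x) * g x * \<psi> x \<partial>?M)" for m
      by (rule L1_deriv_limit_weak[OF \<Omega>b e L1_deriv_limit_chain[OF \<Omega>b e D F F'c F'b F0] \<psi>])
    ultimately show ?thesis using LIMSEQ_unique by fastforce
  qed
  then have "AE x in ?M. h x = 0"
    using integrable_L1_loc[OF hi \<Omega>] by (intro fundamental_lemma_AE[OF \<Omega>]) auto
  then show ?thesis by eventually_elim (auto simp: h_def)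
qed

section \<open>The Gagliardo inequality\<close>

text \<open>The fundamental theorem of calculus on a segment of the line that starts outside the support.\<close>

lemma C1c_le_line_integral:
  assumes w: "w \<in> C1c \<Omega>" and b: "b \<in> Basis"
  shows "ennreal \<bar>w (z + t *\<^sub>R b)\<bar> \<le> (\<integral>\<^sup>+s. ennreal \<bar>pdiff b w (z + s *\<^sub>R b)\<bar> \<partial>lborel)"
proof -
  have "compact (closure {x. w x \<noteq> 0})" using w by (simp add: C1c_def)
  then obtain R where R: "\<And>x. x \<in> closure {x. w x \<noteq> 0} \<Longrightarrow> norm x \<le> R"
    using compact_imp_bounded bounded_iff by metis
  \<comment> \<open>A point on the line beyond the support.\<close>
  define a where "a = min t (- (\<bar>R\<bar> + norm z + 1))"
  have at: "a \<le> t" by (simp add: a_def)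
  have "norm (z + a *\<^sub>R b) \<ge> norm (a *\<^sub>R b) - norm z"
    by (metis add.commute norm_diff_ineq)
  moreover have "norm (a *\<^sub>R b) \<ge> \<bar>R\<bar> + norm z + 1" using b by (auto simp: a_def)
  ultimately have "norm (z + a *\<^sub>R b) > R" by linarith
  then have wa: "w (z + a *\<^sub>R b) = 0"
    using R[of "z + a *\<^sub>R b"] C1c_zero_outside(1)[OF w, of "z + a *\<^sub>R b"] by linarith
  have cont: "continuous_on UNIV (\<lambda>s. pdiff b w (z + s *\<^sub>R b))"
    by (intro continuous_on_compose2[OF C1c_continuous(2)[OF w b]] continuous_intros) auto
  have eq: "(\<integral>s. pdiff b w (z + s *\<^sub>R b) * indicator {a..t} s \<partial>lborel) = w (z + t *\<^sub>R b) - w (z + a *\<^sub>R b)"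
    using cont C1c_deriv_line[OF w, of z b] at
    by (intro integral_FTC_Icc_real) (auto simp: continuous_on_eq_continuous_at)
  have int: "integrable lborel (\<lambda>s. indicator {a..t} s *\<^sub>R pdiff b w (z + s *\<^sub>R b))"
    by (intro borel_integrable_compact continuous_on_subset[OF cont]) auto
  have "ennreal \<bar>w (z + t *\<^sub>R b)\<bar> = ennreal (norm (\<integral>s. indicator {a..t} s *\<^sub>R pdiff b w (z + s *\<^sub>R b) \<partial>lborel))"
    using eq wa by (simp add: mult.commute)
  also have "\<dots> \<le> (\<integral>\<^sup>+s. ennreal (norm (indicator {a..t} s *\<^sub>R pdiff b w (z + s *\<^sub>R b))) \<partial>lborel)"
    by (rule integral_norm_bound_ennreal[OF int])
  also have "\<dots> \<le> (\<integral>\<^sup>+s. ennreal \<bar>pdiff b w (z + s *\<^sub>R b)\<bar> \<partial>lborel)"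
    by (intro nn_integral_mono ennreal_leI) (auto simp: indicator_def)
  finally show ?thesis .
qed

lemma ennreal_power_le_imp_le:
  assumes "a ^ n \<le> ennreal r ^ n" "r \<ge> 0" "n > 0"
  shows "a \<le> ennreal r"
proof (cases a)
  case (real x)
  then show ?thesis using assms by (simp add: ennreal_power ennreal_leI)
next
  case top
  then show ?thesis using assms by (simp add: ennreal_power top_unique)
qed

text \<open>Each factor \<open>|w\<^sub>b|\<close> is at most the integral of \<open>|\<partial>\<^sub>bw\<^sub>b|\<close> over the line in the direction \<open>b\<close>, a function that
  does not depend on the coordinate \<open>b\<close>. This is the situation of the Loomis-Whitney inequality.\<close>

lemma gagliardo_C1c:
  fixes w :: "'a::euclidean_space \<Rightarrow> 'a \<Rightarrow> real" and G :: "'a \<Rightarrow> ennreal"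
  assumes dim: "DIM('a) \<ge> 2" and w: "\<And>b. b \<in> Basis \<Longrightarrow> w b \<in> C1c (\<Omega> b)"
    and G[measurable]: "G \<in> borel_measurable borel"
    and le: "\<And>x. G x ^ (DIM('a) - 1) \<le> (\<Prod>b\<in>Basis. ennreal \<bar>w b x\<bar>)"
  shows "(\<integral>\<^sup>+x. G x \<partial>lborel) ^ (DIM('a) - 1) \<le> (\<Prod>b\<in>Basis. \<integral>\<^sup>+x. ennreal \<bar>pdiff b (w b) x\<bar> \<partial>lborel)"
proof -
  interpret product_sigma_finite "\<lambda>_::'a. lborel :: real measure" by standard
  let ?P = "\<Pi>\<^sub>M b\<in>(Basis::'a set). lborel :: real measure"
  define \<phi> where "\<phi> f = (\<Sum>b\<in>Basis. f b *\<^sub>R b)" for f :: "'a \<Rightarrow> real"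
  have \<phi>[measurable]: "\<phi> \<in> measurable ?P borel" unfolding \<phi>_def by measurable
  have lb: "(lborel :: 'a measure) = distr ?P borel \<phi>"
    unfolding \<phi>_def by (rule lborel_eq)
  have nn: "(\<integral>\<^sup>+x. H x \<partial>lborel) = (\<integral>\<^sup>+y. H (\<phi> y) \<partial>?P)" if "H \<in> borel_measurable borel" for H :: "'a \<Rightarrow> ennreal"
    using that by (subst lb) (simp add: nn_integral_distr)
  have upd: "\<phi> (y(b := s)) = \<phi> (y(b := 0)) + s *\<^sub>R b" if "b \<in> Basis" for y b s
  proof -
    have "\<phi> (y(b := s)) = s *\<^sub>R b + (\<Sum>c\<in>Basis-{b}. y c *\<^sub>R c)" for s
      unfolding \<phi>_def using that by (subst sum.remove[of _ b]) (auto intro!: sum.cong)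
    from this[of s] this[of 0] show ?thesis by simp
  qed
  have "(\<integral>\<^sup>+y. G (\<phi> y) \<partial>?P) ^ (DIM('a) - 1) \<le> (\<Prod>b\<in>Basis. \<integral>\<^sup>+y. ennreal \<bar>pdiff b (w b) (\<phi> y)\<bar> \<partial>?P)"
  proof (rule loomis_whitney_nn)
    fix y :: "'a \<Rightarrow> real"
    have "G (\<phi> y) ^ (DIM('a) - 1) \<le> (\<Prod>b\<in>Basis. ennreal \<bar>w b (\<phi> y)\<bar>)" by (rule le)
    also have "\<dots> \<le> (\<Prod>b\<in>Basis. \<integral>\<^sup>+s. ennreal \<bar>pdiff b (w b) (\<phi> (y(b := s)))\<bar> \<partial>lborel)"
    proof (rule prod_mono_ennreal)
      fix b :: 'a assume b: "b \<in> Basis"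
      define z where "z = \<phi> (y(b := 0))"
      have upd': "\<phi> (y(b := s)) = z + s *\<^sub>R b" for s
        unfolding z_def by (rule upd[OF b])
      have "\<phi> y = z + y b *\<^sub>R b" using upd'[of "y b"] by simp
      then show "ennreal \<bar>w b (\<phi> y)\<bar> \<le> (\<integral>\<^sup>+s. ennreal \<bar>pdiff b (w b) (\<phi> (y(b := s)))\<bar> \<partial>lborel)"
        using C1c_le_line_integral[OF w[OF b] b, of z "y b"] by (simp add: upd')
    qed
    finally show "G (\<phi> y) ^ (DIM('a) - 1) \<le> (\<Prod>b\<in>Basis. if b \<in> Basis
        then \<integral>\<^sup>+s. ennreal \<bar>pdiff b (w b) (\<phi> (y(b := s)))\<bar> \<partial>lborel else ennreal \<bar>pdiff b (w b) (\<phi> y)\<bar>)"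
      by simp
  next
    fix b :: 'a assume b: "b \<in> Basis"
    note [measurable] = C1c_measurable(2)[OF w[OF b] b]
    show "(\<lambda>y. ennreal \<bar>pdiff b (w b) (\<phi> y)\<bar>) \<in> borel_measurable ?P" by measurable
  qed (use dim in auto)
  also have "(\<Prod>b\<in>Basis. \<integral>\<^sup>+y. ennreal \<bar>pdiff b (w b) (\<phi> y)\<bar> \<partial>?P)
      = (\<Prod>b\<in>Basis. \<integral>\<^sup>+x. ennreal \<bar>pdiff b (w b) x\<bar> \<partial>lborel)"
    using C1c_measurable(2)[OF w] by (intro prod.cong refl nn[symmetric]) auto
  finally show ?thesis by (simp add: nn)
qed

lemma nn_integral_lebesgue_on_lborel:
  fixes f :: "'a::euclidean_space \<Rightarrow> ennreal"
  assumes "\<Omega> \<in> sets borel" "f \<in> borel_measurable borel" "\<And>x. x \<notin> \<Omega> \<Longrightarrow> f x = 0"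
  shows "(\<integral>\<^sup>+x. f x \<partial>lebesgue_on \<Omega>) = (\<integral>\<^sup>+x. f x \<partial>lborel)"
proof -
  have "(\<lambda>x. f x * indicator \<Omega> x) = f" using assms(3) by (auto simp: indicator_def fun_eq_iff)
  then show ?thesis
    using assms by (subst nn_integral_restrict_space) (auto simp: nn_integral_completion)
qed

text \<open>The right-hand side only contains integrals of first powers of the derivatives and is continuous with respect to
  convergence in \<open>L\<^sup>1\<close>; the left-hand side is lower semicontinuous by Fatou's lemma.\<close>

lemma gagliardo_L1_deriv_limit:
  fixes v g :: "'a::euclidean_space \<Rightarrow> 'a \<Rightarrow> real" and G :: "'a \<Rightarrow> real"
  assumes dim: "DIM('a) \<ge> 2" and \<Omega>: "\<Omega> \<in> sets borel"
    and D: "\<And>b. b \<in> Basis \<Longrightarrow> L1_deriv_limit \<Omega> b (v b) (g b)"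
    and le: "AE x in lebesgue_on \<Omega>. 0 \<le> G x \<and> G x ^ (DIM('a) - 1) \<le> (\<Prod>b\<in>Basis. \<bar>v b x\<bar>)"
  shows "(\<integral>\<^sup>+x. ennreal (G x) \<partial>lebesgue_on \<Omega>)
    \<le> ennreal (root (DIM('a) - 1) (\<Prod>b\<in>Basis. \<integral>x. \<bar>g b x\<bar> \<partial>lebesgue_on \<Omega>))"
proof -
  let ?M = "lebesgue_on \<Omega>"
  define N where "N = DIM('a) - 1"
  have N: "N > 0" using dim by (simp add: N_def)
  have "\<forall>b\<in>Basis. \<exists>w. (\<forall>j::nat. w j \<in> C1c \<Omega>) \<and>
    (\<lambda>j. \<integral>x. \<bar>pdiff b (w j) x - g b x\<bar> \<partial>?M) \<longlonglongrightarrow> 0 \<and>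
    (AE x in ?M. (\<lambda>j. w j x) \<longlonglongrightarrow> v b x)"
  proof
    fix b :: 'a assume b: "b \<in> Basis"
    show "\<exists>w. (\<forall>j::nat. w j \<in> C1c \<Omega>) \<and>
      (\<lambda>j. \<integral>x. \<bar>pdiff b (w j) x - g b x\<bar> \<partial>?M) \<longlonglongrightarrow> 0 \<and>
      (AE x in ?M. (\<lambda>j. w j x) \<longlonglongrightarrow> v b x)"
      by (rule L1_deriv_limit_AE[OF D[OF b] \<Omega>]) blast
  qed
  then obtain w where w: "\<And>b j. b \<in> Basis \<Longrightarrow> w b (j::nat) \<in> C1c \<Omega>"
    "\<And>b. b \<in> Basis \<Longrightarrow> (\<lambda>j. \<integral>x. \<bar>pdiff b (w b j) x - g b x\<bar> \<partial>?M) \<longlonglongrightarrow> 0"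
    "\<And>b. b \<in> Basis \<Longrightarrow> AE x in ?M. (\<lambda>j. w b j x) \<longlonglongrightarrow> v b x"
    by - (drule bchoice, atomize_elim, blast)
  have gi: "integrable ?M (g b)" if "b \<in> Basis" for b using D[OF that] by (simp add: L1_deriv_limit_def)
  have wi: "integrable ?M (pdiff b (w b j))" if "b \<in> Basis" for b j
    using C1c_integrable_on(2)[OF w(1)[OF that] \<Omega> that] .
  define H where "H j x = root N (\<Prod>b\<in>Basis. \<bar>w b j x\<bar>)" for j x
  have H0: "H j x \<ge> 0" for j x by (simp add: H_def prod_nonneg real_root_ge_zero)
  have wm[measurable]: "b \<in> Basis \<Longrightarrow> w b j \<in> borel_measurable borel" for b j
    using C1c_measurable(1)[OF w(1)] .
  have Hm[measurable]: "H j \<in> borel_measurable borel" for j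
    unfolding H_def by measurable
  define r where "r b j = (\<integral>x. \<bar>pdiff b (w b j) x\<bar> \<partial>?M)" for b j
  have rlim: "(\<lambda>j. r b j) \<longlonglongrightarrow> (\<integral>x. \<bar>g b x\<bar> \<partial>?M)" if b: "b \<in> Basis" for b
  proof -
    have "norm (r b j - (\<integral>x. \<bar>g b x\<bar> \<partial>?M)) \<le> (\<integral>x. \<bar>pdiff b (w b j) x - g b x\<bar> \<partial>?M)" for j
    proof -
      have "r b j - (\<integral>x. \<bar>g b x\<bar> \<partial>?M) = (\<integral>x. \<bar>pdiff b (w b j) x\<bar> - \<bar>g b x\<bar> \<partial>?M)"
        unfolding r_def using wi[OF b, of j] gi[OF b] by simp
      also have "norm \<dots> \<le> (\<integral>x. norm (\<bar>pdiff b (w b j) x\<bar> - \<bar>g b x\<bar>) \<partial>?M)" by (rule integral_norm_bound)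
      also have "\<dots> \<le> (\<integral>x. \<bar>pdiff b (w b j) x - g b x\<bar> \<partial>?M)"
        using wi[OF b, of j] gi[OF b] by (intro integral_mono) auto
      finally show ?thesis .
    qed
    then have "(\<lambda>j. r b j - (\<integral>x. \<bar>g b x\<bar> \<partial>?M)) \<longlonglongrightarrow> 0"
      by (rule Lim_null_comparison[OF always_eventually[OF allI] w(2)[OF b]])
    then show ?thesis by (simp add: LIM_zero_iff)
  qed
  have bound: "(\<integral>\<^sup>+x. ennreal (H j x) \<partial>?M) \<le> ennreal (root N (\<Prod>b\<in>Basis. r b j))" for j
  proof -
    have "(\<integral>\<^sup>+x. ennreal (H j x) \<partial>lborel) ^ N \<le> (\<Prod>b\<in>Basis. \<integral>\<^sup>+x. ennreal \<bar>pdiff b (w b j) x\<bar> \<partial>lborel)"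
      unfolding N_def
    proof (rule gagliardo_C1c[OF dim w(1)])
      show "ennreal (H j x) ^ (DIM('a) - 1) \<le> (\<Prod>b\<in>Basis. ennreal \<bar>w b j x\<bar>)" for x
        unfolding N_def[symmetric] using N H0[of j x]
        by (simp add: ennreal_power H_def prod_ennreal prod_nonneg)
    qed auto
    also have "(\<Prod>b\<in>Basis. \<integral>\<^sup>+x. ennreal \<bar>pdiff b (w b j) x\<bar> \<partial>lborel) = (\<Prod>b\<in>Basis. ennreal (r b j))"
    proof (rule prod.cong[OF refl])
      fix b :: 'a assume b: "b \<in> Basis"
      note [measurable] = C1c_measurable(2)[OF w(1)[OF b] b]
      have "(\<integral>\<^sup>+x. ennreal \<bar>pdiff b (w b j) x\<bar> \<partial>lborel) = (\<integral>\<^sup>+x. ennreal \<bar>pdiff b (w b j) x\<bar> \<partial>?M)"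
        using \<Omega> C1c_zero_outside_domain(2)[OF w(1)[OF b]] by (intro nn_integral_lebesgue_on_lborel[symmetric]) auto
      also have "\<dots> = ennreal (r b j)"
        unfolding r_def using wi[OF b, of j] by (intro nn_integral_eq_integral) auto
      finally show "(\<integral>\<^sup>+x. ennreal \<bar>pdiff b (w b j) x\<bar> \<partial>lborel) = ennreal (r b j)" .
    qed
    also have "\<dots> = ennreal (\<Prod>b\<in>Basis. r b j)" by (rule prod_ennreal) (simp add: r_def)
    also have "\<dots> = ennreal (root N (\<Prod>b\<in>Basis. r b j)) ^ N"
      using N by (simp add: ennreal_power prod_nonneg r_def)
    finally have "(\<integral>\<^sup>+x. ennreal (H j x) \<partial>lborel) \<le> ennreal (root N (\<Prod>b\<in>Basis. r b j))"
      by (rule ennreal_power_le_imp_le) (use N in \<open>auto intro!: real_root_ge_zero prod_nonneg simp: r_def\<close>)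
    moreover have "(\<integral>\<^sup>+x. ennreal (H j x) \<partial>lborel) = (\<integral>\<^sup>+x. ennreal (H j x) \<partial>?M)"
    proof (rule nn_integral_lebesgue_on_lborel[OF \<Omega>, symmetric])
      fix x assume "x \<notin> \<Omega>"
      then have "(\<Prod>b\<in>Basis. \<bar>w b j x\<bar>) = 0"
        using C1c_zero_outside_domain(1)[OF w(1)[OF SOME_Basis]]
        by (intro prod_zero) (auto intro: SOME_Basis)
      then show "ennreal (H j x) = 0" by (simp only: H_def real_root_zero ennreal_0)
    qed simp
    ultimately show ?thesis by simp
  qed
  have "AE x in ?M. \<forall>b\<in>Basis. (\<lambda>j. w b j x) \<longlonglongrightarrow> v b x"
    using w(3) by (intro AE_finite_allI) auto
  with le have "AE x in ?M. ennreal (G x) \<le> liminf (\<lambda>j. ennreal (H j x))"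
  proof eventually_elim
    case (elim x)
    have "(\<lambda>j. H j x) \<longlonglongrightarrow> root N (\<Prod>b\<in>Basis. \<bar>v b x\<bar>)"
      unfolding H_def using elim(2) by (intro tendsto_real_root tendsto_prod tendsto_rabs) auto
    then have "(\<lambda>j. ennreal (H j x)) \<longlonglongrightarrow> ennreal (root N (\<Prod>b\<in>Basis. \<bar>v b x\<bar>))"
      by (rule tendsto_ennrealI)
    then have "liminf (\<lambda>j. ennreal (H j x)) = ennreal (root N (\<Prod>b\<in>Basis. \<bar>v b x\<bar>))"
      by (intro lim_imp_Liminf) auto
    moreover have "G x = root N (G x ^ N)" using elim(1) N by (simp add: real_root_power_cancel)
    ultimately show ?case using elim(1) N
      by (metis N_def ennreal_leI real_root_le_mono)
  qed
  then have "(\<integral>\<^sup>+x. ennreal (G x) \<partial>?M) \<le> (\<integral>\<^sup>+x. liminf (\<lambda>j. ennreal (H j x)) \<partial>?M)"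
    by (rule nn_integral_mono_AE)
  also have "\<dots> \<le> liminf (\<lambda>j. \<integral>\<^sup>+x. ennreal (H j x) \<partial>?M)"
  proof (rule nn_integral_liminf)
    have "H j \<in> borel_measurable ?M" for j
      by (intro measurable_restrict_space1 measurable_completion) simp
    then show "(\<lambda>x. ennreal (H j x)) \<in> borel_measurable ?M" for j by simp
  qed
  also have "\<dots> \<le> liminf (\<lambda>j. ennreal (root N (\<Prod>b\<in>Basis. r b j)))"
    by (intro Liminf_mono always_eventually allI bound)
  also have "\<dots> = ennreal (root N (\<Prod>b\<in>Basis. \<integral>x. \<bar>g b x\<bar> \<partial>?M))"
    by (intro lim_imp_Liminf tendsto_ennrealI tendsto_real_root tendsto_prod rlim) auto
  finally show ?thesis by (simp add: N_def)
qed


section \<open>The anisotropic Sobolev inequality\<close>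

text \<open>Hoelder's inequality with the exponents \<open>1/\<alpha>\<close> and \<open>1/\<beta>\<close>, by integrating Young's inequality for the normalised factors.\<close>

lemma integral_powr_mult_le:
  fixes X Y :: "'x \<Rightarrow> real"
  assumes "\<alpha> > 0" "\<beta> > 0" "\<alpha> + \<beta> = 1"
    and X: "integrable M X" "\<And>x. X x \<ge> 0" and Y: "integrable M Y" "\<And>x. Y x \<ge> 0"
  shows "integrable M (\<lambda>x. X x powr \<alpha> * Y x powr \<beta>)"
    "(\<integral>x. X x powr \<alpha> * Y x powr \<beta> \<partial>M) \<le> (\<integral>x. X x \<partial>M) powr \<alpha> * (\<integral>x. Y x \<partial>M) powr \<beta>"
proof -
  have young: "a powr \<alpha> * b powr \<beta> \<le> \<alpha> * a + \<beta> * b" if "a \<ge> 0" "b \<ge> 0" for a b :: real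
    using Youngs_inequality_0[of \<alpha> \<beta> a b] assms that by (cases "a = 0 \<or> b = 0") auto
  note [measurable] = borel_measurable_integrable[OF X(1)] borel_measurable_integrable[OF Y(1)]
  show int: "integrable M (\<lambda>x. X x powr \<alpha> * Y x powr \<beta>)"
  proof (rule Bochner_Integration.integrable_bound)
    show "integrable M (\<lambda>x. \<alpha> * X x + \<beta> * Y x)" using X Y by simp
    show "AE x in M. norm (X x powr \<alpha> * Y x powr \<beta>) \<le> norm (\<alpha> * X x + \<beta> * Y x)"
      using young[OF X(2) Y(2)] assms by (intro AE_I2) (auto intro: order_trans[OF _ abs_ge_self])
  qed measurable
  let ?A = "\<integral>x. X x \<partial>M" and ?B = "\<integral>x. Y x \<partial>M"
  show "(\<integral>x. X x powr \<alpha> * Y x powr \<beta> \<partial>M) \<le> ?A powr \<alpha> * ?B powr \<beta>"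
  proof (cases "?A = 0 \<or> ?B = 0")
    case True
    then have "AE x in M. X x = 0 \<or> Y x = 0"
    proof
      assume "?A = 0"
      then have "AE x in M. X x = 0" using X by (subst (asm) integral_nonneg_eq_0_iff_AE) auto
      then show ?thesis by eventually_elim simp
    next
      assume "?B = 0"
      then have "AE x in M. Y x = 0" using Y by (subst (asm) integral_nonneg_eq_0_iff_AE) auto
      then show ?thesis by eventually_elim simp
    qed
    then have "AE x in M. X x powr \<alpha> * Y x powr \<beta> = 0" by eventually_elim auto
    then have "(\<integral>x. X x powr \<alpha> * Y x powr \<beta> \<partial>M) = (\<integral>x. 0 \<partial>M)"
      by (intro integral_cong_AE) auto
    then show ?thesis by simp
  next
    case False
    have "?A \<ge> 0" "?B \<ge> 0" using X Y by (auto intro: integral_nonneg)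
    then have pos: "?A > 0" "?B > 0" using False by auto
    have "(\<integral>x. X x powr \<alpha> * Y x powr \<beta> \<partial>M)
        \<le> (\<integral>x. ?A powr \<alpha> * ?B powr \<beta> * (\<alpha> * (X x / ?A) + \<beta> * (Y x / ?B)) \<partial>M)"
    proof (rule integral_mono[OF int])
      show "integrable M (\<lambda>x. ?A powr \<alpha> * ?B powr \<beta> * (\<alpha> * (X x / ?A) + \<beta> * (Y x / ?B)))" using X Y by simp
      fix x
      have "X x powr \<alpha> * Y x powr \<beta> = ?A powr \<alpha> * ?B powr \<beta> * ((X x / ?A) powr \<alpha> * (Y x / ?B) powr \<beta>)"
        using pos X(2) Y(2) by (simp add: powr_divide)
      also have "\<dots> \<le> ?A powr \<alpha> * ?B powr \<beta> * (\<alpha> * (X x / ?A) + \<beta> * (Y x / ?B))"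
        using pos X(2)[of x] Y(2)[of x] by (intro mult_left_mono young) auto
      finally show "X x powr \<alpha> * Y x powr \<beta> \<le> ?A powr \<alpha> * ?B powr \<beta> * (\<alpha> * (X x / ?A) + \<beta> * (Y x / ?B))" .
    qed
    also have "\<dots> = ?A powr \<alpha> * ?B powr \<beta> * (\<alpha> * (?A / ?A) + \<beta> * (?B / ?B))"
      using X Y by simp
    also have "\<dots> = ?A powr \<alpha> * ?B powr \<beta>" using pos assms(3) by simp
    finally show ?thesis .
  qed
qed

text \<open>The signed power \<open>sgn t * |t| powr \<gamma>\<close> has an unbounded derivative. For functions bounded by \<open>k\<close>
  it may be continued linearly outside \<open>[-k, k]\<close>, after which the chain rule applies.\<close>

lemma signed_power_antiderivative:
  fixes \<gamma> k :: real
  assumes \<gamma>: "\<gamma> > 1" and k: "k > 0"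
  obtains F F' L where "\<And>t. (F has_real_derivative F' t) (at t)" "continuous_on UNIV F'"
    "\<And>t. \<bar>F' t\<bar> \<le> L" "F 0 = 0" "\<And>t. \<bar>t\<bar> \<le> k \<Longrightarrow> \<bar>F t\<bar> = \<bar>t\<bar> powr \<gamma>"
    "\<And>t. \<bar>t\<bar> \<le> k \<Longrightarrow> F' t = \<gamma> * \<bar>t\<bar> powr (\<gamma> - 1)"
proof -
  define h where "h t = \<gamma> * min \<bar>t\<bar> k powr (\<gamma> - 1)" for t
  have hc: "continuous_on UNIV h"
    unfolding h_def using \<gamma> k by (intro continuous_intros continuous_on_powr') auto
  obtain F0 where F0: "\<And>x. (F0 has_vector_derivative h x) (at x)"
    using einterval_antiderivative[of "-\<infinity>" "\<infinity>" h] hc by (auto simp: continuous_on_eq_continuous_at)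
  define F where "F t = F0 t - F0 0" for t
  have F: "(F has_real_derivative h t) (at t)" for t
    unfolding F_def using F0[of t] by (auto intro!: derivative_eq_intros simp: has_real_derivative_iff_has_vector_derivative)
  \<comment> \<open>Stated for every antiderivative of \<open>h\<close>: as \<open>h\<close> is even, \<open>- F (- t)\<close> is another one, which settles
    negative arguments.\<close>
  have val: "f t = t powr \<gamma>" if f: "\<And>t. (f has_real_derivative h t) (at t)" "f 0 = 0" and t: "0 \<le> t" "t \<le> k" for f t
  proof (cases "t = 0")
    case True then show ?thesis using f(2) by simp
  next
    case False
    have "(\<lambda>x. f x - x powr \<gamma>) t = (\<lambda>x. f x - x powr \<gamma>) 0"
    proof (rule DERIV_isconst_end[where f = "\<lambda>x. f x - x powr \<gamma>" and a = 0 and b = t])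
      show "0 < t" using t False by simp
      show "continuous_on {0..t} (\<lambda>x. f x - x powr \<gamma>)"
        using f(1) \<gamma> by (intro continuous_intros continuous_on_powr' continuous_at_imp_continuous_on) (auto intro: DERIV_isCont)
      fix x assume x: "0 < x" "x < t"
      have "((\<lambda>x. f x - x powr \<gamma>) has_real_derivative h x - \<gamma> * x powr (\<gamma> - 1)) (at x)"
        using x by (intro DERIV_diff f(1) has_real_derivative_powr)
      then show "((\<lambda>x. f x - x powr \<gamma>) has_real_derivative 0) (at x)"
        using x t by (simp add: h_def)
    qed
    then show ?thesis using f(2) by simp
  qed
  show ?thesis
  proof (rule that[of F h "\<gamma> * k powr (\<gamma> - 1)"])
    show "\<bar>h t\<bar> \<le> \<gamma> * k powr (\<gamma> - 1)" for t
      using \<gamma> k by (auto simp: h_def abs_mult intro!: powr_mono2)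
    show "\<bar>F t\<bar> = \<bar>t\<bar> powr \<gamma>" if "\<bar>t\<bar> \<le> k" for t
    proof (cases "t \<ge> 0")
      case True
      then show ?thesis using val[of F t] F that by (simp add: F_def)
    next
      case False
      have "((\<lambda>t. - F (- t)) has_real_derivative h t) (at t)" for t
      proof -
        have "((\<lambda>t. F (- t)) has_real_derivative h (- t) * (-1)) (at t)"
          by (rule DERIV_chain2[OF F]) (auto intro!: derivative_eq_intros)
        then have "((\<lambda>t. - F (- t)) has_real_derivative - (h (- t) * (-1))) (at t)"
          by (rule DERIV_minus)
        then show ?thesis by (simp add: h_def)
      qed
      then have "- F (- (- t)) = (- t) powr \<gamma>"
        using val[of "\<lambda>t. - F (- t)" "- t"] False that by (simp add: F_def)
      then have "F t = - ((- t) powr \<gamma>)" by simp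
      then show ?thesis using False by simp
    qed
    show "h t = \<gamma> * \<bar>t\<bar> powr (\<gamma> - 1)" if "\<bar>t\<bar> \<le> k" for t using that by (simp add: h_def)
  qed (use F hc in \<open>auto simp: F_def\<close>)
qed

text \<open>Troisi's inequality for bounded functions, with the same bound \<open>E\<close> for all energies. The Gagliardo inequality for
  the signed powers of \<open>v\<close> with exponents \<open>\<gamma>\<^sub>b = 1 + s - s/p\<^sub>b\<close> and Hoelder's inequality yield, for \<open>A = \<integral>|v| powr s\<close>,
  \<open>A powr (n - 1) \<le> (\<Prod>\<gamma>\<^sub>b) * A powr (n - S) * E powr S\<close>. As \<open>A\<close> is finite, it can be divided out unless it is 0. The sum of the \<open>\<gamma>\<^sub>b\<close> equals \<open>s(n - 1)\<close> because
  \<open>s(S - 1) = n\<close>.\<close>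

lemma anisotropic_sobolev:
  fixes p :: "'a::euclidean_space \<Rightarrow> real" and g :: "'a \<Rightarrow> 'a \<Rightarrow> real"
  assumes dim: "DIM('a) \<ge> 2" and \<Omega>: "\<Omega> \<in> sets borel" and fin: "finite_measure (lebesgue_on \<Omega>)"
    and p: "\<And>b. b \<in> Basis \<Longrightarrow> 1 < p b"
    and S: "S = (\<Sum>b\<in>Basis. 1 / p b)" "S > 1" and s: "s = real DIM('a) / (S - 1)"
    and D: "\<And>b. b \<in> Basis \<Longrightarrow> L1_deriv_limit \<Omega> b v (g b)"
    and k: "k > 0" "\<And>x. \<bar>v x\<bar> \<le> k"
    and int: "\<And>b. b \<in> Basis \<Longrightarrow> integrable (lebesgue_on \<Omega>) (\<lambda>x. \<bar>g b x\<bar> powr p b)"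
    and E: "\<And>b. b \<in> Basis \<Longrightarrow> (\<integral>x. \<bar>g b x\<bar> powr p b \<partial>lebesgue_on \<Omega>) \<le> E"
  shows "integrable (lebesgue_on \<Omega>) (\<lambda>x. \<bar>v x\<bar> powr s)"
    "(\<integral>x. \<bar>v x\<bar> powr s \<partial>lebesgue_on \<Omega>) powr (S - 1) \<le> (\<Prod>b\<in>Basis. 1 + s - s / p b) * E powr S"
proof -
  let ?M = "lebesgue_on \<Omega>"
  define N where "N = DIM('a) - 1"
  have N: "N > 0" "real N = real DIM('a) - 1" using dim by (auto simp: N_def)
  have s0: "s > 0" using S dim by (simp add: s)
  define \<gamma> where "\<gamma> b = 1 + s - s / p b" for b
  have \<gamma>: "\<gamma> b > 1" if "b \<in> Basis" for b
    using p[OF that] s0 by (simp add: \<gamma>_def divide_less_eq)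
  have vm[measurable]: "v \<in> borel_measurable ?M"
    using D[OF SOME_Basis] borel_measurable_integrable by (auto simp: L1_deriv_limit_def)
  show Gi: "integrable ?M (\<lambda>x. \<bar>v x\<bar> powr s)"
  proof (rule Bochner_Integration.integrable_bound)
    show "integrable ?M (\<lambda>x. k powr s)" using fin finite_measure.integrable_const by blast
    show "AE x in ?M. norm (\<bar>v x\<bar> powr s) \<le> norm (k powr s)"
      using k(2) s0 by (intro AE_I2) (auto intro: powr_mono2)
  qed measurable
  define A where "A = (\<integral>x. \<bar>v x\<bar> powr s \<partial>?M)"
  have A0: "A \<ge> 0" by (simp add: A_def)
  have "\<forall>b\<in>Basis. \<exists>vg. L1_deriv_limit \<Omega> b (fst vg) (snd vg) \<and> (\<forall>x. \<bar>fst vg x\<bar> = \<bar>v x\<bar> powr \<gamma> b)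
      \<and> (\<forall>x. snd vg x = \<gamma> b * \<bar>v x\<bar> powr (\<gamma> b - 1) * g b x)"
  proof
    fix b :: 'a assume b: "b \<in> Basis"
    obtain F F' L where F: "\<And>t. (F has_real_derivative F' t) (at t)" "continuous_on UNIV F'"
      "\<And>t. \<bar>F' t\<bar> \<le> L" "F 0 = 0" "\<And>t. \<bar>t\<bar> \<le> k \<Longrightarrow> \<bar>F t\<bar> = \<bar>t\<bar> powr \<gamma> b"
      "\<And>t. \<bar>t\<bar> \<le> k \<Longrightarrow> F' t = \<gamma> b * \<bar>t\<bar> powr (\<gamma> b - 1)"
      by (rule signed_power_antiderivative[OF \<gamma>[OF b] k(1)]) blast
    have "L1_deriv_limit \<Omega> b (\<lambda>x. F (v x)) (\<lambda>x. F' (v x) * g b x)"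
      by (rule L1_deriv_limit_chain[OF \<Omega> b D[OF b] F(1-4)])
    then show "\<exists>vg. L1_deriv_limit \<Omega> b (fst vg) (snd vg) \<and> (\<forall>x. \<bar>fst vg x\<bar> = \<bar>v x\<bar> powr \<gamma> b)
      \<and> (\<forall>x. snd vg x = \<gamma> b * \<bar>v x\<bar> powr (\<gamma> b - 1) * g b x)"
      using F(5,6) k(2) by (intro exI[of _ "(\<lambda>x. F (v x), \<lambda>x. F' (v x) * g b x)"]) auto
  qed
  then obtain vg where vg: "\<And>b. b \<in> Basis \<Longrightarrow> L1_deriv_limit \<Omega> b (fst (vg b)) (snd (vg b))"
    "\<And>b x. b \<in> Basis \<Longrightarrow> \<bar>fst (vg b) x\<bar> = \<bar>v x\<bar> powr \<gamma> b"
    "\<And>b x. b \<in> Basis \<Longrightarrow> snd (vg b) x = \<gamma> b * \<bar>v x\<bar> powr (\<gamma> b - 1) * g b x"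
    by - (drule bchoice, atomize_elim, blast)
  have sum\<gamma>: "(\<Sum>b\<in>Basis. \<gamma> b) = s * real N"
  proof -
    have "(\<Sum>b\<in>Basis. \<gamma> b) = real DIM('a) * (1 + s) - s * S"
      by (simp add: \<gamma>_def S(1) sum.distrib sum_subtractf sum_distrib_left algebra_simps)
    moreover have "s * (S - 1) = real DIM('a)" using S by (simp add: s)
    ultimately show ?thesis unfolding N(2) by (simp add: algebra_simps)
  qed
  have "(\<integral>\<^sup>+x. ennreal (\<bar>v x\<bar> powr s) \<partial>?M)
    \<le> ennreal (root N (\<Prod>b\<in>Basis. \<integral>x. \<bar>snd (vg b) x\<bar> \<partial>?M))"
    unfolding N_def
  proof (rule gagliardo_L1_deriv_limit[OF dim \<Omega> vg(1)])
    show "AE x in ?M. 0 \<le> \<bar>v x\<bar> powr s \<and> (\<bar>v x\<bar> powr s) ^ (DIM('a) - 1) \<le> (\<Prod>b\<in>Basis. \<bar>fst (vg b) x\<bar>)"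
    proof (intro AE_I2 conjI)
      fix x
      show "(\<bar>v x\<bar> powr s) ^ (DIM('a) - 1) \<le> (\<Prod>b\<in>Basis. \<bar>fst (vg b) x\<bar>)"
      proof (cases "v x = 0")
        case True
        then show ?thesis using N by (simp add: N_def[symmetric] zero_power prod_nonneg del: One_nat_def)
      next
        case False
        have "(\<Prod>b\<in>Basis. \<bar>fst (vg b) x\<bar>) = (\<Prod>b\<in>Basis. \<bar>v x\<bar> powr \<gamma> b)"
          by (intro prod.cong refl vg(2))
        also have "\<dots> = \<bar>v x\<bar> powr (s * real N)"
          using False by (simp add: powr_sum[symmetric] sum\<gamma>)
        also have "\<dots> = (\<bar>v x\<bar> powr s) ^ N"
          using False by (simp add: powr_powr[symmetric] powr_realpow)
        finally show ?thesis by (simp add: N_def)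
      qed
    qed auto
  qed
  moreover have "(\<integral>\<^sup>+x. ennreal (\<bar>v x\<bar> powr s) \<partial>?M) = ennreal A"
    unfolding A_def by (rule nn_integral_eq_integral[OF Gi]) auto
  ultimately have "A \<le> root N (\<Prod>b\<in>Basis. \<integral>x. \<bar>snd (vg b) x\<bar> \<partial>?M)"
    using N by (simp add: real_root_ge_zero prod_nonneg)
  then have "A ^ N \<le> root N (\<Prod>b\<in>Basis. \<integral>x. \<bar>snd (vg b) x\<bar> \<partial>?M) ^ N"
    using A0 by (rule power_mono)
  also have "\<dots> = (\<Prod>b\<in>Basis. \<integral>x. \<bar>snd (vg b) x\<bar> \<partial>?M)" using N by (simp add: prod_nonneg)
  also have "\<dots> \<le> (\<Prod>b\<in>Basis. \<gamma> b * (A powr (1 - 1 / p b) * E powr (1 / p b)))"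
  proof (rule prod_mono, intro conjI)
    fix b :: 'a assume b: "b \<in> Basis"
    let ?X = "\<lambda>x. \<bar>v x\<bar> powr s" and ?Y = "\<lambda>x. \<bar>g b x\<bar> powr p b"
    note pb = p[OF b]
    have gm[measurable]: "g b \<in> borel_measurable ?M"
      using D[OF b] borel_measurable_integrable by (auto simp: L1_deriv_limit_def)
    have eq: "\<bar>snd (vg b) x\<bar> = \<gamma> b * (?X x powr (1 - 1 / p b) * ?Y x powr (1 / p b))" for x
    proof -
      have "?X x powr (1 - 1 / p b) = \<bar>v x\<bar> powr (\<gamma> b - 1)"
        by (simp add: powr_powr \<gamma>_def algebra_simps)
      moreover have "?Y x powr (1 / p b) = \<bar>g b x\<bar>" using pb by (simp add: powr_powr)
      ultimately show ?thesis using vg(3)[OF b, of x] \<gamma>[OF b] by (simp add: abs_mult)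
    qed
    have "(\<integral>x. \<bar>snd (vg b) x\<bar> \<partial>?M) = \<gamma> b * (\<integral>x. ?X x powr (1 - 1 / p b) * ?Y x powr (1 / p b) \<partial>?M)"
      unfolding eq by simp
    also have "\<dots> \<le> \<gamma> b * ((\<integral>x. ?X x \<partial>?M) powr (1 - 1 / p b) * (\<integral>x. ?Y x \<partial>?M) powr (1 / p b))"
      using \<gamma>[OF b] pb by (intro mult_left_mono integral_powr_mult_le(2) Gi int[OF b]) auto
    also have "\<dots> \<le> \<gamma> b * (A powr (1 - 1 / p b) * E powr (1 / p b))"
      unfolding A_def using \<gamma>[OF b] pb E[OF b] by (intro mult_left_mono powr_mono2) auto
    finally show "(\<integral>x. \<bar>snd (vg b) x\<bar> \<partial>?M) \<le> \<gamma> b * (A powr (1 - 1 / p b) * E powr (1 / p b))" .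
  qed auto
  also have "\<dots> = (\<Prod>b\<in>Basis. \<gamma> b) * ((\<Prod>b\<in>Basis. A powr (1 - 1 / p b)) * (\<Prod>b\<in>Basis. E powr (1 / p b)))"
    by (simp add: prod.distrib)
  finally have main: "A ^ N \<le> (\<Prod>b\<in>Basis. \<gamma> b) * ((\<Prod>b\<in>Basis. A powr (1 - 1 / p b)) * (\<Prod>b\<in>Basis. E powr (1 / p b)))" .
  have C0: "(\<Prod>b\<in>Basis. \<gamma> b) > 0" using \<gamma> by (intro prod_pos) (auto dest: less_trans[OF zero_less_one])
  have "A powr (S - 1) \<le> (\<Prod>b\<in>Basis. \<gamma> b) * E powr S"
  proof (cases "A = 0")
    case True
    then show ?thesis using C0 by simp
  next
    case False
    then have Apos: "A > 0" using A0 by simp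
    have "E \<noteq> 0"
    proof
      assume "E = 0"
      then have "(\<Prod>b\<in>(Basis::'a set). E powr (1 / p b)) = 0"
        using p SOME_Basis by (intro prod_zero) auto
      then have "A ^ N \<le> 0" using main by (simp only: mult_zero_right)
      then show False using zero_less_power[OF Apos, of N] by linarith
    qed
    moreover have "E \<ge> 0"
      using E[OF SOME_Basis]
      by (rule order_trans[rotated]) (rule Bochner_Integration.integral_nonneg, simp)
    ultimately have Epos: "E > 0" by simp
    have "A powr real N \<le> (\<Prod>b\<in>Basis. \<gamma> b) * (A powr (real DIM('a) - S) * E powr S)"
      using main Apos Epos by (simp add: powr_realpow powr_sum[symmetric] S(1) sum_subtractf)
    then have "A powr real N / A powr (real DIM('a) - S) \<le> (\<Prod>b\<in>Basis. \<gamma> b) * E powr S"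
      using Apos by (simp add: divide_le_eq mult_ac)
    also have "A powr real N / A powr (real DIM('a) - S) = A powr (S - 1)"
      by (simp add: powr_diff[symmetric] N(2))
    finally show ?thesis .
  qed
  then show "A powr (S - 1) \<le> (\<Prod>b\<in>Basis. 1 + s - s / p b) * E powr S"
    by (simp add: \<gamma>_def)
qed

section \<open>Weak derivatives and admissible test functions\<close>

lemma Lp_integrable:
  assumes "f \<in> Lp \<Omega> p" "p \<ge> 1" "finite_measure (lebesgue_on \<Omega>)"
  shows "integrable (lebesgue_on \<Omega>) f"
proof (rule Bochner_Integration.integrable_bound)
  show "integrable (lebesgue_on \<Omega>) (\<lambda>x. 1 + \<bar>f x\<bar> powr p)"
    using assms finite_measure.integrable_const[OF assms(3), of 1] by (auto simp: Lp_def)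
  show "f \<in> borel_measurable (lebesgue_on \<Omega>)" using assms by (simp add: Lp_def)
  have "\<bar>t\<bar> \<le> 1 + \<bar>t\<bar> powr p" for t :: real
  proof (cases "\<bar>t\<bar> \<le> 1")
    case True
    then show ?thesis using powr_ge_zero[of "\<bar>t\<bar>" p] by linarith
  next
    case False
    then have "\<bar>t\<bar> powr 1 \<le> \<bar>t\<bar> powr p" using assms(2) by (intro powr_mono) auto
    then show ?thesis using False by simp
  qed
  then show "AE x in lebesgue_on \<Omega>. norm (f x) \<le> norm (1 + \<bar>f x\<bar> powr p)"
    by (intro AE_I2) auto
qed

lemma finite_measure_lebesgue_on:
  fixes \<Omega> :: "'a::euclidean_space set"
  assumes "bounded \<Omega>" "\<Omega> \<in> sets lebesgue"
  shows "finite_measure (lebesgue_on \<Omega>)"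
proof (rule finite_measureI)
  have "\<Omega> \<in> lmeasurable" using assms bounded_set_imp_lmeasurable by blast
  then show "emeasure (lebesgue_on \<Omega>) (space (lebesgue_on \<Omega>)) \<noteq> \<infinity>"
    using fmeasurableD2[of \<Omega> lebesgue] assms
    by (simp add: emeasure_restrict_space space_restrict_space del: emeasure_completion)
qed

lemma borel_measurable_lebesgue_on: "f \<in> borel_measurable borel \<Longrightarrow> f \<in> borel_measurable (lebesgue_on \<Omega>)"
  by (auto intro!: measurable_restrict_space1 measurable_completion)

lemma bounded_L1_loc:
  fixes f :: "'a::euclidean_space \<Rightarrow> real"
  assumes "f \<in> borel_measurable borel" "\<And>x. \<bar>f x\<bar> \<le> B"
  shows "f \<in> L1_loc \<Omega>"
proof -
  have "integrable (lebesgue_on K) f" if "compact K" for K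
  proof -
    have "K \<in> sets lebesgue" using that lmeasurable_compact by blast
    then interpret finite_measure "lebesgue_on K"
      using that by (intro finite_measure_lebesgue_on compact_imp_bounded)
    show ?thesis
      using assms borel_measurable_lebesgue_on by (intro integrable_const_bound[of _ B]) auto
  qed
  then show ?thesis by (simp add: L1_loc_def)
qed

lemma L1_loc_mult_C1c:
  assumes \<Omega>: "open \<Omega>" and g: "g \<in> L1_loc \<Omega>" and \<psi>: "\<psi> \<in> C1c \<Omega>"
  shows "integrable (lebesgue_on \<Omega>) (\<lambda>x. g x * \<psi> x)"
proof -
  let ?K = "closure {x. \<psi> x \<noteq> 0}"
  have K: "compact ?K" "?K \<subseteq> \<Omega>" using \<psi> by (auto simp: C1c_def)
  have Kl: "?K \<in> sets lebesgue" using K lmeasurable_compact by blast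
  obtain e :: 'a where e: "e \<in> Basis" using SOME_Basis by blast
  obtain B where B: "\<And>x. \<bar>\<psi> x\<bar> \<le> B" by (rule C1c_bounded[OF \<psi> e]) metis
  have "integrable (lebesgue_on ?K) g" using g K by (auto simp: L1_loc_def)
  then have i: "integrable lebesgue (\<lambda>x. indicator ?K x * g x)"
    using Kl by (simp add: integrable_restrict_space)
  have pm: "\<psi> \<in> borel_measurable lebesgue"
    using C1c_measurable(1)[OF \<psi>] by (auto intro: measurable_completion)
  have "integrable lebesgue (\<lambda>x. (indicator ?K x * g x) * \<psi> x)"
  proof (rule Bochner_Integration.integrable_bound)
    show "integrable lebesgue (\<lambda>x. B * (indicator ?K x * g x))" using i by simp
    show "(\<lambda>x. indicator ?K x * g x * \<psi> x) \<in> borel_measurable lebesgue"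
      by (rule borel_measurable_times[OF borel_measurable_integrable[OF i] pm])
    have "\<bar>\<psi> x\<bar> \<le> \<bar>B\<bar>" for x using B[of x] by linarith
    then show "AE x in lebesgue. norm (indicator ?K x * g x * \<psi> x) \<le> norm (B * (indicator ?K x * g x))"
      by (intro AE_I2) (auto simp: abs_mult mult.commute intro: mult_right_mono)
  qed
  also have "(\<lambda>x. (indicator ?K x * g x) * \<psi> x) = (\<lambda>x. indicator \<Omega> x *\<^sub>R (g x * \<psi> x))"
  proof
    show "(indicator ?K x * g x) * \<psi> x = indicator \<Omega> x *\<^sub>R (g x * \<psi> x)" for x
      using K(2) C1c_zero_outside(1)[OF \<psi>, of x] by (cases "x \<in> ?K") (auto simp: indicator_def)
  qed
  finally show ?thesis using \<Omega> by (simp add: integrable_restrict_space)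
qed

lemma has_weak_deriv_AE_unique:
  assumes \<Omega>: "open \<Omega>" and g: "has_weak_deriv \<Omega> e v g" "has_weak_deriv \<Omega> e v g'"
  shows "AE x in lebesgue_on \<Omega>. g x = g' x"
proof -
  have l: "g \<in> L1_loc \<Omega>" "g' \<in> L1_loc \<Omega>" using g by (auto simp: has_weak_deriv_def)
  have "AE x in lebesgue_on \<Omega>. g x - g' x = 0"
  proof (rule fundamental_lemma_AE[OF \<Omega>])
    show "(\<lambda>x. g x - g' x) \<in> L1_loc \<Omega>" using l by (auto simp: L1_loc_def)
    show "\<forall>\<psi>\<in>test_functions \<Omega>. (\<integral>x. (g x - g' x) * \<psi> x \<partial>lebesgue_on \<Omega>) = 0"
    proof
      fix \<psi> assume \<psi>: "\<psi> \<in> test_functions \<Omega>"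
      then have c: "\<psi> \<in> C1c \<Omega>" using test_functions_C1c by auto
      have "(\<integral>x. g x * \<psi> x \<partial>lebesgue_on \<Omega>) = (\<integral>x. g' x * \<psi> x \<partial>lebesgue_on \<Omega>)"
        using g \<psi> unfolding has_weak_deriv_def by (metis neg_equal_iff_equal)
      then show "(\<integral>x. (g x - g' x) * \<psi> x \<partial>lebesgue_on \<Omega>) = 0"
        using L1_loc_mult_C1c[OF \<Omega> l(1) c] L1_loc_mult_C1c[OF \<Omega> l(2) c] by (simp add: left_diff_distrib)
    qed
  qed
  then show ?thesis by simp
qed

lemma weak_deriv_AE_eq:
  assumes "open \<Omega>" "has_weak_deriv \<Omega> e v g"
  shows "AE x in lebesgue_on \<Omega>. weak_deriv \<Omega> e v x = g x"
  unfolding weak_deriv_def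
  by (rule has_weak_deriv_AE_unique[OF assms(1) someI[of "has_weak_deriv \<Omega> e v", OF assms(2)] assms(2)])

lemma has_weak_deriv_lipschitz:
  fixes w d :: "'a::euclidean_space \<Rightarrow> real"
  assumes \<Omega>: "open \<Omega>" and e: "e \<in> Basis" and w: "continuous_on UNIV w" "\<And>x. \<bar>w x\<bar> \<le> B"
    and d: "d \<in> borel_measurable borel" "\<And>x. \<bar>d x\<bar> \<le> L"
    and L: "\<And>x t. \<bar>w (x + t *\<^sub>R e) - w x\<bar> \<le> L * \<bar>t\<bar>"
    and D: "AE x in lborel. ((\<lambda>s. w (x + s *\<^sub>R e)) has_real_derivative d x) (at 0)"
  shows "has_weak_deriv \<Omega> e w d"
  unfolding has_weak_deriv_def
proof (intro conjI ballI)
  have wm: "w \<in> borel_measurable borel" using w(1) by (rule borel_measurable_continuous_onI)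
  show "w \<in> L1_loc \<Omega>" "d \<in> L1_loc \<Omega>" using bounded_L1_loc wm w(2) d by blast+
  fix \<psi> assume "\<psi> \<in> test_functions \<Omega>"
  then have \<psi>: "\<psi> \<in> C1c \<Omega>" using test_functions_C1c by auto
  note [measurable] = wm d(1) C1c_measurable(1)[OF \<psi>] C1c_measurable(2)[OF \<psi> e]
  have "(\<integral>x. w x * pdiff e \<psi> x \<partial>lebesgue_on \<Omega>) = (\<integral>x. w x * pdiff e \<psi> x \<partial>lborel)"
    using \<Omega> C1c_zero_outside_domain[OF \<psi>] by (intro integral_lebesgue_on_lborel) auto
  also have "\<dots> = - (\<integral>x. d x * \<psi> x \<partial>lborel)"
    by (rule integral_by_parts_lipschitz[OF e w(1) d(1) L D \<psi>])
  also have "(\<integral>x. d x * \<psi> x \<partial>lborel) = (\<integral>x. d x * \<psi> x \<partial>lebesgue_on \<Omega>)"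
    using \<Omega> C1c_zero_outside_domain[OF \<psi>] by (intro integral_lebesgue_on_lborel[symmetric]) auto
  finally show "(\<integral>x. w x * pdiff e \<psi> x \<partial>lebesgue_on \<Omega>) = - (\<integral>x. d x * \<psi> x \<partial>lebesgue_on \<Omega>)" .
qed

lemma has_weak_deriv_const:
  assumes "open \<Omega>" "e \<in> Basis"
  shows "has_weak_deriv \<Omega> e (\<lambda>_. c) (\<lambda>_. 0)"
  by (rule has_weak_deriv_lipschitz[OF assms, where B = "\<bar>c\<bar>" and L = 0]) auto

lemma const_W1inf:
  assumes "open \<Omega>" shows "(\<lambda>_. c) \<in> W1inf \<Omega>"
proof -
  have "(\<lambda>_. c) \<in> Linf \<Omega>" for c :: real by (auto simp: Linf_def)
  then show ?thesis using has_weak_deriv_const[OF assms] unfolding W1inf_def by blast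
qed

text \<open>Lebesgue measure is complete, hence the arbitrary choice made in \<open>weak_deriv\<close> does not destroy measurability.\<close>

lemma AE_zero_measurable:
  fixes z :: "'a::euclidean_space \<Rightarrow> real"
  assumes \<Omega>: "\<Omega> \<in> sets lebesgue" and z: "AE x in lebesgue_on \<Omega>. z x = 0"
  shows "z \<in> borel_measurable (lebesgue_on \<Omega>)"
proof (rule measurableI)
  have "AE x in lebesgue. x \<in> \<Omega> \<longrightarrow> z x = 0" using z \<Omega> by (simp add: AE_restrict_space_iff)
  then obtain Z where Z: "Z \<in> null_sets lebesgue" "{x. \<not> (x \<in> \<Omega> \<longrightarrow> z x = 0)} \<subseteq> Z"
    by (auto simp: eventually_ae_filter)
  have sub: "Y \<in> sets lebesgue" if "Y \<subseteq> Z" for Y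
    using null_sets_completion_subset[OF that Z(1)] by auto
  fix A :: "real set"
  have "z -` A \<inter> \<Omega> \<in> sets lebesgue"
  proof (cases "0 \<in> A")
    case True
    then have "z -` A \<inter> \<Omega> = \<Omega> - {x \<in> \<Omega>. z x \<notin> A}" by auto
    moreover have "{x \<in> \<Omega>. z x \<notin> A} \<in> sets lebesgue" using Z(2) True by (intro sub) auto
    ultimately show ?thesis using \<Omega> by auto
  next
    case False
    then show ?thesis using Z(2) by (intro sub) auto
  qed
  then show "z -` A \<inter> space (lebesgue_on \<Omega>) \<in> sets (lebesgue_on \<Omega>)"
    using \<Omega> by (auto simp: sets_restrict_space_iff space_restrict_space)
qed auto

lemma zero_W1p_0:
  fixes \<Omega> :: "(real^'n) set"
  assumes "open \<Omega>" shows "(\<lambda>_. 0) \<in> W1p_0 \<Omega> p \<inter> Linf \<Omega>"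
proof -
  note wd = has_weak_deriv_const[OF assms, of _ 0]
  have ae: "AE x in lebesgue_on \<Omega>. weak_deriv \<Omega> e (\<lambda>_. 0) x = 0" if "e \<in> Basis" for e
    by (rule weak_deriv_AE_eq[OF assms wd[OF that]])
  have z: "(\<lambda>_. 0) \<in> Lp \<Omega> 1" by (simp add: Lp_def)
  have "(\<lambda>_. 0) \<in> W11 \<Omega>" using z wd by (auto simp: W11_def)
  moreover have "(\<lambda>x. 0) \<in> test_functions \<Omega>"
    using smooth_alg_smooth[OF smooth_alg.const[of 0]] by (simp add: test_functions_def)
  moreover have "Lp_norm \<Omega> 1 (\<lambda>x. frechet_derivative (\<lambda>x. 0) (at x) e - weak_deriv \<Omega> e (\<lambda>_. 0) x) = 0"
    if "e \<in> Basis" for e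
  proof -
    have "(\<integral>x. \<bar>frechet_derivative (\<lambda>x. 0) (at x) e - weak_deriv \<Omega> e (\<lambda>_. 0) x\<bar> powr 1 \<partial>lebesgue_on \<Omega>) = 0"
      by (rule integral_eq_zero_AE) (use ae[OF that] in \<open>eventually_elim, simp\<close>)
    then show ?thesis by (simp add: Lp_norm_def)
  qed
  ultimately have "(\<lambda>_. 0) \<in> W11_0 \<Omega>"
    unfolding W11_0_def by (intro CollectI conjI exI[of _ "\<lambda>j x. 0"]) (auto simp: Lp_norm_def)
  moreover have "weak_deriv \<Omega> (axis i 1) (\<lambda>_. 0) \<in> Lp \<Omega> (p $ i)" for i
  proof -
    have b: "axis i (1::real) \<in> Basis" by (simp add: axis_in_Basis_iff)
    have m: "weak_deriv \<Omega> (axis i 1) (\<lambda>_. 0) \<in> borel_measurable (lebesgue_on \<Omega>)"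
      using ae[OF b] assms by (intro AE_zero_measurable) auto
    have "integrable (lebesgue_on \<Omega>) (\<lambda>x. \<bar>weak_deriv \<Omega> (axis i 1) (\<lambda>_. 0) x\<bar> powr p $ i)"
    proof (rule integrable_cong_AE_imp[of _ "\<lambda>_. 0"])
      show "AE x in lebesgue_on \<Omega>. 0 = \<bar>weak_deriv \<Omega> (axis i 1) (\<lambda>_. 0) x\<bar> powr p $ i"
        using ae[OF b] by eventually_elim simp
    qed (use m in auto)
    then show ?thesis using m by (simp add: Lp_def)
  qed
  ultimately show ?thesis by (auto simp: W1p_0_def Linf_def)
qed

lemma trunc_eq: "k > 0 \<Longrightarrow> trunc k s = max (- k) (min k s)"
  by (auto simp: trunc_def)

lemma continuous_on_trunc: "continuous_on A (trunc k)"
  unfolding trunc_def[abs_def] by (intro continuous_intros) simp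

text \<open>Truncations are admissible in the definition of a solution. Their derivative is the
  indicator of \<open>(-k, k)\<close>; the chosen weak derivative agrees with it almost everywhere.\<close>

lemma trunc_renormalization:
  assumes k: "k > 0" shows "trunc k \<in> renormalizations"
proof -
  define d where "d s = indicat_real {-k<..<k} s" for s :: real
  have wd: "has_weak_deriv UNIV 1 (trunc k) d"
  proof (rule has_weak_deriv_lipschitz[where B = k and L = 1])
    show "continuous_on UNIV (trunc k)" by (rule continuous_on_trunc)
    show "\<bar>trunc k x\<bar> \<le> k" for x using k by (auto simp: trunc_eq)
    show "d \<in> borel_measurable borel" unfolding d_def by measurable
    show "\<bar>d x\<bar> \<le> 1" for x by (simp add: d_def indicator_def)
    show "\<bar>trunc k (x + t *\<^sub>R 1) - trunc k x\<bar> \<le> 1 * \<bar>t\<bar>" for x t using k by (auto simp: trunc_eq)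
    have "finite {-k, k}" by simp
    then have "AE x in lborel. x \<notin> {-k, k}"
      by (intro AE_not_in finite_imp_null_set_lborel)
    then show "AE x in lborel. ((\<lambda>s. trunc k (x + s *\<^sub>R 1)) has_real_derivative d x) (at 0)"
    proof eventually_elim
      case (elim x)
      then consider "x < -k" | "-k < x" "x < k" | "x > k" by fastforce
      then show ?case
      proof cases
        case 1
        have "((\<lambda>s. - k) has_real_derivative d x) (at 0)" using 1 by (simp add: d_def)
        then show ?thesis
          by (rule has_field_derivative_transform_within_open[where S = "{..< - k - x}"])
            (use 1 k in \<open>auto simp: trunc_eq\<close>)
      next
        case 2
        have "((\<lambda>s. x + s) has_real_derivative d x) (at 0)"
          using 2 by (auto simp: d_def intro!: derivative_eq_intros)
        then show ?thesis
          by (rule has_field_derivative_transform_within_open[where S = "{- k - x <..< k - x}"])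
            (use 2 k in \<open>auto simp: trunc_eq\<close>)
      next
        case 3
        have "((\<lambda>s. k) has_real_derivative d x) (at 0)" using 3 k by (simp add: d_def)
        then show ?thesis
          by (rule has_field_derivative_transform_within_open[where S = "{k - x <..}"])
            (use 3 k in \<open>auto simp: trunc_eq\<close>)
      qed
    qed
  qed auto
  have "AE s in lebesgue_on UNIV. weak_deriv UNIV 1 (trunc k) s = d s"
    by (rule weak_deriv_AE_eq[OF open_UNIV wd])
  then have ae: "AE s in lebesgue. \<bar>s\<bar> \<ge> k \<longrightarrow> weak_deriv UNIV 1 (trunc k) s = 0"
    unfolding lebesgue_on_UNIV_eq by eventually_elim (auto simp: d_def indicator_def)
  have "trunc k \<in> Linf UNIV"
    unfolding Linf_def using borel_measurable_lebesgue_on[OF borel_measurable_continuous_onI[OF continuous_on_trunc]] k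
    by (auto simp: trunc_eq intro!: exI[of _ k])
  moreover have "d \<in> Linf UNIV"
  proof -
    have "d \<in> borel_measurable borel" unfolding d_def by measurable
    then have "d \<in> borel_measurable (lebesgue_on UNIV)" by (rule borel_measurable_lebesgue_on)
    moreover have "AE s in lebesgue_on UNIV. \<bar>d s\<bar> \<le> 1" by (simp add: d_def indicator_def)
    ultimately show ?thesis unfolding Linf_def by blast
  qed
  ultimately have "trunc k \<in> W1inf UNIV" using wd by (auto simp: W1inf_def)
  then show ?thesis
    unfolding renormalizations_def using ae k continuous_on_trunc by (auto simp: trunc_def)
qed

lemma Lp_norm_1: "Lp_norm \<Omega> 1 f = (\<integral>x. \<bar>f x\<bar> \<partial>lebesgue_on \<Omega>)"
  by (simp add: Lp_norm_def)

lemma Lp_1_integrable: "f \<in> Lp \<Omega> 1 \<Longrightarrow> integrable (lebesgue_on \<Omega>) f"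
  unfolding Lp_def mem_Collect_eq using integrable_abs_cancel[of "lebesgue_on \<Omega>" f] by auto

text \<open>The integrability of the chosen weak derivative is a hypothesis because \<open>Lp_norm\<close> is 0, and hence carries no information,
  for functions that are not integrable.\<close>

lemma W11_0_L1_deriv_limit:
  assumes v: "v \<in> W11_0 \<Omega>" and e: "e \<in> Basis"
    and i: "integrable (lebesgue_on \<Omega>) (weak_deriv \<Omega> e v)"
  shows "L1_deriv_limit \<Omega> e v (weak_deriv \<Omega> e v)"
proof -
  have "v \<in> Lp \<Omega> 1" using v by (simp add: W11_0_def W11_def)
  moreover obtain \<phi> where "\<And>j::nat. \<phi> j \<in> test_functions \<Omega>"
     "(\<lambda>j. Lp_norm \<Omega> 1 (\<lambda>x. \<phi> j x - v x)) \<longlonglongrightarrow> 0"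
     "(\<lambda>j. Lp_norm \<Omega> 1 (\<lambda>x. frechet_derivative (\<phi> j) (at x) e - weak_deriv \<Omega> e v x)) \<longlonglongrightarrow> 0"
    using v e by (auto simp: W11_0_def)
  moreover from this(1) have "\<phi> j \<in> C1c \<Omega>" for j using test_functions_C1c by blast
  ultimately show ?thesis
    unfolding L1_deriv_limit_def using i Lp_1_integrable
    by (intro conjI exI[of _ \<phi>]) (simp_all add: Lp_norm_1)
qed

section \<open>Truncations of a solution\<close>

lemma weak_grad_component:
  "weak_grad \<Omega> v x $ i = weak_deriv \<Omega> (axis i 1) v x"
  by (simp add: weak_grad_def)

lemma sum_Basis_vec:
  fixes f :: "real^'n \<Rightarrow> real"
  shows "(\<Sum>b\<in>Basis. f b) = (\<Sum>i\<in>UNIV. f (axis i 1))"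
proof -
  have "(Basis :: (real^'n) set) = range (\<lambda>i. axis i 1)" by (auto simp: Basis_vec_def)
  moreover have "inj (\<lambda>i::'n. axis i (1::real))" by (auto simp: inj_def axis_eq_axis)
  ultimately show ?thesis
    using sum.reindex[of "\<lambda>i::'n. axis i (1::real)" UNIV f] by (simp add: o_def)
qed

text \<open>The truncations \<open>T\<^sub>k(u)\<close> of one fixed function and their weak partial derivatives.\<close>

locale truncations =
  fixes \<Omega> :: "(real^'n) set" and p :: "real^'n" and u :: "real^'n \<Rightarrow> real"
  assumes \<Omega>: "open \<Omega>" "bounded \<Omega>" and p: "\<And>i. 1 < p $ i" and u: "u \<in> S1p_0 \<Omega> p"
begin

abbreviation "M \<equiv> lebesgue_on \<Omega>"
abbreviation "Tu k \<equiv> (\<lambda>x. trunc k (u x))"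
abbreviation "dTu k i \<equiv> weak_deriv \<Omega> (axis i 1) (Tu k)"

lemma finite_M: "finite_measure M"
  using \<Omega> by (intro finite_measure_lebesgue_on) auto

lemma u_measurable[measurable]: "u \<in> borel_measurable M"
  using u by (simp add: S1p_0_def)

lemma dTu_Lp: "k > 0 \<Longrightarrow> dTu k i \<in> Lp \<Omega> (p $ i)"
  using u by (simp add: S1p_0_def W1p_0_def)

lemma dTu_measurable: "k > 0 \<Longrightarrow> dTu k i \<in> borel_measurable M"
  using dTu_Lp by (simp add: Lp_def)

lemma dTu_integrable_powr: "k > 0 \<Longrightarrow> integrable M (\<lambda>x. \<bar>dTu k i x\<bar> powr p $ i)"
  using dTu_Lp by (simp add: Lp_def)

lemma Tu_limit:
  assumes "k > 0" shows "L1_deriv_limit \<Omega> (axis i 1) (Tu k) (dTu k i)"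
proof (rule W11_0_L1_deriv_limit)
  show "Tu k \<in> W11_0 \<Omega>" using u assms by (simp add: S1p_0_def W1p_0_def)
  show "axis i (1::real) \<in> Basis" by (simp add: axis_in_Basis_iff)
  show "integrable M (dTu k i)"
    using Lp_integrable[OF dTu_Lp[OF assms] _ finite_M] p[of i] by simp
qed

lemma dTu_above:
  assumes "k > 0" shows "AE x in M. \<bar>u x\<bar> \<ge> k \<longrightarrow> dTu k i x = 0"
proof -
  have b: "axis i (1::real) \<in> Basis" by (simp add: axis_in_Basis_iff)
  show ?thesis
    using L1_deriv_limit_level_set[OF \<Omega>(1) b Tu_limit[OF assms], of k]
      L1_deriv_limit_level_set[OF \<Omega>(1) b Tu_limit[OF assms], of "-k"]
  proof eventually_elim
    case (elim x)
    have "trunc k (u x) = k \<or> trunc k (u x) = - k" if "\<bar>u x\<bar> \<ge> k"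
      using that assms by (auto simp: trunc_eq)
    then show ?case using elim by blast
  qed
qed

lemma dTu_consistent:
  assumes "k > 0" "j > 0" shows "AE x in M. \<bar>u x\<bar> < k \<and> \<bar>u x\<bar> < j \<longrightarrow> dTu k i x = dTu j i x"
proof -
  have b: "axis i (1::real) \<in> Basis" by (simp add: axis_in_Basis_iff)
  have "L1_deriv_limit \<Omega> (axis i 1) (\<lambda>x. Tu k x - Tu j x) (\<lambda>x. dTu k i x - dTu j i x)"
    using L1_deriv_limit_diff[OF _ b Tu_limit[OF assms(1)] Tu_limit[OF assms(2)]] \<Omega>(1) by simp
  from L1_deriv_limit_level_set[OF \<Omega>(1) b this, of 0] show ?thesis
    by eventually_elim (use assms in \<open>auto simp: trunc_eq\<close>)
qed

text \<open>The choice in the definition of \<open>trunc_grad\<close> is not vacuous: on each of the countably many sets where \<open>|u|\<close> has a given integer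
  part, take the gradient of the truncation at the next integer, and use that the gradients of different truncations agree where
  neither is active.\<close>

lemma trunc_grad:
  "trunc_grad \<Omega> u \<in> borel_measurable M"
  "k > 0 \<Longrightarrow> AE x in M. \<bar>u x\<bar> < k \<longrightarrow> trunc_grad \<Omega> u x = weak_grad \<Omega> (Tu k) x"
proof -
  \<comment> \<open>A positive integer level at which \<open>u\<close> is not truncated.\<close>
  define lev where "lev x = Suc (nat \<lfloor>\<bar>u x\<bar>\<rfloor>)" for x
  have lev: "\<bar>u x\<bar> < real (lev x)" for x unfolding lev_def by linarith
  define G where "G x = weak_grad \<Omega> (Tu (real (lev x))) x" for x
  have "G \<in> borel_measurable M"
  proof -
    have lm: "lev \<in> measurable M (count_space {0<..})"
    proof -
      have "lev \<in> measurable M (count_space UNIV)" unfolding lev_def by measurable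
      then show ?thesis by (auto simp: measurable_count_space_eq2_countable lev_def)
    qed
    have "(\<lambda>x. weak_grad \<Omega> (Tu (real j)) x) \<in> borel_measurable M" if "j \<in> {0<..}" for j :: nat
      using that dTu_measurable[of "real j"]
      by (subst borel_measurable_euclidean_space) (auto simp: Basis_vec_def inner_axis weak_grad_component)
    then show ?thesis unfolding G_def
      by (rule measurable_compose_countable'[OF _ lm]) auto
  qed
  moreover have "AE x in M. \<bar>u x\<bar> < k \<longrightarrow> G x = weak_grad \<Omega> (Tu k) x" if "k > 0" for k
  proof -
    have "AE x in M. \<forall>j. \<forall>i. \<bar>u x\<bar> < k \<and> \<bar>u x\<bar> < real (Suc j) \<longrightarrow> dTu k i x = dTu (real (Suc j)) i x"
      unfolding AE_all_countable
    proof (intro allI)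
      fix j :: nat and i :: 'n
      show "AE x in M. \<bar>u x\<bar> < k \<and> \<bar>u x\<bar> < real (Suc j) \<longrightarrow> dTu k i x = dTu (real (Suc j)) i x"
        by (rule dTu_consistent) (use that in auto)
    qed
    then show ?thesis
    proof eventually_elim
      case (elim x)
      show ?case
      proof
        assume "\<bar>u x\<bar> < k"
        then have "dTu k i x = dTu (real (lev x)) i x" for i
          using elim lev[of x] unfolding lev_def by blast
        then show "G x = weak_grad \<Omega> (Tu k) x"
          by (simp add: vec_eq_iff G_def weak_grad_component)
      qed
    qed
  qed
  ultimately have "\<exists>G. G \<in> borel_measurable M \<and>
     (\<forall>k>0. AE x in M. \<bar>u x\<bar> < k \<longrightarrow> G x = weak_grad \<Omega> (Tu k) x)" by blast
  from someI_ex[OF this]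
  show "trunc_grad \<Omega> u \<in> borel_measurable M"
    "k > 0 \<Longrightarrow> AE x in M. \<bar>u x\<bar> < k \<longrightarrow> trunc_grad \<Omega> u x = weak_grad \<Omega> (Tu k) x"
    unfolding trunc_grad_def[symmetric] by blast+
qed

text \<open>Where \<open>|u| < k\<close> both gradients agree, and where \<open>|u| \<ge> k\<close> the gradient of \<open>T\<^sub>k(u)\<close> vanishes because \<open>T\<^sub>k(u)\<close> only takes
  the values \<open>k\<close> and \<open>-k\<close> there.\<close>

lemma energy_density:
  assumes "k > 0"
  shows "AE x in M. a_hat p (trunc_grad \<Omega> u x) \<bullet> weak_grad \<Omega> (Tu k) x = (\<Sum>i\<in>UNIV. \<bar>dTu k i x\<bar> powr p $ i)"
proof -
  have "AE x in M. \<forall>i. \<bar>u x\<bar> \<ge> k \<longrightarrow> dTu k i x = 0"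
    unfolding AE_all_countable using dTu_above[OF assms] by blast
  with trunc_grad(2)[OF assms] show ?thesis
  proof eventually_elim
    case (elim x)
    show ?case
    proof (cases "\<bar>u x\<bar> < k")
      case True
      have "\<bar>t\<bar> powr (q - 2) * t * t = \<bar>t\<bar> powr q" for t q :: real
      proof (cases "t = 0")
        case False
        have "\<bar>t\<bar> powr (q - 2) * (\<bar>t\<bar> powr 2) = \<bar>t\<bar> powr q"
          by (simp only: powr_add[symmetric]) simp
        moreover have "\<bar>t\<bar> powr 2 = t * t" by (simp add: power2_eq_square)
        ultimately show ?thesis by (simp only: mult.assoc)
      qed simp
      then show ?thesis using True elim(1)
        by (simp add: a_hat_def inner_vec_def weak_grad_component)
    next
      case False
      then have "dTu k i x = 0" for i using elim(2) by simp
      then show ?thesis by (simp add: inner_vec_def weak_grad_component)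
    qed
  qed
qed

text \<open>The equation tested with \<open>T\<^sub>k(u)\<close>, where \<open>V(x,u) T\<^sub>k(u) \<ge> 0\<close> is dropped and \<open>|T\<^sub>k(u)| \<le> k\<close> is used on the right.\<close>

lemma energy_estimate:
  assumes V: "admissible_potential \<Omega> V" and f: "f \<in> Lp \<Omega> 1"
    and sol: "entropic_renormalized_solution \<Omega> p V f u" and k: "k > 0"
  shows "(\<integral>x. \<bar>dTu k i x\<bar> powr p $ i \<partial>M) \<le> k * Lp_norm \<Omega> 1 f"
proof -
  have eq: "(\<integral>x. a_hat p (trunc_grad \<Omega> u x) \<bullet> weak_grad \<Omega> (Tu k) x \<partial>M)
      + (\<integral>x. V x (u x) * trunc k (u x) \<partial>M) = (\<integral>x. f x * trunc k (u x) \<partial>M)"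
  proof -
    have "\<forall>\<eta>\<in>W1inf \<Omega>. \<forall>\<phi>\<in>W1p_0 \<Omega> p \<inter> Linf \<Omega>. \<forall>B\<in>renormalizations.
        (\<integral>x. a_hat p (trunc_grad \<Omega> u x) \<bullet> weak_grad \<Omega> (\<lambda>y. \<eta> y * B (u y - \<phi> y)) x \<partial>M)
          + (\<integral>x. V x (u x) * \<eta> x * B (u x - \<phi> x) \<partial>M)
          = (\<integral>x. f x * \<eta> x * B (u x - \<phi> x) \<partial>M)"
      using sol unfolding entropic_renormalized_solution_def by blast
    from this[rule_format, OF const_W1inf[OF \<Omega>(1), of 1] zero_W1p_0[OF \<Omega>(1)] trunc_renormalization[OF k]]
    show ?thesis by simp
  qed
  have fi: "integrable M f" by (rule Lp_1_integrable[OF f])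
  note [measurable] = borel_measurable_integrable[OF fi]
  have [measurable]: "trunc k \<in> borel_measurable borel"
    by (rule borel_measurable_continuous_onI[OF continuous_on_trunc])
  have bt: "\<bar>trunc k t\<bar> \<le> k" for t using k by (auto simp: trunc_eq)
  have "(\<integral>x. V x (u x) * trunc k (u x) \<partial>M) \<ge> 0"
  proof (rule integral_nonneg_AE)
    have "AE x in M. mono (V x) \<and> V x 0 = 0"
      using V unfolding admissible_potential_def by (auto elim: eventually_mono)
    then show "AE x in M. 0 \<le> V x (u x) * trunc k (u x)"
    proof eventually_elim
      case (elim x)
      then show ?case
        using monoD[of "V x" 0 "u x"] monoD[of "V x" "u x" 0] k
        by (cases "u x \<ge> 0") (auto simp: trunc_eq intro!: mult_nonneg_nonneg mult_nonpos_nonpos)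
    qed
  qed
  moreover have "(\<integral>x. f x * trunc k (u x) \<partial>M) \<le> k * Lp_norm \<Omega> 1 f"
  proof -
    have fb: "\<bar>f x * trunc k (u x)\<bar> \<le> k * \<bar>f x\<bar>" for x
      using mult_right_mono[OF bt[of "u x"] abs_ge_zero[of "f x"]] by (simp add: abs_mult mult.commute)
    have "(\<integral>x. f x * trunc k (u x) \<partial>M) \<le> (\<integral>x. k * \<bar>f x\<bar> \<partial>M)"
    proof (rule integral_mono)
      show "integrable M (\<lambda>x. k * \<bar>f x\<bar>)" using fi by simp
      then show "integrable M (\<lambda>x. f x * trunc k (u x))"
        by (rule Bochner_Integration.integrable_bound) (use fb k in \<open>auto simp: abs_mult\<close>)
      show "f x * trunc k (u x) \<le> k * \<bar>f x\<bar>" for x using fb[of x] by linarith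
    qed
    then show ?thesis by (simp add: Lp_norm_1)
  qed
  moreover have "(\<integral>x. a_hat p (trunc_grad \<Omega> u x) \<bullet> weak_grad \<Omega> (Tu k) x \<partial>M)
      = (\<Sum>i\<in>UNIV. \<integral>x. \<bar>dTu k i x\<bar> powr p $ i \<partial>M)"
  proof -
    have "integrable M (\<lambda>x. a_hat p (trunc_grad \<Omega> u x) \<bullet> weak_grad \<Omega> (Tu k) x)"
    proof -
      have "\<forall>\<eta>\<in>W1inf \<Omega>. \<forall>\<phi>\<in>W1p_0 \<Omega> p \<inter> Linf \<Omega>. \<forall>B\<in>renormalizations.
        integrable M (\<lambda>x. a_hat p (trunc_grad \<Omega> u x) \<bullet> weak_grad \<Omega> (\<lambda>y. \<eta> y * B (u y - \<phi> y)) x)"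
        using sol unfolding entropic_renormalized_solution_def by blast
      from this[rule_format, OF const_W1inf[OF \<Omega>(1), of 1] zero_W1p_0[OF \<Omega>(1)] trunc_renormalization[OF k]]
      show ?thesis by simp
    qed
    then have "(\<integral>x. a_hat p (trunc_grad \<Omega> u x) \<bullet> weak_grad \<Omega> (Tu k) x \<partial>M)
        = (\<integral>x. (\<Sum>i\<in>UNIV. \<bar>dTu k i x\<bar> powr p $ i) \<partial>M)"
      using energy_density[OF k] dTu_integrable_powr[OF k]
      by (intro integral_cong_AE) (auto intro: borel_measurable_integrable)
    then show ?thesis using dTu_integrable_powr[OF k] by simp
  qed
  ultimately have "(\<Sum>i\<in>UNIV. \<integral>x. \<bar>dTu k i x\<bar> powr p $ i \<partial>M) \<le> k * Lp_norm \<Omega> 1 f"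
    using eq by linarith
  moreover have "(\<integral>x. \<bar>dTu k i x\<bar> powr p $ i \<partial>M) \<le> (\<Sum>i\<in>UNIV. \<integral>x. \<bar>dTu k i x\<bar> powr p $ i \<partial>M)"
    by (rule member_le_sum) auto
  ultimately show ?thesis by linarith
qed

lemma measure_level_le:
  assumes k: "k > 0" and s: "s > 0" and i: "integrable M (\<lambda>x. \<bar>Tu k x\<bar> powr s)"
  shows "k powr s * meas_gt \<Omega> u k \<le> (\<integral>x. \<bar>Tu k x\<bar> powr s \<partial>M)"
proof -
  interpret finite_measure M by (rule finite_M)
  have set: "{x \<in> \<Omega>. \<bar>u x\<bar> > k} \<in> sets M"
  proof -
    have "{x \<in> space M. \<bar>u x\<bar> > k} \<in> sets M" by measurable
    then show ?thesis by (simp add: space_restrict_space)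
  qed
  have "k powr s * meas_gt \<Omega> u k = (\<integral>x. indicator {x \<in> \<Omega>. \<bar>u x\<bar> > k} x * k powr s \<partial>M)"
    using set by (simp add: meas_gt_def Int_absorb2[of _ \<Omega>] subsetI)
  also have "\<dots> \<le> (\<integral>x. \<bar>Tu k x\<bar> powr s \<partial>M)"
  proof (rule integral_mono[OF _ i])
    show "integrable M (\<lambda>x. indicator {x \<in> \<Omega>. \<bar>u x\<bar> > k} x * k powr s)"
      using set by (simp add: emeasure_finite less_top[symmetric])
    show "indicator {x \<in> \<Omega>. \<bar>u x\<bar> > k} x * k powr s \<le> \<bar>Tu k x\<bar> powr s" for x
    proof -
      have "\<bar>Tu k x\<bar> = k" if "\<bar>u x\<bar> > k" using that k by (auto simp: trunc_eq)
      then show ?thesis by (auto simp: indicator_def)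
    qed
  qed
  finally show ?thesis .
qed

text \<open>The level \<open>k/2\<close> makes room for the strict inequality \<open>|u| < k\<close> on which \<open>trunc_grad\<close> is known.\<close>

lemma measure_gradient_le:
  assumes l: "l > 0" and k: "k > 0"
  shows "meas_gt \<Omega> (\<lambda>x. trunc_grad \<Omega> u x $ i) l
    \<le> meas_gt \<Omega> u (k / 2) + l powr (- p $ i) * (\<integral>x. \<bar>dTu k i x\<bar> powr p $ i \<partial>M)"
proof -
  interpret finite_measure M by (rule finite_M)
  note [measurable] = dTu_measurable[OF k, of i] trunc_grad(1)
  have gm[measurable]: "(\<lambda>x. trunc_grad \<Omega> u x $ i) \<in> borel_measurable M"
  proof -
    have "(\<lambda>x. trunc_grad \<Omega> u x \<bullet> axis i 1) \<in> borel_measurable M" by measurable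
    then show ?thesis by (simp add: inner_axis)
  qed
  let ?A = "{x \<in> space M. \<bar>trunc_grad \<Omega> u x $ i\<bar> > l}"
  let ?B = "{x \<in> space M. \<bar>u x\<bar> > k / 2}" and ?C = "{x \<in> space M. \<bar>dTu k i x\<bar> > l}"
  have sets: "?A \<in> sets M" "?B \<in> sets M" "?C \<in> sets M" by measurable
  have "AE x in M. x \<in> ?A \<longrightarrow> x \<in> ?B \<union> ?C"
    using trunc_grad(2)[OF k]
  proof eventually_elim
    case (elim x)
    then show ?case using k by (cases "\<bar>u x\<bar> < k") (auto simp: weak_grad_component)
  qed
  then have "measure M ?A \<le> measure M (?B \<union> ?C)"
    using sets by (intro finite_measure_mono_AE) auto
  also have "\<dots> \<le> measure M ?B + measure M ?C" using sets by (intro measure_Un_le)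
  finally have "measure M ?A \<le> measure M ?B + measure M ?C" .
  moreover have "measure M ?C \<le> l powr (- p $ i) * (\<integral>x. \<bar>dTu k i x\<bar> powr p $ i \<partial>M)"
  proof -
    have "measure M ?C = (\<integral>x. indicator ?C x \<partial>M)"
      using sets by (simp add: Int_absorb2[of _ \<Omega>] subsetI)
    also have "\<dots> \<le> (\<integral>x. l powr (- p $ i) * \<bar>dTu k i x\<bar> powr p $ i \<partial>M)"
    proof (rule integral_mono)
      show "integrable M (indicat_real ?C)" using sets by (simp add: emeasure_finite less_top[symmetric])
      show "integrable M (\<lambda>x. l powr (- p $ i) * \<bar>dTu k i x\<bar> powr p $ i)"
        using dTu_integrable_powr[OF k] by simp
      show "indicat_real ?C x \<le> l powr (- p $ i) * \<bar>dTu k i x\<bar> powr p $ i" for x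
      proof (cases "x \<in> ?C")
        case True
        then have "l powr p $ i \<le> \<bar>dTu k i x\<bar> powr p $ i" using l p[of i] by (intro powr_mono2) auto
        then have "l powr (- p $ i) * l powr p $ i \<le> l powr (- p $ i) * \<bar>dTu k i x\<bar> powr p $ i"
          by (intro mult_left_mono) auto
        moreover have "l powr (- p $ i) * l powr p $ i = 1" using l by (simp add: powr_add[symmetric])
        ultimately show ?thesis using True by simp
      qed simp
    qed
    finally show ?thesis by simp
  qed
  ultimately show ?thesis by (simp add: meas_gt_def space_restrict_space)
qed

end

section \<open>The Marcinkiewicz estimates\<close>

text \<open>For \<open>M > 0\<close> the two terms of the hypothesis are equal when \<open>k = M powr a * l powr (P (S - 1) a)\<close> with \<open>a = 1/(n - 1)\<close>.\<close>

lemma level_balance: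
  fixes n S P \<mu> K l M :: real
  assumes n: "n > 1" and S: "S > 1" "S < n" and P: "P > 0" and K: "K \<ge> 0" and l: "l > 0" and M: "M \<ge> 0"
    and \<mu>: "\<And>k. k > 0 \<Longrightarrow> \<mu> \<le> K * (M powr (S / (S - 1)) * k powr (- (n - S) / (S - 1)) + k * M * l powr (- P))"
  shows "\<mu> \<le> 2 * K * M powr (n / (n - 1)) * l powr (- (P * (n - S) / (n - 1)))"
proof (cases "M = 0")
  case True
  then show ?thesis using \<mu>[of 1] by simp
next
  case False
  then have M: "M > 0" using assms by simp
  define a where "a = 1 / (n - 1)"
  define k where "k = M powr a * l powr (P * (S - 1) * a)"
  have k: "k > 0" using M l by (simp add: k_def)
  have e1: "k * M * l powr (- P) = M powr (n / (n - 1)) * l powr (- (P * (n - S) / (n - 1)))"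
  proof -
    have "k * M * l powr (- P) = (M powr a * M powr 1) * (l powr (P * (S - 1) * a) * l powr (- P))"
      using M by (simp add: k_def)
    also have "\<dots> = M powr (a + 1) * l powr (P * (S - 1) * a + (- P))"
      by (simp only: powr_add)
    also have "a + 1 = n / (n - 1)" using n by (simp add: a_def field_simps)
    also have "P * (S - 1) * a + (- P) = - (P * (n - S) / (n - 1))" using n by (simp add: a_def field_simps)
    finally show ?thesis .
  qed
  have e2: "M powr (S / (S - 1)) * k powr (- (n - S) / (S - 1)) = M powr (n / (n - 1)) * l powr (- (P * (n - S) / (n - 1)))"
  proof -
    have "k powr (- (n - S) / (S - 1)) = M powr (a * (- (n - S) / (S - 1))) * l powr (P * (S - 1) * a * (- (n - S) / (S - 1)))"
      using M l by (simp add: k_def powr_mult powr_powr)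
    then have "M powr (S / (S - 1)) * k powr (- (n - S) / (S - 1))
        = M powr (S / (S - 1) + a * (- (n - S) / (S - 1))) * l powr (P * (S - 1) * a * (- (n - S) / (S - 1)))"
      by (simp add: powr_add)
    also have "P * (S - 1) * a * (- (n - S) / (S - 1)) = - (P * (n - S) / (n - 1))"
      using n S by (simp add: a_def) (simp add: field_simps)
    also have "S / (S - 1) + a * (- (n - S) / (S - 1)) = n / (n - 1)"
    proof -
      have "S / (S - 1) + a * (- (n - S) / (S - 1)) = (S * (n - 1) - (n - S)) / ((S - 1) * (n - 1))"
      proof -
        have "S / (S - 1) = S * (n - 1) / ((S - 1) * (n - 1))" using n by simp
        moreover have "a * (- (n - S) / (S - 1)) = - (n - S) / ((S - 1) * (n - 1))"
          by (simp add: a_def mult.commute)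
        ultimately show ?thesis by (simp only: add_divide_distrib[symmetric]) simp
      qed
      also have "S * (n - 1) - (n - S) = (S - 1) * n" by (simp add: algebra_simps)
      finally show ?thesis using S by simp
    qed
    finally show ?thesis .
  qed
  have "\<mu> \<le> K * (M powr (S / (S - 1)) * k powr (- (n - S) / (S - 1)) + k * M * l powr (- P))"
    by (rule \<mu>[OF k])
  then show ?thesis unfolding e1 e2 by (simp add: mult.assoc)
qed

theorem theorem5p2:
  fixes \<Omega> :: "(real^'n) set"
    and p :: "real^'n"
    and V :: "real^'n \<Rightarrow> real \<Rightarrow> real"
    and n n' q q' qstar :: real
  assumes "CARD('n) \<ge> 2"
    and "bounded_smooth_domain \<Omega>"
    and "\<And>i. 1 < p$i"
    and "(\<Sum>i\<in>UNIV. 1 / p$i) > 1"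
    and "n = real CARD('n)"
    and "1 / q = 1 / n * (\<Sum>i\<in>UNIV. 1 / p$i)"
    and "qstar = n * q / (n - q)"
    and "q' = q / (q - 1)"
    and "n' = n / (n - 1)"
    and "admissible_potential \<Omega> V"
  shows "\<exists>c>0. \<forall>f\<in>Lp \<Omega> 1. \<forall>u. entropic_renormalized_solution \<Omega> p V f u \<longrightarrow>
    (\<forall>k>0. meas_gt \<Omega> u k \<le> c * Lp_norm \<Omega> 1 f powr (qstar / q) * k powr (- qstar / q')) \<and>
    (\<forall>i. weak_Lp_norm \<Omega> (n' * p$i / q') (\<lambda>x. trunc_grad \<Omega> u x $ i)
           \<le> ennreal (c * Lp_norm \<Omega> 1 f powr (q' / p$i)))"
proof -
  define S where "S = (\<Sum>i\<in>UNIV. 1 / p$i)"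
  have \<Omega>: "open \<Omega>" "bounded \<Omega>" using assms(2) by (auto simp: bounded_smooth_domain_def)
  have p: "1 < p $ i" for i by (rule assms(3))
  have n: "n \<ge> 2" using assms(1,5) by simp
  have S1: "S > 1" using assms(4) by (simp add: S_def)
  have "S < (\<Sum>i\<in>(UNIV::'n set). 1)"
    unfolding S_def using p by (intro sum_strict_mono) (auto simp: divide_less_eq_1)
  then have Sn: "S < n" using assms(5) by simp
  have q: "q = n / S"
  proof -
    have "1 / q = S / n" using assms(6) by (simp add: S_def)
    then have "1 / (1 / q) = 1 / (S / n)" by simp
    then show ?thesis by simp
  qed
  \<comment> \<open>The exponents of the two estimates in terms of \<open>n\<close>, \<open>S\<close> and \<open>p\<close>.\<close>
  have ex1: "qstar / q = S / (S - 1)"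
    unfolding assms(7) q using n S1 by (simp add: field_simps)
  have ex2: "- qstar / q' = - (n - S) / (S - 1)"
    unfolding assms(7,8) q using n S1 Sn by (simp add: field_simps)
  have ex3: "n' * p$i / q' = p $ i * (n - S) / (n - 1)" for i
    unfolding assms(8,9) q using n S1 Sn by (simp add: field_simps)
  have ex4: "n / (n - 1) / (p $ i * (n - S) / (n - 1)) = q' / p $ i" for i
  proof -
    have "q' = n / (n - S)" unfolding assms(8) q using n S1 Sn by (simp add: field_simps)
    then show ?thesis using n by simp
  qed
  define s where "s = n / (S - 1)"
  have s: "s > 0" using n S1 by (simp add: s_def)
  define C where "C = (\<Prod>b\<in>(Basis :: (real^'n) set). 1 + s - s / (p \<bullet> b))"
  have pB: "1 < p \<bullet> b" if "b \<in> Basis" for b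
    using that p by (auto simp: Basis_vec_def inner_axis)
  have C0: "C > 0"
    unfolding C_def
  proof (rule prod_pos)
    fix b :: "real^'n" assume "b \<in> Basis"
    then have "s / (p \<bullet> b) < s" using pB[of b] s by (simp add: divide_less_eq)
    then show "0 < 1 + s - s / (p \<bullet> b)" by linarith
  qed
  \<comment> \<open>\<open>c1\<close> is the constant of the first estimate; \<open>K\<close> also absorbs the factor from the level \<open>k/2\<close>.\<close>
  define c1 where "c1 = C powr (1 / (S - 1))"
  define K where "K = c1 * 2 powr ((n - S) / (S - 1)) + 1"
  define r where "r i = p $ i * (n - S) / (n - 1)" for i
  define c where "c = c1 + (\<Sum>i\<in>UNIV. (2 * K) powr (1 / r i))"
  have c1: "c1 > 0" using C0 by (simp add: c1_def)
  have K1: "K \<ge> 1" using c1 by (simp add: K_def)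
  have r: "r i > 0" for i using p[of i] n Sn by (simp add: r_def)
  have cc1: "c1 \<le> c" unfolding c_def by (simp add: sum_nonneg)
  have ccK: "(2 * K) powr (1 / r i) \<le> c" for i
    unfolding c_def using c1 member_le_sum[of i UNIV "\<lambda>i. (2 * K) powr (1 / r i)"] by simp
  have level: "meas_gt \<Omega> u k \<le> c1 * Lp_norm \<Omega> 1 f powr (S / (S - 1)) * k powr (- (n - S) / (S - 1))"
    if f: "f \<in> Lp \<Omega> 1" and sol: "entropic_renormalized_solution \<Omega> p V f u" and k: "k > 0" for f u k
  proof -
    interpret truncations \<Omega> p u
      using \<Omega> p sol by unfold_locales (auto simp: entropic_renormalized_solution_def)
    define E where "E = k * Lp_norm \<Omega> 1 f"
    define A where "A = (\<integral>x. \<bar>Tu k x\<bar> powr s \<partial>M)"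
    have "integrable M (\<lambda>x. \<bar>Tu k x\<bar> powr s)" "A powr (S - 1) \<le> C * E powr S"
    proof -
      have dim: "DIM(real^'n) \<ge> 2" using assms(1) by simp
      have SB: "S = (\<Sum>b\<in>(Basis :: (real^'n) set). 1 / (p \<bullet> b))"
        by (simp add: sum_Basis_vec inner_axis S_def)
      have sd: "s = real DIM(real^'n) / (S - 1)" using assms(5) by (simp add: s_def)
      have bd: "\<bar>Tu k x\<bar> \<le> k" for x using k by (auto simp: trunc_eq)
      have D: "L1_deriv_limit \<Omega> b (Tu k) (weak_deriv \<Omega> b (Tu k))"
        and int: "integrable M (\<lambda>x. \<bar>weak_deriv \<Omega> b (Tu k) x\<bar> powr (p \<bullet> b))"
        and en: "(\<integral>x. \<bar>weak_deriv \<Omega> b (Tu k) x\<bar> powr (p \<bullet> b) \<partial>M) \<le> E" if bB: "b \<in> Basis" for b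
      proof -
        obtain i where b: "b = axis i 1" using bB by (auto simp: Basis_vec_def)
        show "L1_deriv_limit \<Omega> b (Tu k) (weak_deriv \<Omega> b (Tu k))"
          unfolding b by (rule Tu_limit[OF k])
        show "integrable M (\<lambda>x. \<bar>weak_deriv \<Omega> b (Tu k) x\<bar> powr (p \<bullet> b))"
          unfolding b using dTu_integrable_powr[OF k, of i] by (simp add: inner_axis)
        show "(\<integral>x. \<bar>weak_deriv \<Omega> b (Tu k) x\<bar> powr (p \<bullet> b) \<partial>M) \<le> E"
          unfolding b E_def using energy_estimate[OF assms(10) f sol k, of i] by (simp add: inner_axis)
      qed
      have \<Omega>b: "\<Omega> \<in> sets borel" using \<Omega>(1) by simp
      note sob = anisotropic_sobolev[where p = "\<lambda>b. p \<bullet> b" and g = "\<lambda>b. weak_deriv \<Omega> b (Tu k)",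
          OF dim \<Omega>b finite_M pB SB S1 sd D k bd int en]
      show "integrable M (\<lambda>x. \<bar>Tu k x\<bar> powr s)" by (rule sob(1))
      show "A powr (S - 1) \<le> C * E powr S" unfolding A_def C_def by (rule sob(2))
    qed
    then have "k powr s * meas_gt \<Omega> u k \<le> A" and CE: "A powr (S - 1) \<le> C * E powr S"
      unfolding A_def using measure_level_le[OF k s] by blast+
    note this(1)
    also have "A = (A powr (S - 1)) powr (1 / (S - 1))"
      using S1 by (simp add: powr_powr A_def)
    also have "\<dots> \<le> (C * E powr S) powr (1 / (S - 1))"
      using CE S1 by (intro powr_mono2) auto
    also have "\<dots> = c1 * (k powr (S / (S - 1)) * Lp_norm \<Omega> 1 f powr (S / (S - 1)))"
      using C0 k by (simp add: E_def c1_def powr_mult powr_powr Lp_norm_def)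
    finally have "k powr (- s) * (k powr s * meas_gt \<Omega> u k)
        \<le> k powr (- s) * (c1 * (k powr (S / (S - 1)) * Lp_norm \<Omega> 1 f powr (S / (S - 1))))"
      by (intro mult_left_mono) auto
    also have "\<dots> = c1 * Lp_norm \<Omega> 1 f powr (S / (S - 1)) * (k powr (- s) * k powr (S / (S - 1)))"
      by (simp add: mult_ac)
    also have "k powr (- s) * k powr (S / (S - 1)) = k powr (- (n - S) / (S - 1))"
    proof -
      have "- s + S / (S - 1) = - (n - S) / (S - 1)" by (simp add: s_def diff_divide_distrib)
      then show ?thesis by (simp only: powr_add[symmetric])
    qed
    also have "k powr (- s) * (k powr s * meas_gt \<Omega> u k) = meas_gt \<Omega> u k"
      using k by (simp add: mult.assoc[symmetric] powr_add[symmetric])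
    finally show ?thesis .
  qed
  have grad: "l * meas_gt \<Omega> (\<lambda>x. trunc_grad \<Omega> u x $ i) l powr (1 / r i) \<le> c * Lp_norm \<Omega> 1 f powr (q' / p $ i)"
    if f: "f \<in> Lp \<Omega> 1" and sol: "entropic_renormalized_solution \<Omega> p V f u" and l: "l > 0" for f u l i
  proof -
    interpret truncations \<Omega> p u
      using \<Omega> p sol by unfold_locales (auto simp: entropic_renormalized_solution_def)
    define F where "F = Lp_norm \<Omega> 1 f"
    define \<mu> where "\<mu> = meas_gt \<Omega> (\<lambda>x. trunc_grad \<Omega> u x $ i) l"
    define \<tau> where "\<tau> = S / (S - 1)"
    define \<kappa> where "\<kappa> = (n - S) / (S - 1)"
    have \<kappa>': "- \<kappa> = - (n - S) / (S - 1)" unfolding \<kappa>_def by (rule minus_divide_left)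
    have F0: "F \<ge> 0" by (simp add: F_def Lp_norm_def)
    have \<mu>0: "\<mu> \<ge> 0" by (simp add: \<mu>_def meas_gt_def)
    have bound: "\<mu> \<le> K * (F powr \<tau> * k powr (- \<kappa>) + k * F * l powr (- p $ i))" if k: "k > 0" for k
    proof -
      have "\<mu> \<le> meas_gt \<Omega> u (k / 2) + l powr (- p $ i) * (\<integral>x. \<bar>dTu k i x\<bar> powr p $ i \<partial>M)"
        unfolding \<mu>_def by (rule measure_gradient_le[OF l k])
      also have "meas_gt \<Omega> u (k / 2) \<le> c1 * F powr \<tau> * (k / 2) powr (- \<kappa>)"
        unfolding F_def \<tau>_def \<kappa>' using k by (intro level[OF f sol]) simp
      also have "(k / 2) powr (- \<kappa>) = k powr (- \<kappa>) * 2 powr \<kappa>"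
        using k by (simp add: powr_divide powr_minus_divide)
      also have "l powr (- p $ i) * (\<integral>x. \<bar>dTu k i x\<bar> powr p $ i \<partial>M) \<le> l powr (- p $ i) * (k * F)"
        unfolding F_def by (intro mult_left_mono energy_estimate[OF assms(10) f sol k]) auto
      finally have "\<mu> \<le> (c1 * 2 powr \<kappa>) * (F powr \<tau> * k powr (- \<kappa>)) + 1 * (k * F * l powr (- p $ i))"
        by (simp add: mult_ac)
      also have "\<dots> \<le> K * (F powr \<tau> * k powr (- \<kappa>)) + K * (k * F * l powr (- p $ i))"
        using k F0 c1 K1 by (intro add_mono mult_right_mono) (auto simp: K_def \<kappa>_def)
      finally show ?thesis by (simp add: distrib_left)
    qed
    have "\<mu> \<le> 2 * K * F powr (n / (n - 1)) * l powr (- (p $ i * (n - S) / (n - 1)))"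
    proof (rule level_balance[OF _ S1 Sn])
      show "\<mu> \<le> K * (F powr (S / (S - 1)) * k powr (- (n - S) / (S - 1)) + k * F * l powr (- p $ i))"
        if "k > 0" for k using bound[OF that] unfolding \<tau>_def \<kappa>' .
    qed (use n p[of i] K1 l F0 in auto)
    then have "\<mu> \<le> 2 * K * F powr (n / (n - 1)) * l powr (- r i)" by (simp add: r_def)
    then have "\<mu> powr (1 / r i) \<le> (2 * K * F powr (n / (n - 1)) * l powr (- r i)) powr (1 / r i)"
      using \<mu>0 r[of i] by (intro powr_mono2) auto
    also have "\<dots> = (2 * K) powr (1 / r i) * F powr (n / (n - 1) / r i) * l powr (- 1)"
      using K1 r[of i] l by (simp add: powr_mult powr_powr)
    also have "n / (n - 1) / r i = q' / p $ i" unfolding r_def by (rule ex4)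
    finally have "l * \<mu> powr (1 / r i) \<le> l * ((2 * K) powr (1 / r i) * F powr (q' / p $ i) * l powr (- 1))"
      using l by (intro mult_left_mono) auto
    also have "\<dots> = (2 * K) powr (1 / r i) * F powr (q' / p $ i)"
      using l by (simp add: powr_minus)
    also have "\<dots> \<le> c * F powr (q' / p $ i)" by (intro mult_right_mono ccK) auto
    finally show ?thesis by (simp add: F_def \<mu>_def)
  qed
  have c0: "c > 0" using c1 cc1 by linarith
  have "(\<forall>k>0. meas_gt \<Omega> u k \<le> c * Lp_norm \<Omega> 1 f powr (qstar / q) * k powr (- qstar / q')) \<and>
    (\<forall>i. weak_Lp_norm \<Omega> (n' * p$i / q') (\<lambda>x. trunc_grad \<Omega> u x $ i)
           \<le> ennreal (c * Lp_norm \<Omega> 1 f powr (q' / p$i)))"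
    if f: "f \<in> Lp \<Omega> 1" and sol: "entropic_renormalized_solution \<Omega> p V f u" for f u
  proof (intro conjI allI impI)
    fix k :: real assume k: "k > 0"
    have "meas_gt \<Omega> u k \<le> c1 * Lp_norm \<Omega> 1 f powr (S / (S - 1)) * k powr (- (n - S) / (S - 1))"
      by (rule level[OF f sol k])
    also have "\<dots> \<le> c * Lp_norm \<Omega> 1 f powr (S / (S - 1)) * k powr (- (n - S) / (S - 1))"
      using cc1 by (intro mult_right_mono) auto
    finally show "meas_gt \<Omega> u k \<le> c * Lp_norm \<Omega> 1 f powr (qstar / q) * k powr (- qstar / q')"
      unfolding ex1 ex2 .
  next
    fix i
    show "weak_Lp_norm \<Omega> (n' * p$i / q') (\<lambda>x. trunc_grad \<Omega> u x $ i)
           \<le> ennreal (c * Lp_norm \<Omega> 1 f powr (q' / p$i))"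
      unfolding weak_Lp_norm_def ex3 r_def[symmetric]
      by (intro SUP_least ennreal_leI grad[OF f sol]) simp
  qed
  then show ?thesis using c0 by blast
qed

end
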